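(* Let $B$ be a freely indecomposable group which is not infinite cyclic. Then for any generic tuple $z$ of (non-zero) natural numbers the homogenisation $\bar{f}^{\mathbb{Z}}_z \colon \mathbb{Z} \ast B \to \mathbb{R}$ of the weighted code quasimorphism $f^{\mathbb{Z}}_z$ is an unbounded Aut-invariant quasimorphism on $\mathbb{Z} \ast B$. Moreover, the space of homogeneous Aut-invariant quasimorphisms on $\mathbb{Z} \ast B$ that vanish on letters has infinite dimension.
   Context: A group is freely indecomposable if it is non-trivial and not isomorphic to any free product $G_1 \ast G_2$ with $G_1, G_2$ non-trivial. A map $\psi \colon G \to \mathbb{R}$ is a quasimorphism if there is $D \geq 0$ with $|\psi(g)+\psi(h)-\psi(gh)| \leq D$ for all $g,h \in G$. It is homogeneous if $\psi(g^n) = n\psi(g)$ for all $g \in G$, $n \in \mathbb{Z}$, and Aut-invariant if $\psi(\varphi(g)) = \psi(g)$ for all $g \in G$, $\varphi \in \mathrm{Aut}(G)$. The homogenisation of a quasimorphism $\psi$ is $\bar{\psi}(g) = \lim_{n \to \infty} \psi(g^n)/n$; it is a homogeneous quasimorphism. A letter of $\mathbb{Z} \ast B$ is an element lying in one of the factors $\mathbb{Z}$, $B$. Every element has a unique reduced form: a product of non-identity letters with no two consecutive letters in the same factor. The $\mathbb{Z}$-tuple of $g \in \mathbb{Z} \ast B$ is the ordered tuple $(a_1,\dots,a_k)$ of the (non-zero integer) letters from $\mathbb{Z}$ appearing in the reduced form of $g$. Weighted $\mathbb{Z}$-code: split $(a_1,\dots,a_k)$ into its successive maximal runs of consecutive integers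 all of the same sign; let $x_i$ be the absolute value of the sum of the integers in the $i$-th run. The tuple $(x_1,\dots,x_\ell)$ is the weighted $\mathbb{Z}$-code of $g$. (E.g. the $\mathbb{Z}$-tuple $(7,-2,-4,-1,9,2,-3)$ yields $(7,7,11,3)$.) For a non-empty tuple $z$ of non-zero natural numbers, $\theta^{\mathbb{Z}}_z(g)$ is the (maximal) number of disjoint appearances of $z$ as a tuple of consecutive entries in the weighted $\mathbb{Z}$-code of $g$, and the weighted code quasimorphism is $f^{\mathbb{Z}}_z(g) = \theta^{\mathbb{Z}}_z(g) - \theta^{\mathbb{Z}}_z(g^{-1})$ (it is a quasimorphism). A tuple $z = (n_1,\dots,n_k)$ of non-zero natural numbers is generic if the reversed tuple $\bar{z} = (n_k,\dots,n_1)$ does not appear as a tuple of $k$ adjacent entries in $z^2 = (n_1,\dots,n_k,n_1,\dots,n_k)$. *)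

theory Defs
  imports
    Complex_Main
    "HOL-Algebra.Elementary_Groups"
    "HOL-Algebra.Bij"
    "HOL-Library.Sublist"
    "HOL-Library.Function_Algebras"
begin

section \<open>Free products\<close>

text \<open>
  The free product of \<open>G\<close> and \<open>H\<close> is realised on reduced words: lists of non-identity letters,
  tagged \<open>Inl\<close> or \<open>Inr\<close> by the factor they come from, in which the two factors alternate.
\<close>

definition reduced_word ::
  "('a, 'm) monoid_scheme \<Rightarrow> ('b, 'n) monoid_scheme \<Rightarrow> ('a + 'b) list \<Rightarrow> bool" where
  "reduced_word G H w \<longleftrightarrow>
     set w \<subseteq> Inl ` (carrier G - {\<one>\<^bsub>G\<^esub>}) \<union> Inr ` (carrier H - {\<one>\<^bsub>H\<^esub>}) \<and>
     successively (\<lambda>x y. isl x \<noteq> isl y) w"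

definition fp_inl :: "('a, 'm) monoid_scheme \<Rightarrow> 'a \<Rightarrow> ('a + 'b) list" where
  "fp_inl G a = (if a = \<one>\<^bsub>G\<^esub> then [] else [Inl a])"

definition fp_inr :: "('b, 'n) monoid_scheme \<Rightarrow> 'b \<Rightarrow> ('a + 'b) list" where
  "fp_inr H b = (if b = \<one>\<^bsub>H\<^esub> then [] else [Inr b])"

text \<open>Left multiplication of a reduced word by a single (possibly trivial) letter.\<close>

fun fp_cons ::
  "('a, 'm) monoid_scheme \<Rightarrow> ('b, 'n) monoid_scheme \<Rightarrow> 'a + 'b \<Rightarrow> ('a + 'b) list \<Rightarrow> ('a + 'b) list"
where
  "fp_cons G H (Inl a) (Inl b # w) = fp_inl G (a \<otimes>\<^bsub>G\<^esub> b) @ w"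
| "fp_cons G H (Inr a) (Inr b # w) = fp_inr H (a \<otimes>\<^bsub>H\<^esub> b) @ w"
| "fp_cons G H (Inl a) w = fp_inl G a @ w"
| "fp_cons G H (Inr a) w = fp_inr H a @ w"

definition free_product ::
  "('a, 'm) monoid_scheme \<Rightarrow> ('b, 'n) monoid_scheme \<Rightarrow> ('a + 'b) list monoid" where
  "free_product G H =
     \<lparr>carrier = {w. reduced_word G H w}, monoid.mult = foldr (fp_cons G H), one = []\<rparr>"

lemma free_product_simps [simp]:
  "carrier (free_product G H) = {w. reduced_word G H w}"
  "u \<otimes>\<^bsub>free_product G H\<^esub> v = foldr (fp_cons G H) u v"
  "\<one>\<^bsub>free_product G H\<^esub> = []"
  by (simp_all add: free_product_def)

definition letters ::
  "('a, 'm) monoid_scheme \<Rightarrow> ('b, 'n) monoid_scheme \<Rightarrow> ('a + 'b) list set" where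
  "letters G H = fp_inl G ` carrier G \<union> fp_inr H ` carrier H"

text \<open>
  The factors \<open>G1\<close> and \<open>G2\<close> may be taken with elements in the type of \<open>G\<close>: a free product
  isomorphic to \<open>G\<close> has factors that embed into \<open>G\<close>; see \<open>freely_indecomposableD\<close> below.
\<close>

definition freely_indecomposable :: "('a, 'm) monoid_scheme \<Rightarrow> bool" where
  "freely_indecomposable G \<longleftrightarrow>
     carrier G \<noteq> {\<one>\<^bsub>G\<^esub>} \<and>
     (\<forall>(G1 :: 'a monoid) (G2 :: 'a monoid).
        group G1 \<and> group G2 \<and> carrier G1 \<noteq> {\<one>\<^bsub>G1\<^esub>} \<and> carrier G2 \<noteq> {\<one>\<^bsub>G2\<^esub>} \<longrightarrow>
        \<not> G \<cong> free_product G1 G2)"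


section \<open>Quasimorphisms\<close>

definition quasimorphism :: "('g, 'm) monoid_scheme \<Rightarrow> ('g \<Rightarrow> real) \<Rightarrow> bool" where
  "quasimorphism G \<psi> \<longleftrightarrow>
     (\<exists>D\<ge>0. \<forall>g\<in>carrier G. \<forall>h\<in>carrier G. \<bar>\<psi> g + \<psi> h - \<psi> (g \<otimes>\<^bsub>G\<^esub> h)\<bar> \<le> D)"

definition homogeneous :: "('g, 'm) monoid_scheme \<Rightarrow> ('g \<Rightarrow> real) \<Rightarrow> bool" where
  "homogeneous G \<psi> \<longleftrightarrow> (\<forall>g\<in>carrier G. \<forall>n::int. \<psi> (g [^]\<^bsub>G\<^esub> n) = of_int n * \<psi> g)"

definition Aut_invariant :: "('g, 'm) monoid_scheme \<Rightarrow> ('g \<Rightarrow> real) \<Rightarrow> bool" where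
  "Aut_invariant G \<psi> \<longleftrightarrow> (\<forall>g\<in>carrier G. \<forall>\<phi>\<in>auto G. \<psi> (\<phi> g) = \<psi> g)"

definition unbounded_on :: "'g set \<Rightarrow> ('g \<Rightarrow> real) \<Rightarrow> bool" where
  "unbounded_on A \<psi> \<longleftrightarrow> (\<forall>M. \<exists>g\<in>A. \<bar>\<psi> g\<bar> > M)"

definition homogenisation :: "('g, 'm) monoid_scheme \<Rightarrow> ('g \<Rightarrow> real) \<Rightarrow> 'g \<Rightarrow> real" where
  "homogenisation G \<psi> g = lim (\<lambda>n::nat. \<psi> (g [^]\<^bsub>G\<^esub> n) / real n)"


section \<open>Weighted codes\<close>

definition Z_tuple :: "(int + 'b) list \<Rightarrow> int list" where
  "Z_tuple w = [a. Inl a \<leftarrow> w]"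

text \<open>The decomposition of a tuple into maximal runs of consecutive entries of the same sign.\<close>

fun sign_runs :: "int list \<Rightarrow> int list list" where
  "sign_runs [] = []"
| "sign_runs (a # as) =
     (case sign_runs as of
        [] \<Rightarrow> [[a]]
      | r # rs \<Rightarrow> if sgn a = sgn (hd r) then (a # r) # rs else [a] # r # rs)"

definition weighted_code :: "(int + 'b) list \<Rightarrow> nat list" where
  "weighted_code w = map (\<lambda>r. nat \<bar>sum_list r\<bar>) (sign_runs (Z_tuple w))"

lemma "map (\<lambda>r. nat \<bar>sum_list r\<bar>) (sign_runs [7, -2, -4, -1, 9, 2, -3]) = [7, 7, 11, 3]"
  by simp

text \<open>Starting positions of the appearances of a non-empty tuple \<open>z\<close> in \<open>xs\<close>.\<close>

definition appearances :: "'a list \<Rightarrow> 'a list \<Rightarrow> nat set" where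
  "appearances z xs = {i. i + length z \<le> length xs \<and> take (length z) (drop i xs) = z}"

definition max_disjoint_appearances :: "'a list \<Rightarrow> 'a list \<Rightarrow> nat" where
  "max_disjoint_appearances z xs =
     Max {card S | S. S \<subseteq> appearances z xs \<and> (\<forall>i\<in>S. \<forall>j\<in>S. i < j \<longrightarrow> i + length z \<le> j)}"

definition theta_Z :: "nat list \<Rightarrow> (int + 'b) list \<Rightarrow> nat" where
  "theta_Z z g = max_disjoint_appearances z (weighted_code g)"

definition weighted_code_qm ::
  "('b, 'm) monoid_scheme \<Rightarrow> nat list \<Rightarrow> (int + 'b) list \<Rightarrow> real" where
  "weighted_code_qm B z g =
     real (theta_Z z g) - real (theta_Z z (inv\<^bsub>free_product integer_group B\<^esub> g))"

definition generic :: "nat list \<Rightarrow> bool" where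
  "generic z \<longleftrightarrow> z \<noteq> [] \<and> 0 \<notin> set z \<and> \<not> sublist (rev z) (z @ z)"


section \<open>Spaces of real functions\<close>

definition fun_scale :: "real \<Rightarrow> ('a \<Rightarrow> real) \<Rightarrow> 'a \<Rightarrow> real" where
  "fun_scale c f = (\<lambda>x. c * f x)"

interpretation fun_space: vector_space "fun_scale :: real \<Rightarrow> ('a \<Rightarrow> real) \<Rightarrow> 'a \<Rightarrow> real"
  by unfold_locales (simp_all add: fun_scale_def fun_eq_iff algebra_simps)

definition infinite_dimensional :: "('a \<Rightarrow> real) set \<Rightarrow> bool" where
  "infinite_dimensional V \<longleftrightarrow> \<not> (\<exists>S. finite S \<and> S \<subseteq> V \<and> V \<subseteq> fun_space.span S)"

text \<open>
  A function on the group is represented by a function on the whole type that is zero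
  off the carrier, so that distinct elements of the space differ somewhere on the group.
\<close>

definition Aut_qm_vanishing_on_letters ::
  "('b, 'm) monoid_scheme \<Rightarrow> ((int + 'b) list \<Rightarrow> real) set" where
  "Aut_qm_vanishing_on_letters B =
     {\<psi>. (\<forall>g. g \<notin> carrier (free_product integer_group B) \<longrightarrow> \<psi> g = 0) \<and>
          quasimorphism (free_product integer_group B) \<psi> \<and>
          homogeneous (free_product integer_group B) \<psi> \<and>
          Aut_invariant (free_product integer_group B) \<psi> \<and>
          (\<forall>g\<in>letters integer_group B. \<psi> g = 0)}"

lemma subspace_Aut_qm_vanishing_on_letters:
  "fun_space.subspace (Aut_qm_vanishing_on_letters B)"
proof -
  let ?P = "free_product integer_group B"
  have "quasimorphism ?P (\<lambda>_. 0)" by (auto simp: quasimorphism_def intro: exI[of _ 0])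
  moreover have "quasimorphism ?P (\<lambda>x. f x + g x)" if fg: "quasimorphism ?P f" "quasimorphism ?P g" for f g
  proof -
    from fg obtain D E where "D \<ge> 0" "E \<ge> 0"
      and D: "\<And>x y. x \<in> carrier ?P \<Longrightarrow> y \<in> carrier ?P \<Longrightarrow> \<bar>f x + f y - f (x \<otimes>\<^bsub>?P\<^esub> y)\<bar> \<le> D"
      and E: "\<And>x y. x \<in> carrier ?P \<Longrightarrow> y \<in> carrier ?P \<Longrightarrow> \<bar>g x + g y - g (x \<otimes>\<^bsub>?P\<^esub> y)\<bar> \<le> E"
      unfolding quasimorphism_def by blast
    have "\<bar>(f x + g x) + (f y + g y) - (f (x \<otimes>\<^bsub>?P\<^esub> y) + g (x \<otimes>\<^bsub>?P\<^esub> y))\<bar> \<le> D + E"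
      if "x \<in> carrier ?P" "y \<in> carrier ?P" for x y
      using D[OF that] E[OF that] by linarith
    then show ?thesis
      using \<open>D \<ge> 0\<close> \<open>E \<ge> 0\<close> unfolding quasimorphism_def by (intro exI[of _ "D + E"]) simp
  qed
  moreover have "quasimorphism ?P (\<lambda>x. c * f x)" if "quasimorphism ?P f" for c f
  proof -
    from that obtain D where "D \<ge> 0"
      and D: "\<And>x y. x \<in> carrier ?P \<Longrightarrow> y \<in> carrier ?P \<Longrightarrow> \<bar>f x + f y - f (x \<otimes>\<^bsub>?P\<^esub> y)\<bar> \<le> D"
      unfolding quasimorphism_def by blast
    have "\<bar>c * f x + c * f y - c * f (x \<otimes>\<^bsub>?P\<^esub> y)\<bar> \<le> \<bar>c\<bar> * D"
      if "x \<in> carrier ?P" "y \<in> carrier ?P" for x y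
      using mult_left_mono[OF D[OF that], of "\<bar>c\<bar>"]
      by (simp add: abs_mult[symmetric] algebra_simps)
    then show ?thesis
      using \<open>D \<ge> 0\<close> unfolding quasimorphism_def by (intro exI[of _ "\<bar>c\<bar> * D"]) simp
  qed
  ultimately show ?thesis
    unfolding fun_space.subspace_def Aut_qm_vanishing_on_letters_def
    by (simp add: fun_scale_def homogeneous_def Aut_invariant_def plus_fun_def zero_fun_def algebra_simps)
qed


section \<open>The group structure of the free product\<close>

lemma reduced_word_Cons:
  "reduced_word G H (x # w) \<longleftrightarrow>
     x \<in> Inl ` (carrier G - {\<one>\<^bsub>G\<^esub>}) \<union> Inr ` (carrier H - {\<one>\<^bsub>H\<^esub>}) \<and>
     reduced_word G H w \<and> (w \<noteq> [] \<longrightarrow> isl x \<noteq> isl (hd w))"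
  by (cases w) (auto simp: reduced_word_def)

lemma reduced_word_Nil [simp]: "reduced_word G H []"
  by (simp add: reduced_word_def)

context
  fixes G :: "('a, 'm) monoid_scheme" and H :: "('b, 'n) monoid_scheme"
  assumes G: "group G" and H: "group H"
begin

interpretation G: group G by (fact G)
interpretation H: group H by (fact H)

lemma fp_cons_reduced:
  assumes "x \<in> Inl ` carrier G \<union> Inr ` carrier H" "reduced_word G H w"
  shows "reduced_word G H (fp_cons G H x w)"
  using assms
  by (cases "(G, H, x, w)" rule: fp_cons.cases)
     (auto simp: reduced_word_Cons fp_inl_def fp_inr_def)

lemma foldr_fp_cons_reduced:
  assumes "set u \<subseteq> Inl ` carrier G \<union> Inr ` carrier H" "reduced_word G H v"
  shows "reduced_word G H (foldr (fp_cons G H) u v)"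
  using assms by (induction u) (auto intro!: fp_cons_reduced)

lemma reduced_word_subset:
  "reduced_word G H w \<Longrightarrow> set w \<subseteq> Inl ` carrier G \<union> Inr ` carrier H"
  by (auto simp: reduced_word_def)

lemma fp_cons_one:
  assumes "reduced_word G H w"
  shows "fp_cons G H (Inl \<one>\<^bsub>G\<^esub>) w = w" "fp_cons G H (Inr \<one>\<^bsub>H\<^esub>) w = w"
  using assms
  by (cases w; cases "hd w"; auto simp: reduced_word_Cons fp_inl_def fp_inr_def)+

lemma fp_cons_Inl_Inl:
  assumes "a \<in> carrier G" "b \<in> carrier G" "reduced_word G H w"
  shows "fp_cons G H (Inl a) (fp_cons G H (Inl b) w) = fp_cons G H (Inl (a \<otimes>\<^bsub>G\<^esub> b)) w"
proof -
  consider "w = []" | c v where "w = Inl c # v" | c v where "w = Inr c # v"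
    by (metis list.exhaust sum.exhaust)
  then show ?thesis
  proof cases
    case 2
    then have "v = [] \<or> (\<exists>d v'. v = Inr d # v')" 
      using assms by (cases v; cases "hd v") (auto simp: reduced_word_Cons)
    moreover have "b \<otimes>\<^bsub>G\<^esub> c = \<one>\<^bsub>G\<^esub> \<Longrightarrow> a \<otimes>\<^bsub>G\<^esub> b \<otimes>\<^bsub>G\<^esub> c = a"
      using assms 2 by (auto simp: reduced_word_Cons G.m_assoc)
    ultimately show ?thesis
      using 2 assms by (auto simp: fp_inl_def reduced_word_Cons G.m_assoc)
  qed (use assms in \<open>auto simp: fp_inl_def\<close>)
qed

lemma fp_cons_Inr_Inr:
  assumes "a \<in> carrier H" "b \<in> carrier H" "reduced_word G H w"
  shows "fp_cons G H (Inr a) (fp_cons G H (Inr b) w) = fp_cons G H (Inr (a \<otimes>\<^bsub>H\<^esub> b)) w"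
proof -
  consider "w = []" | c v where "w = Inr c # v" | c v where "w = Inl c # v"
    by (metis list.exhaust sum.exhaust)
  then show ?thesis
  proof cases
    case 2
    then have "v = [] \<or> (\<exists>d v'. v = Inl d # v')" 
      using assms by (cases v; cases "hd v") (auto simp: reduced_word_Cons)
    moreover have "b \<otimes>\<^bsub>H\<^esub> c = \<one>\<^bsub>H\<^esub> \<Longrightarrow> a \<otimes>\<^bsub>H\<^esub> b \<otimes>\<^bsub>H\<^esub> c = a"
      using assms 2 by (auto simp: reduced_word_Cons H.m_assoc)
    ultimately show ?thesis
      using 2 assms by (auto simp: fp_inr_def reduced_word_Cons H.m_assoc)
  qed (use assms in \<open>auto simp: fp_inr_def\<close>)
qed

lemma foldr_fp_cons_fp_cons:
  assumes "x \<in> Inl ` carrier G \<union> Inr ` carrier H" "reduced_word G H u" "reduced_word G H v"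
  shows "foldr (fp_cons G H) (fp_cons G H x u) v = fp_cons G H x (foldr (fp_cons G H) u v)"
proof -
  have red: "reduced_word G H (foldr (fp_cons G H) w v)" if "reduced_word G H w" for w
    using that assms by (intro foldr_fp_cons_reduced reduced_word_subset)
  consider (ll) a b w where "x = Inl a" "u = Inl b # w"
    | (rr) a b w where "x = Inr a" "u = Inr b # w"
    | (l) a where "x = Inl a" "fp_cons G H x u = fp_inl G a @ u"
    | (r) b where "x = Inr b" "fp_cons G H x u = fp_inr H b @ u"
    by (cases x; cases u; cases "hd u") auto
  then show ?thesis
  proof cases
    case ll
    with assms red[of w] show ?thesis
      by (auto simp: fp_inl_def fp_cons_Inl_Inl reduced_word_Cons fp_cons_one)
  next
    case rr
    with assms red[of w] show ?thesis
      by (auto simp: fp_inr_def fp_cons_Inr_Inr reduced_word_Cons fp_cons_one)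
  next
    case l
    with assms red[of u] show ?thesis
      by (auto simp: fp_inl_def fp_cons_one)
  next
    case r
    with assms red[of u] show ?thesis
      by (auto simp: fp_inr_def fp_cons_one)
  qed
qed

lemma foldr_fp_cons_foldr_fp_cons:
  assumes "set u \<subseteq> Inl ` carrier G \<union> Inr ` carrier H" "reduced_word G H v" "reduced_word G H w"
  shows "foldr (fp_cons G H) (foldr (fp_cons G H) u v) w =
         foldr (fp_cons G H) u (foldr (fp_cons G H) v w)"
  using assms
  by (induction u) (auto simp: foldr_fp_cons_fp_cons foldr_fp_cons_reduced)

lemma foldr_fp_cons_Nil:
  assumes "reduced_word G H w"
  shows "foldr (fp_cons G H) w [] = w"
  using assms
proof (induction w)
  case (Cons x w)
  then show ?case
    by (cases "(G, H, x, w)" rule: fp_cons.cases) (auto simp: reduced_word_Cons fp_inl_def fp_inr_def)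
qed simp

lemma fp_left_inverse:
  assumes "reduced_word G H w"
  shows "\<exists>v. reduced_word G H v \<and> foldr (fp_cons G H) v w = []"
  using assms
proof (induction w)
  case (Cons x w)
  then obtain v where v: "reduced_word G H v" "foldr (fp_cons G H) v w = []"
    by (auto simp: reduced_word_Cons)
  define y where "y = map_sum (m_inv G) (m_inv H) x"
  have y: "y \<in> Inl ` carrier G \<union> Inr ` carrier H" "fp_cons G H y (x # w) = w"
    "reduced_word G H [y]"
    using Cons.prems by (auto simp: y_def reduced_word_Cons fp_inl_def fp_inr_def)
  have "foldr (fp_cons G H) (foldr (fp_cons G H) v [y]) (x # w) = []"
    using y v Cons.prems
    by (subst foldr_fp_cons_foldr_fp_cons) (auto dest: reduced_word_subset)
  then show ?case
    using foldr_fp_cons_reduced[OF reduced_word_subset[OF v(1)] y(3)] by blast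
qed (auto intro: exI[of _ "[]"])

lemma group_free_product: "group (free_product G H)"
  by (rule groupI)
     (auto simp: foldr_fp_cons_reduced reduced_word_subset foldr_fp_cons_foldr_fp_cons fp_left_inverse)

lemma fp_inl_hom: "fp_inl G \<in> hom G (free_product G H)"
  by (auto simp: hom_def fp_inl_def reduced_word_Cons)

lemma fp_inr_hom: "fp_inr H \<in> hom H (free_product G H)"
  by (auto simp: hom_def fp_inr_def reduced_word_Cons)

end

lemma inj_fp_inl: "inj_on (fp_inl G) A" and inj_fp_inr: "inj_on (fp_inr H) B"
  by (auto simp: inj_on_def fp_inl_def fp_inr_def split: if_splits)

lemma iso_image_group:
  assumes "group K" "group G" "f \<in> hom K G" "inj_on f (carrier K)"
  shows "group \<lparr>carrier = f ` carrier K, monoid.mult = monoid.mult G, one = \<one>\<^bsub>G\<^esub>\<rparr>"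
    and "f \<in> iso K \<lparr>carrier = f ` carrier K, monoid.mult = monoid.mult G, one = \<one>\<^bsub>G\<^esub>\<rparr>"
proof -
  interpret group_hom K G f
    using assms by (simp add: group_hom_def group_hom_axioms_def)
  show "group \<lparr>carrier = f ` carrier K, monoid.mult = monoid.mult G, one = \<one>\<^bsub>G\<^esub>\<rparr>"
  proof (rule groupI, goal_cases)
    case (5 x)
    then obtain k where k: "k \<in> carrier K" "x = f k" by auto
    have "f (inv\<^bsub>K\<^esub> k) \<otimes>\<^bsub>G\<^esub> f k = \<one>\<^bsub>G\<^esub>"
      using k by (metis G.inv_closed G.l_inv hom_mult hom_one)
    with k have "\<exists>y\<in>carrier K. f y \<otimes>\<^bsub>G\<^esub> f k = \<one>\<^bsub>G\<^esub>" by (metis G.inv_closed)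
    with k show ?case by auto
  next
    case (1 x y)
    then obtain k l where k: "k \<in> carrier K" "l \<in> carrier K" "x = f k" "y = f l" by auto
    then have "f k \<otimes>\<^bsub>G\<^esub> f l \<in> f ` carrier K"
      by (metis G.m_closed hom_mult imageI)
    then show ?case using k by simp
  next
    case 2
    have "\<one>\<^bsub>G\<^esub> \<in> f ` carrier K" by (metis G.one_closed hom_one imageI)
    then show ?case by simp
  qed (auto simp: H.m_assoc)
  show "f \<in> iso K \<lparr>carrier = f ` carrier K, monoid.mult = monoid.mult G, one = \<one>\<^bsub>G\<^esub>\<rparr>"
    using assms(3,4) by (auto simp: iso_def hom_def bij_betw_def)
qed

lemma free_product_iso:
  assumes "group G" "group H" "group G'" "group H'" "f \<in> iso G G'" "g \<in> iso H H'"
  shows "map (map_sum f g) \<in> iso (free_product G H) (free_product G' H')"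
proof -
  have f: "f \<in> hom G G'" "bij_betw f (carrier G) (carrier G')"
   and g: "g \<in> hom H H'" "bij_betw g (carrier H) (carrier H')"
    using assms by (auto simp: iso_def)
  have f1: "f a = \<one>\<^bsub>G'\<^esub> \<longleftrightarrow> a = \<one>\<^bsub>G\<^esub>" if "a \<in> carrier G" for a
    using f assms(1,3) that
    by (metis bij_betw_imp_inj_on group.is_monoid hom_one inj_onD monoid.one_closed)
  have g1: "g a = \<one>\<^bsub>H'\<^esub> \<longleftrightarrow> a = \<one>\<^bsub>H\<^esub>" if "a \<in> carrier H" for a
    using g assms(2,4) that
    by (metis bij_betw_imp_inj_on group.is_monoid hom_one inj_onD monoid.one_closed)
  note fg1 = f1 g1
  let ?m = "map (map_sum f g)"
  have f_cl: "f a \<in> carrier G'" if "a \<in> carrier G" for a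
    using f(1) that by (auto simp: hom_def)
  have g_cl: "g a \<in> carrier H'" if "a \<in> carrier H" for a
    using g(1) that by (auto simp: hom_def)
  have isl: "isl (map_sum f g z) = isl z" for z by (cases z) auto
  have red: "reduced_word G' H' (?m w)" if "reduced_word G H w" for w
    using that
  proof (induction w)
    case (Cons x w)
    have "map_sum f g x \<in> Inl ` (carrier G' - {\<one>\<^bsub>G'\<^esub>}) \<union> Inr ` (carrier H' - {\<one>\<^bsub>H'\<^esub>})"
      using Cons.prems fg1 f_cl g_cl by (cases x) (simp_all add: reduced_word_Cons image_iff)
    then show ?case
      using Cons by (simp add: reduced_word_Cons hd_map isl)
  qed simp
  have cons: "?m (fp_cons G H x w) = fp_cons G' H' (map_sum f g x) (?m w)"
    if "x \<in> Inl ` carrier G \<union> Inr ` carrier H" "reduced_word G H w" for x w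
  proof -
    have inl: "?m (fp_inl G a) = fp_inl G' (f a)" if "a \<in> carrier G" for a
      using f1[OF that] by (simp add: fp_inl_def)
    have inr: "?m (fp_inr H a) = fp_inr H' (g a)" if "a \<in> carrier H" for a
      using g1[OF that] by (simp add: fp_inr_def)
    have fm: "f a \<otimes>\<^bsub>G'\<^esub> f b = f (a \<otimes>\<^bsub>G\<^esub> b)" if "a \<in> carrier G" "b \<in> carrier G" for a b
      using f(1) that by (simp add: hom_mult)
    have gm: "g a \<otimes>\<^bsub>H'\<^esub> g b = g (a \<otimes>\<^bsub>H\<^esub> b)" if "a \<in> carrier H" "b \<in> carrier H" for a b
      using g(1) that by (simp add: hom_mult)
    have Gm: "a \<otimes>\<^bsub>G\<^esub> b \<in> carrier G" if "a \<in> carrier G" "b \<in> carrier G" for a b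
      using assms(1) that by (simp add: group.is_monoid monoid.m_closed)
    have Hm: "a \<otimes>\<^bsub>H\<^esub> b \<in> carrier H" if "a \<in> carrier H" "b \<in> carrier H" for a b
      using assms(2) that by (simp add: group.is_monoid monoid.m_closed)
    consider (ll) a b v where "x = Inl a" "w = Inl b # v"
      | (rr) a b v where "x = Inr a" "w = Inr b # v"
      | (lr) a b v where "x = Inl a" "w = Inr b # v"
      | (rl) a b v where "x = Inr a" "w = Inl b # v"
      | (l) a where "x = Inl a" "w = []" | (r) a where "x = Inr a" "w = []"
    proof -
      have "w = [] \<or> (\<exists>b v. w = Inl b # v) \<or> (\<exists>b v. w = Inr b # v)"
        by (metis list.exhaust sum.exhaust)
      then show thesis using ll rr lr rl l r by (cases x) blast+
    qed
    then show ?thesis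
      using that
      by cases (auto simp: reduced_word_Cons inl inr fm gm Gm Hm)
  qed
  have mult: "?m (foldr (fp_cons G H) u v) = foldr (fp_cons G' H') (?m u) (?m v)"
    if "set u \<subseteq> Inl ` carrier G \<union> Inr ` carrier H" "reduced_word G H v" for u v
    using that by (induction u) (auto simp: cons foldr_fp_cons_reduced assms)
  have "inj_on (map_sum f g) (Inl ` carrier G \<union> Inr ` carrier H)"
    using inj_onD[OF bij_betw_imp_inj_on[OF f(2)]] inj_onD[OF bij_betw_imp_inj_on[OF g(2)]]
    by (intro inj_onI) auto
  from inj_on_map_lists[OF this] have inj: "inj_on ?m {w. reduced_word G H w}"
    by (rule inj_on_subset) (auto dest: reduced_word_subset[OF assms(1,2)])
  have "w \<in> ?m ` {w. reduced_word G H w}" if "reduced_word G' H' w" for w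
    using that
  proof (induction w)
    case (Cons y w)
    then obtain v where v: "reduced_word G H v" "w = ?m v" by (auto simp: reduced_word_Cons)
    have "\<exists>x. y = map_sum f g x \<and> x \<in> Inl ` (carrier G - {\<one>\<^bsub>G\<^esub>}) \<union> Inr ` (carrier H - {\<one>\<^bsub>H\<^esub>})"
    proof (cases y)
      case (Inl a)
      then obtain a' where "a' \<in> carrier G" "a = f a'"
        using Cons.prems bij_betw_imp_surj_on[OF f(2)] by (auto simp: reduced_word_Cons)
      then show ?thesis
        using Inl Cons.prems fg1 by (intro exI[of _ "Inl a'"]) (auto simp: reduced_word_Cons)
    next
      case (Inr b)
      then obtain b' where "b' \<in> carrier H" "b = g b'"
        using Cons.prems bij_betw_imp_surj_on[OF g(2)] by (auto simp: reduced_word_Cons)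
      then show ?thesis
        using Inr Cons.prems fg1 by (intro exI[of _ "Inr b'"]) (auto simp: reduced_word_Cons)
    qed
    then obtain x where x: "y = map_sum f g x"
      "x \<in> Inl ` (carrier G - {\<one>\<^bsub>G\<^esub>}) \<union> Inr ` (carrier H - {\<one>\<^bsub>H\<^esub>})" by blast
    have "reduced_word G H (x # v)"
      using Cons.prems v x by (auto simp: reduced_word_Cons hd_map isl)
    then have "?m (x # v) \<in> ?m ` {w. reduced_word G H w}" by blast
    then show ?case using v x by simp
  qed auto
  with red have "?m ` {w. reduced_word G H w} = {w. reduced_word G' H' w}"
    by auto
  with inj have "bij_betw ?m (carrier (free_product G H)) (carrier (free_product G' H'))"
    by (simp add: bij_betw_def)
  moreover have "?m \<in> hom (free_product G H) (free_product G' H')"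
    using red mult by (simp add: hom_def reduced_word_subset assms)
  ultimately show ?thesis
    by (simp add: iso_def)
qed

text \<open>Free indecomposability excludes decompositions with factors in arbitrary types.\<close>

lemma freely_indecomposableD:
  fixes G :: "('a, 'm) monoid_scheme"
    and G1 :: "('c, 'k) monoid_scheme" and G2 :: "('d, 'l) monoid_scheme"
  assumes ind: "freely_indecomposable G" and grp: "group G" "group G1" "group G2"
    and non: "carrier G1 \<noteq> {\<one>\<^bsub>G1\<^esub>}" "carrier G2 \<noteq> {\<one>\<^bsub>G2\<^esub>}"
  shows "\<not> G \<cong> free_product G1 G2"
proof
  assume iso: "G \<cong> free_product G1 G2"
  then obtain h where h: "h \<in> iso (free_product G1 G2) G"
    using grp by (metis group.iso_sym is_iso_def ex_in_conv)
  define K1 K2 where "K1 = \<lparr>carrier = (h \<circ> fp_inl G1) ` carrier G1, monoid.mult = monoid.mult G, one = \<one>\<^bsub>G\<^esub>\<rparr>"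
    and "K2 = \<lparr>carrier = (h \<circ> fp_inr G2) ` carrier G2, monoid.mult = monoid.mult G, one = \<one>\<^bsub>G\<^esub>\<rparr>"
  have hom: "h \<circ> fp_inl G1 \<in> hom G1 G" "h \<circ> fp_inr G2 \<in> hom G2 G"
    using h fp_inl_hom[OF grp(2,3)] fp_inr_hom[OF grp(2,3)] by (auto simp: iso_def intro: hom_compose simp del: free_product_simps)
  have inj: "inj_on (h \<circ> fp_inl G1) (carrier G1)" "inj_on (h \<circ> fp_inr G2) (carrier G2)"
    using h fp_inl_hom[OF grp(2,3)] fp_inr_hom[OF grp(2,3)]
    by (auto intro!: comp_inj_on inj_fp_inl inj_fp_inr elim!: inj_on_subset simp: iso_def bij_betw_def hom_def)
  note K1 = iso_image_group[OF grp(2,1) hom(1) inj(1), folded K1_def]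
  note K2 = iso_image_group[OF grp(3,1) hom(2) inj(2), folded K2_def]
  have "G \<cong> free_product K1 K2"
    using iso_trans[OF iso] free_product_iso[OF grp(2,3) K1(1) K2(1) K1(2) K2(2)]
    by (auto simp: is_iso_def)
  moreover have "carrier K1 \<noteq> {\<one>\<^bsub>K1\<^esub>}"
  proof 
    assume "carrier K1 = {\<one>\<^bsub>K1\<^esub>}"
    with K1(2) have "card (carrier G1) = card {\<one>\<^bsub>K1\<^esub>}"
      by (metis iso_same_card is_isoI)
    then show False using non(1) grp(2) 
      by (metis card_1_singletonE group.is_monoid is_singletonI is_singleton_altdef monoid.one_closed singletonD)
  qed
  moreover have "carrier K2 \<noteq> {\<one>\<^bsub>K2\<^esub>}"
  proof 
    assume "carrier K2 = {\<one>\<^bsub>K2\<^esub>}"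
    with K2(2) have "card (carrier G2) = card {\<one>\<^bsub>K2\<^esub>}"
      by (metis iso_same_card is_isoI)
    then show False using non(2) grp(3) 
      by (metis card_1_singletonE group.is_monoid is_singletonI is_singleton_altdef monoid.one_closed singletonD)
  qed
  ultimately show False
    using ind K1(1) K2(1) unfolding freely_indecomposable_def by blast
qed

end

theory Submission
  imports Defs
begin

text \<open>
  Let \<open>P\<close> be the free product of the integers, generated by \<open>t\<close>, with \<open>B\<close>, acting on the tree with
  vertices \<open>g B\<close> and edges from \<open>g B\<close> to \<open>g t B\<close>. Edge stabilisers are trivial, so a subgroup that
  translates a half-tree into itself is infinite cyclic or a non-trivial free product: collapse all edges outside
  the orbit of one translated edge and play ping-pong. Hence every automorphism sends \<open>B\<close> to a
  conjugate of \<open>B\<close>, and after an inner automorphism it maps \<open>B\<close> to itself and \<open>t\<close> to \<open>c t\<close> or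
  \<open>c t\<^sup>-\<^sup>1\<close> with \<open>c\<close> in \<open>B\<close>. Such an automorphism preserves the weighted code, because only letters
  \<open>t\<close> of opposite sign cancel. Homogeneous quasimorphisms are invariant under conjugation, so the homogenised
  code quasimorphisms are invariant under all automorphisms. They are unbounded on elements whose powers have
  code \<open>z \<dots> z\<close>, and independent for generic tuples without common entries.
\<close>

text \<open>The tree is never built: an element stands for the vertex or edge that it names, and
  half-trees are sets of reduced words with a given sign at the start. Integers are split into unit
  steps, so that each step crosses one edge and lengths and first steps obey the rules of a free
  group. Two obstacles shape the argument. Collapsing leaves one orbit of edges, whose two ends may
  or may not lie in one orbit of vertices: if they do, an infinite cyclic factor splits off; if not,
  the two vertex stabilisers are the factors, and the given translation keeps this splitting from
  being trivial. Secondly, that \<open>B\<close> is preserved says nothing yet about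
  \<open>t\<close>. Strip its image of elements of \<open>B\<close> at both ends; the rest and
  \<open>B\<close> generate the group, while everything they generate has length zero or at least
  the length of that rest. As \<open>t\<close> has length one, the rest is a single step.\<close>

declare free_product_simps [simp del]

lemma carrier_free_product: "w \<in> carrier (free_product G H) \<longleftrightarrow> reduced_word G H w"
  by (simp add: free_product_simps)

lemma mult_free_product_Cons:
  "(x # u) \<otimes>\<^bsub>free_product G H\<^esub> v = fp_cons G H x (u \<otimes>\<^bsub>free_product G H\<^esub> v)"
  "[] \<otimes>\<^bsub>free_product G H\<^esub> v = v"
  by (simp_all add: free_product_simps)

lemma one_free_product: "\<one>\<^bsub>free_product G H\<^esub> = []"
  by (simp add: free_product_simps)

section \<open>The universal property and the ping-pong criterion\<close>

definition fp_lift ::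
  "('c, 'k) monoid_scheme \<Rightarrow> ('a \<Rightarrow> 'c) \<Rightarrow> ('b \<Rightarrow> 'c) \<Rightarrow> ('a + 'b) list \<Rightarrow> 'c" where
  "fp_lift K f g w = foldr (\<lambda>x y. case_sum f g x \<otimes>\<^bsub>K\<^esub> y) w \<one>\<^bsub>K\<^esub>"

lemma fp_lift_Nil [simp]: "fp_lift K f g [] = \<one>\<^bsub>K\<^esub>"
  and fp_lift_Cons [simp]: "fp_lift K f g (x # w) = case_sum f g x \<otimes>\<^bsub>K\<^esub> fp_lift K f g w"
  by (simp_all add: fp_lift_def)

context
  fixes G :: "('a, 'm) monoid_scheme" and H :: "('b, 'n) monoid_scheme"
    and K :: "('c, 'k) monoid_scheme" and f :: "'a \<Rightarrow> 'c" and g :: "'b \<Rightarrow> 'c"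
  assumes G: "group G" and H: "group H" and K: "group K"
    and f: "f \<in> hom G K" and g: "g \<in> hom H K"
begin

interpretation G: group G by (fact G)
interpretation H: group H by (fact H)
interpretation K: group K by (fact K)
interpretation f: group_hom G K f using f by (simp add: group_hom_def group_hom_axioms_def G K)
interpretation g: group_hom H K g using g by (simp add: group_hom_def group_hom_axioms_def H K)

lemma fp_lift_closed:
  assumes "set w \<subseteq> Inl ` carrier G \<union> Inr ` carrier H"
  shows "fp_lift K f g w \<in> carrier K"
  using assms by (induction w) auto

lemma fp_lift_fp_cons:
  assumes x: "x \<in> Inl ` carrier G \<union> Inr ` carrier H" and w: "reduced_word G H w"
  shows "fp_lift K f g (fp_cons G H x w) = case_sum f g x \<otimes>\<^bsub>K\<^esub> fp_lift K f g w"
proof -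
  have cl: "fp_lift K f g v \<in> carrier K" if "reduced_word G H v" for v
    using that fp_lift_closed reduced_word_subset[OF G H] by blast
  have l: "fp_lift K f g (fp_inl G a @ v) = f a \<otimes>\<^bsub>K\<^esub> fp_lift K f g v"
    if "fp_lift K f g v \<in> carrier K" "a \<in> carrier G" for a v
    using that by (auto simp: fp_inl_def)
  have r: "fp_lift K f g (fp_inr H a @ v) = g a \<otimes>\<^bsub>K\<^esub> fp_lift K f g v"
    if "fp_lift K f g v \<in> carrier K" "a \<in> carrier H" for a v
    using that by (auto simp: fp_inr_def)
  have fg: "fp_lift K f g (fp_inl G a) = f a" "fp_lift K f g (fp_inr H b) = g b"
    if "a \<in> carrier G" "b \<in> carrier H" for a b
    using that by (auto simp: fp_inl_def fp_inr_def)
  show ?thesis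
    using x w cl
    by (cases "(G, H, x, w)" rule: fp_cons.cases)
       (auto simp: l r reduced_word_Cons K.m_assoc fg[OF _ H.one_closed] fg[OF G.one_closed])
qed

lemma fp_lift_hom: "fp_lift K f g \<in> hom (free_product G H) K"
proof -
  have "fp_lift K f g (foldr (fp_cons G H) u v) = fp_lift K f g u \<otimes>\<^bsub>K\<^esub> fp_lift K f g v"
    if "set u \<subseteq> Inl ` carrier G \<union> Inr ` carrier H" "reduced_word G H v" for u v
    using that(1)
  proof (induction u)
    case Nil
    then show ?case
      using fp_lift_closed[OF reduced_word_subset[OF G H that(2)]] by simp
  next
    case (Cons x u)
    then have "fp_lift K f g u \<in> carrier K" "fp_lift K f g v \<in> carrier K" "case_sum f g x \<in> carrier K"
      using fp_lift_closed[OF reduced_word_subset[OF G H that(2)]] fp_lift_closed[of u] by auto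
    moreover have "reduced_word G H (foldr (fp_cons G H) u v)"
      using Cons.prems that by (intro foldr_fp_cons_reduced[OF G H]) auto
    ultimately show ?case
      using Cons by (simp add: fp_lift_fp_cons K.m_assoc)
  qed
  then show ?thesis
    using reduced_word_subset[OF G H] fp_lift_closed
    by (auto simp: hom_def free_product_simps)
qed

text \<open>Ping-pong with base point \<open>p\<close>: a word beginning in the first factor carries
  \<open>p\<close> into \<open>Y\<close>, one beginning in the second keeps it outside. So the
  former are not in the kernel; for the latter, moving the first letter to the other side would make
  an element of the second factor send \<open>p\<close> into \<open>Y\<close>. A single letter of
  the second factor need not move \<open>p\<close>, hence the assumption
  \<open>g_inj\<close>.\<close>

lemma inj_on_fp_liftI:
  assumes Y: "Y \<subseteq> carrier K" and p: "p \<in> carrier K - Y"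
    and f_Y: "\<And>a x. a \<in> carrier G \<Longrightarrow> a \<noteq> \<one>\<^bsub>G\<^esub> \<Longrightarrow> x \<in> carrier K - Y \<Longrightarrow> f a \<otimes>\<^bsub>K\<^esub> x \<in> Y"
    and g_Y: "\<And>b x. b \<in> carrier H \<Longrightarrow> b \<noteq> \<one>\<^bsub>H\<^esub> \<Longrightarrow> x \<in> Y \<Longrightarrow> g b \<otimes>\<^bsub>K\<^esub> x \<notin> Y"
    and g_p: "\<And>b. b \<in> carrier H \<Longrightarrow> g b \<otimes>\<^bsub>K\<^esub> p \<notin> Y"
    and g_inj: "inj_on g (carrier H)"
  shows "inj_on (fp_lift K f g) (carrier (free_product G H))"
proof -
  interpret F: group "free_product G H" using group_free_product[OF G H] .
  interpret l: group_hom "free_product G H" K "fp_lift K f g"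
    using fp_lift_hom by unfold_locales
  have move: "fp_lift K f g w \<otimes>\<^bsub>K\<^esub> p \<in> (if isl (hd w) then Y else carrier K - Y)"
    if "reduced_word G H w" "w \<noteq> []" for w
    using that
  proof (induction w)
    case (Cons x w)
    have w: "fp_lift K f g w \<in> carrier K" "reduced_word G H w"
      using Cons.prems by (auto intro!: fp_lift_closed reduced_word_subset[OF G H] simp: reduced_word_Cons)
    consider a where "x = Inl a" "a \<in> carrier G" "a \<noteq> \<one>\<^bsub>G\<^esub>" "w = [] \<or> \<not> isl (hd w)"
      | b where "x = Inr b" "b \<in> carrier H" "b \<noteq> \<one>\<^bsub>H\<^esub>" "w = [] \<or> isl (hd w)"
      using Cons.prems by (auto simp: reduced_word_Cons)
    then show ?case
    proof cases
      case 1
      then have "fp_lift K f g w \<otimes>\<^bsub>K\<^esub> p \<in> carrier K - Y"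
        using Cons.IH w p by (cases "w = []") auto
      then show ?thesis
        using f_Y[OF 1(2,3)] 1 p w by (simp add: K.m_assoc)
    next
      case 2
      then have "w \<noteq> [] \<Longrightarrow> fp_lift K f g w \<otimes>\<^bsub>K\<^esub> p \<in> Y"
        using Cons.IH w p by auto
      then have "w \<noteq> [] \<Longrightarrow> g b \<otimes>\<^bsub>K\<^esub> (fp_lift K f g w \<otimes>\<^bsub>K\<^esub> p) \<notin> Y"
        using g_Y[OF 2(2,3)] by blast
      then show ?thesis
        using 2 p w g_p[OF 2(2)] by (cases "w = []") (auto simp: K.m_assoc)
    qed
  qed simp
  have "w = []" if w: "reduced_word G H w" "fp_lift K f g w = \<one>\<^bsub>K\<^esub>" for w
  proof (rule ccontr)
    assume "w \<noteq> []"
    have "\<not> isl (hd w)"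
      using move[OF w(1) \<open>w \<noteq> []\<close>] w(2) p by (auto split: if_splits)
    then obtain b v where bv: "w = Inr b # v" "b \<in> carrier H" "b \<noteq> \<one>\<^bsub>H\<^esub>" "reduced_word G H v"
      "v \<noteq> [] \<Longrightarrow> isl (hd v)"
      using w \<open>w \<noteq> []\<close> by (cases w; cases "hd w") (auto simp: reduced_word_Cons)
    have v: "fp_lift K f g v \<in> carrier K"
      using bv by (intro fp_lift_closed reduced_word_subset[OF G H])
    then have eq: "fp_lift K f g v = g (inv\<^bsub>H\<^esub> b)"
      using w bv by (metis K.inv_equality K.inv_inv fp_lift_Cons g.hom_closed g.hom_inv sum.case(2))
    show False
    proof (cases "v = []")
      case True
      then have "g b = g \<one>\<^bsub>H\<^esub>"
        using w bv by simp
      then show False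
        using g_inj bv by (metis H.one_closed inj_onD)
    next
      case False
      then show False
        using move[OF bv(4)] bv g_p[of "inv\<^bsub>H\<^esub> b"] eq by simp
    qed
  qed
  then show ?thesis
    by (intro l.inj_on_one_iff[THEN iffD2]) (auto simp: free_product_simps)
qed

end

section \<open>Cancellation in the free product of the integers with a group\<close>

text \<open>Orientations of the edges on the path from the vertex \<open>B\<close> to the vertex
  \<open>w B\<close>; letters from \<open>B\<close> only choose the branch and leave no
  trace.\<close>

definition signs :: "(int + 'b) list \<Rightarrow> int list" where
  "signs w = concat (map (case_sum (\<lambda>a. replicate (nat \<bar>a\<bar>) (sgn a)) (\<lambda>_. [])) w)"

text \<open>The values 1 and -1 single out the half-trees beyond the edges from \<open>B\<close> to
  \<open>t B\<close> and to \<open>t\<^sup>-\<^sup>1 B\<close>; the value 0 covers the empty word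
  and all words beginning in \<open>B\<close>.\<close>

definition start_sign :: "(int + 'b) list \<Rightarrow> int" where
  "start_sign w = (case w of Inl a # _ \<Rightarrow> sgn a | _ \<Rightarrow> 0)"

definition inv_signs :: "int list \<Rightarrow> int list" where
  "inv_signs s = rev (map uminus s)"

lemma inv_signs_simps [simp]:
  "inv_signs [] = []" "inv_signs (xs @ ys) = inv_signs ys @ inv_signs xs"
  "inv_signs (inv_signs xs) = xs" "inv_signs [s] = [- s]" "inv_signs xs = [] \<longleftrightarrow> xs = []"
  "length (inv_signs xs) = length xs" "inv_signs (s # xs) = inv_signs xs @ [- s]"
  by (simp_all add: inv_signs_def rev_map[symmetric] o_def)

lemma signs_simps [simp]:
  "signs [] = []" "signs (Inr b # w) = signs w"
  "signs (Inl a # w) = replicate (nat \<bar>a\<bar>) (sgn a) @ signs w"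
  by (simp_all add: signs_def)

lemma start_sign_simps [simp]:
  "start_sign [] = 0" "start_sign (Inr b # w) = 0" "start_sign (Inl a # w) = sgn a"
  by (simp_all add: start_sign_def)

lemma sign_cases: "\<bar>s::int\<bar> = 1 \<Longrightarrow> s = 1 \<or> s = -1"
  by linarith

section \<open>Reduced forms, unit steps and first edges\<close>

locale free_product_Z = B: group B for B :: "('b, 'm) monoid_scheme"
begin

abbreviation P :: "(int + 'b) list monoid" where "P \<equiv> free_product integer_group B"
abbreviation T :: "int \<Rightarrow> (int + 'b) list" where "T \<equiv> fp_inl integer_group"
abbreviation \<beta> :: "'b \<Rightarrow> (int + 'b) list" where "\<beta> \<equiv> fp_inr B"

text \<open>Together with the first entry of \<open>signs\<close> this names the first edge on the
  path to \<open>w B\<close>.\<close>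

definition lead :: "(int + 'b) list \<Rightarrow> 'b" where
  "lead w = (case w of Inr b # _ \<Rightarrow> b | _ \<Rightarrow> \<one>\<^bsub>B\<^esub>)"

lemma lead_simps [simp]:
  "lead [] = \<one>\<^bsub>B\<^esub>" "lead (Inr b # w) = b" "lead (Inl a # w) = \<one>\<^bsub>B\<^esub>"
  by (simp_all add: lead_def)

sublocale P: group P
  by (rule group_free_product) (auto simp: B.is_group group_integer_group)

sublocale T: group_hom integer_group P T
  by (intro group_hom.intro group_hom_axioms.intro fp_inl_hom group_integer_group B.is_group P.is_group)

sublocale \<beta>: group_hom B P \<beta>
  by (intro group_hom.intro group_hom_axioms.intro fp_inr_hom group_integer_group B.is_group P.is_group)

lemma T_closed [simp]: "T a \<in> carrier P"
  using T.hom_closed by simp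

lemma T_mult: "T a \<otimes>\<^bsub>P\<^esub> T b = T (a + b)"
  using T.hom_mult[of a b] by simp

lemma inv_T: "inv\<^bsub>P\<^esub> (T a) = T (- a)"
  using T.hom_inv[of a] by simp

lemma one_P: "\<one>\<^bsub>P\<^esub> = []"
  by (simp add: one_free_product)

lemma one_P_simps [simp]:
  "signs \<one>\<^bsub>P\<^esub> = []" "start_sign \<one>\<^bsub>P\<^esub> = 0" "lead \<one>\<^bsub>P\<^esub> = \<one>\<^bsub>B\<^esub>"
  by (simp_all add: one_P)

lemma T_cancel: "w \<in> carrier P \<Longrightarrow> T (- s) \<otimes>\<^bsub>P\<^esub> (T s \<otimes>\<^bsub>P\<^esub> w) = w"
  "w \<in> carrier P \<Longrightarrow> T s \<otimes>\<^bsub>P\<^esub> (T (- s) \<otimes>\<^bsub>P\<^esub> w) = w"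
  using T.hom_one by (simp_all add: T_mult P.m_assoc[symmetric])

lemma carrier_P_Cons:
  "Inl a # w \<in> carrier P \<longleftrightarrow> a \<noteq> 0 \<and> w \<in> carrier P \<and> start_sign w = 0"
  "Inr b # w \<in> carrier P \<longleftrightarrow> b \<in> carrier B \<and> b \<noteq> \<one>\<^bsub>B\<^esub> \<and> w \<in> carrier P \<and> lead w = \<one>\<^bsub>B\<^esub>"
  by (cases w; cases "hd w"; auto simp: carrier_free_product reduced_word_Cons sgn_if)+

lemma Nil_in_P [simp]: "[] \<in> carrier P"
  by (simp add: carrier_free_product)

lemma T_mult_eq: "a \<noteq> 0 \<Longrightarrow> T a \<otimes>\<^bsub>P\<^esub> w = fp_cons integer_group B (Inl a) w"
  by (simp add: fp_inl_def mult_free_product_Cons)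

lemma \<beta>_mult_eq:
  "b \<in> carrier B \<Longrightarrow> w \<in> carrier P \<Longrightarrow> \<beta> b \<otimes>\<^bsub>P\<^esub> w = fp_cons integer_group B (Inr b) w"
  by (auto simp: fp_inr_def mult_free_product_Cons carrier_free_product
      fp_cons_one[OF group_integer_group B.is_group])

lemma P_cases:
  obtains "w = []" | a v where "w = Inl a # v" | b v where "w = Inr b # v"
  by (metis list.exhaust sum.exhaust)

lemma signs_\<beta>_mult [simp]:
  "b \<in> carrier B \<Longrightarrow> w \<in> carrier P \<Longrightarrow> signs (\<beta> b \<otimes>\<^bsub>P\<^esub> w) = signs w"
  by (simp add: \<beta>_mult_eq, cases w rule: P_cases) (auto simp: fp_inr_def)

lemma signs_\<beta> [simp]: "signs (\<beta> b) = []"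
  by (simp add: fp_inr_def)

lemma lead_\<beta> [simp]: "lead (\<beta> b) = b"
  by (simp add: fp_inr_def)

lemma start_sign_\<beta> [simp]: "start_sign (\<beta> b) = 0"
  by (simp add: fp_inr_def)

lemma signs_T [simp]: "\<bar>s\<bar> = 1 \<Longrightarrow> signs (T s) = [s]"
  and start_sign_T [simp]: "start_sign (T s) = sgn s"
  and lead_T [simp]: "lead (T s) = \<one>\<^bsub>B\<^esub>"
  using sign_cases[of s] by (auto simp: fp_inl_def)

lemma lead_closed [simp]: "w \<in> carrier P \<Longrightarrow> lead w \<in> carrier B"
  by (cases w rule: P_cases) (auto simp: carrier_P_Cons)

lemma lead_\<beta>_mult [simp]:
  "b \<in> carrier B \<Longrightarrow> w \<in> carrier P \<Longrightarrow> lead (\<beta> b \<otimes>\<^bsub>P\<^esub> w) = b \<otimes>\<^bsub>B\<^esub> lead w"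
  by (simp add: \<beta>_mult_eq, cases w rule: P_cases) (auto simp: fp_inr_def carrier_P_Cons)

text \<open>The hypothesis lets \<open>w\<close> begin with an integer of sign \<open>s\<close>,
  which then absorbs the new step; in \<open>signs\<close> this looks the same as a new
  letter.\<close>

lemma T_mult_reduced:
  assumes "\<bar>s\<bar> = 1" "w \<in> carrier P" "start_sign w \<noteq> - s"
  shows "signs (T s \<otimes>\<^bsub>P\<^esub> w) = s # signs w" "start_sign (T s \<otimes>\<^bsub>P\<^esub> w) = s"
proof -
  have nat: "nat (1 + a) = Suc (nat a)" if "a > 0" for a :: int
    using that by simp
  have nat': "nat (1 - a) = Suc (nat (- a))" if "\<not> a > 0" for a :: int
    using that by simp
  have s: "s \<noteq> 0" using assms by auto
  show "signs (T s \<otimes>\<^bsub>P\<^esub> w) = s # signs w"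
    unfolding T_mult_eq[OF s] using assms(2,3) sign_cases[OF assms(1)]
    by (cases w rule: P_cases) (auto simp: fp_inl_def carrier_P_Cons sgn_if nat nat' split: if_splits)
  show "start_sign (T s \<otimes>\<^bsub>P\<^esub> w) = s"
    unfolding T_mult_eq[OF s] using assms(2,3) sign_cases[OF assms(1)]
    by (cases w rule: P_cases) (auto simp: fp_inl_def carrier_P_Cons sgn_if split: if_splits)
qed

lemma T_mult_unreduced:
  assumes "\<bar>s\<bar> = 1" "w \<in> carrier P" "start_sign w = - s"
  shows "start_sign (T s \<otimes>\<^bsub>P\<^esub> w) \<noteq> s"
proof -
  have s: "s \<noteq> 0" using assms by auto
  show ?thesis
    unfolding T_mult_eq[OF s] using assms(2,3) sign_cases[OF assms(1)]
    by (cases w rule: P_cases) (auto simp: fp_inl_def carrier_P_Cons sgn_if split: if_splits)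
qed

lemma signs_T_mult_unreduced:
  assumes "\<bar>s\<bar> = 1" "w \<in> carrier P" "start_sign w = - s"
  shows "signs w = - s # signs (T s \<otimes>\<^bsub>P\<^esub> w)"
  using T_mult_reduced(1)[of "-s" "T s \<otimes>\<^bsub>P\<^esub> w"] T_mult_unreduced[OF assms] assms
  by (simp add: T_cancel)

lemma start_sign_eq:
  "w \<in> carrier P \<Longrightarrow>
     start_sign w = (if lead w = \<one>\<^bsub>B\<^esub> \<and> signs w \<noteq> [] then hd (signs w) else 0)"
  by (cases w rule: P_cases) (auto simp: carrier_P_Cons)

lemma signs_Nil_iff: "w \<in> carrier P \<Longrightarrow> signs w = [] \<longleftrightarrow> w \<in> \<beta> ` carrier B"
proof (cases w rule: P_cases)
  case (3 b v)
  assume "w \<in> carrier P"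
  with 3 have "signs w = [] \<Longrightarrow> v = []"
    by (cases v rule: P_cases) (auto simp: carrier_P_Cons)
  then show ?thesis
    using 3 \<open>w \<in> carrier P\<close> by (auto simp: carrier_P_Cons fp_inr_def image_iff split: if_splits)
qed (auto simp: carrier_P_Cons fp_inr_def image_iff intro!: bexI[of _ "\<one>\<^bsub>B\<^esub>"])

lemma signs_Nil_eq: "w \<in> carrier P \<Longrightarrow> signs w = [] \<Longrightarrow> w = \<beta> (lead w)"
  using signs_Nil_iff by fastforce

lemma abs_signs: "w \<in> carrier P \<Longrightarrow> s \<in> set (signs w) \<Longrightarrow> \<bar>s\<bar> = 1"
proof (induction w)
  case (Cons x w)
  then show ?case by (cases x) (auto simp: carrier_P_Cons sgn_if split: if_splits)
qed simp

lemma start_sign_abs: "w \<in> carrier P \<Longrightarrow> start_sign w \<noteq> 0 \<Longrightarrow> \<bar>start_sign w\<bar> = 1"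
  by (cases w rule: P_cases) (auto simp: sgn_if split: if_splits)

lemma start_sign_lead: "w \<in> carrier P \<Longrightarrow> start_sign w \<noteq> 0 \<Longrightarrow> lead w = \<one>\<^bsub>B\<^esub>"
  by (cases w rule: P_cases) auto

text \<open>Integers enter one unit at a time, so that an inductive step crosses one edge of the
  tree; the side conditions say that nothing cancels or merges inside \<open>B\<close>.\<close>

lemma P_induct [consumes 1, case_names one \<beta> T]:
  assumes "w \<in> carrier P"
    and one: "Q \<one>\<^bsub>P\<^esub>"
    and \<beta>: "\<And>b w. b \<in> carrier B \<Longrightarrow> b \<noteq> \<one>\<^bsub>B\<^esub> \<Longrightarrow> w \<in> carrier P \<Longrightarrow> lead w = \<one>\<^bsub>B\<^esub> \<Longrightarrow> Q w \<Longrightarrow>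
            Q (\<beta> b \<otimes>\<^bsub>P\<^esub> w)"
    and T: "\<And>s w. \<bar>s\<bar> = 1 \<Longrightarrow> w \<in> carrier P \<Longrightarrow> start_sign w \<noteq> - s \<Longrightarrow> Q w \<Longrightarrow> Q (T s \<otimes>\<^bsub>P\<^esub> w)"
  shows "Q w"
  using assms(1)
proof (induction w)
  case Nil
  then show ?case using one by (simp add: one_P)
next
  case (Cons x w)
  show ?case
  proof (cases x)
    case (Inr b)
    then have *: "\<beta> b \<otimes>\<^bsub>P\<^esub> w = x # w"
      using Cons.prems
      by (simp add: \<beta>_mult_eq carrier_P_Cons, cases w rule: P_cases)
         (auto simp: fp_inr_def carrier_P_Cons)
    show ?thesis
      unfolding *[symmetric] using Cons Inr by (intro \<beta>) (auto simp: carrier_P_Cons)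
  next
    case (Inl a)
    then have w: "w \<in> carrier P" "start_sign w = 0" "a \<noteq> 0" "Q w"
      using Cons by (auto simp: carrier_P_Cons)
    then have w_cases: "w = [] \<or> (\<exists>b v. w = Inr b # v)"
      by (cases w rule: P_cases) (auto simp: carrier_P_Cons sgn_if split: if_splits)
    have "Q (Inl (s * (1 + int n)) # w)" if s: "\<bar>s\<bar> = 1" for s n
    proof (induction n)
      case 0
      have "T s \<otimes>\<^bsub>P\<^esub> w = Inl s # w"
        using w_cases s by (subst T_mult_eq) (auto simp: fp_inl_def)
      then show ?case
        using T[of s w] w s by auto
    next
      case (Suc n)
      have "s * (1 + int (Suc n)) = s + s * (1 + int n)" "s * (1 + int (Suc n)) \<noteq> 0"
        using sign_cases[OF s] by (auto simp: algebra_simps)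
      then have "T s \<otimes>\<^bsub>P\<^esub> (Inl (s * (1 + int n)) # w) = Inl (s * (1 + int (Suc n))) # w"
        using s by (subst T_mult_eq) (auto simp: fp_inl_def)
      moreover have "start_sign (Inl (s * (1 + int n)) # w) \<noteq> - s"
        using sign_cases[OF s] by auto
      ultimately show ?case
        using T[OF s _ _ Suc] w s by (auto simp: carrier_P_Cons)
    qed
    from this[of 1 "nat (a - 1)"] this[of "- 1" "nat (- a - 1)"] show ?thesis
      using Inl w(3) by (cases "a > 0") auto
  qed
qed

text \<open>Only letters of opposite sign cancel, so the sign sequences of two factors and of their
  product are related as in a free group; the first element of \<open>B\<close> can change only if
  the first factor cancels completely.\<close>

lemma cancellation:
  assumes "g \<in> carrier P" "h \<in> carrier P"
  shows "\<exists>p c q. signs g = p @ c \<and> signs h = inv_signs c @ q \<and> signs (g \<otimes>\<^bsub>P\<^esub> h) = p @ q \<and>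
           (p \<noteq> [] \<longrightarrow> lead (g \<otimes>\<^bsub>P\<^esub> h) = lead g)"
  using assms(1)
proof (induction g rule: P_induct)
  case one
  show ?case using assms(2) by (intro exI[of _ "[]"] exI[of _ "signs h"]) simp
next
  case (\<beta> b g)
  then obtain p c q where *: "signs g = p @ c" "signs h = inv_signs c @ q"
    "signs (g \<otimes>\<^bsub>P\<^esub> h) = p @ q" "p \<noteq> [] \<longrightarrow> lead (g \<otimes>\<^bsub>P\<^esub> h) = lead g" by blast
  show ?case
    using * \<beta>.hyps assms(2) by (intro exI[of _ p] exI[of _ c] exI[of _ q]) (auto simp: P.m_assoc)
next
  case (T s g)
  then obtain p c q where *: "signs g = p @ c" "signs h = inv_signs c @ q"
    "signs (g \<otimes>\<^bsub>P\<^esub> h) = p @ q" "p \<noteq> [] \<longrightarrow> lead (g \<otimes>\<^bsub>P\<^esub> h) = lead g" by blast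
  have g: "signs (T s \<otimes>\<^bsub>P\<^esub> g) = s # signs g" "start_sign (T s \<otimes>\<^bsub>P\<^esub> g) = s"
    using T.hyps by (simp_all add: T_mult_reduced)
  show ?case
  proof (cases "start_sign (g \<otimes>\<^bsub>P\<^esub> h) = - s")
    case False
    then have "signs (T s \<otimes>\<^bsub>P\<^esub> (g \<otimes>\<^bsub>P\<^esub> h)) = s # p @ q"
      "start_sign (T s \<otimes>\<^bsub>P\<^esub> (g \<otimes>\<^bsub>P\<^esub> h)) = s"
      using T.hyps assms(2) * by (simp_all add: T_mult_reduced)
    then show ?thesis
      using * g T.hyps assms(2)
      by (intro exI[of _ "s # p"] exI[of _ c] exI[of _ q]) (auto simp: P.m_assoc start_sign_lead)
  next
    case True
    then have gh: "p @ q = - s # signs (T s \<otimes>\<^bsub>P\<^esub> (g \<otimes>\<^bsub>P\<^esub> h))" "lead (g \<otimes>\<^bsub>P\<^esub> h) = \<one>\<^bsub>B\<^esub>"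
      using signs_T_mult_unreduced[of s "g \<otimes>\<^bsub>P\<^esub> h"] start_sign_lead[of "g \<otimes>\<^bsub>P\<^esub> h"] T.hyps assms(2) *
      by auto
    \<comment> \<open>If part of \<open>g\<close> survived, \<open>g\<close> would begin like the
      product, that is with the inverse of \<open>T s\<close>, although \<open>T s\<close> times
      \<open>g\<close> is reduced.\<close>
    have "p = []"
    proof (rule ccontr)
      assume "p \<noteq> []"
      then have "start_sign g = - s"
        using * gh T.hyps by (auto simp: start_sign_eq Cons_eq_append_conv append_eq_Cons_conv)
      then show False using T.hyps by simp
    qed
    then show ?thesis
      using * g gh T.hyps assms(2)
      by (intro exI[of _ "[]"] exI[of _ "s # c"] exI[of _ "tl q"]) (auto simp: P.m_assoc)
  qed
qed

lemma signs_inv: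
  assumes "g \<in> carrier P"
  shows "signs (inv\<^bsub>P\<^esub> g) = inv_signs (signs g)"
  using cancellation[of g "inv\<^bsub>P\<^esub> g"] assms by auto

text \<open>\<open>cancellation\<close> does not compare the first letters of \<open>h\<close> and
  of the inverse of \<open>g\<close>. Applying it once more, to \<open>h\<close> as the product of
  that inverse with the product of \<open>g\<close> and \<open>h\<close>, turns the cancelled part
  into a surviving beginning. So any cancellation forces \<open>h\<close> and the inverse of
  \<open>g\<close> to begin with the same edge.\<close>

lemma no_cancellation:
  assumes g: "g \<in> carrier P" and h: "h \<in> carrier P"
    and neq: "lead (inv\<^bsub>P\<^esub> g) \<noteq> lead h \<or> signs g = [] \<or> signs h = [] \<or>
                hd (signs (inv\<^bsub>P\<^esub> g)) \<noteq> hd (signs h)"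
  shows "signs (g \<otimes>\<^bsub>P\<^esub> h) = signs g @ signs h"
    and "signs g \<noteq> [] \<Longrightarrow> lead (g \<otimes>\<^bsub>P\<^esub> h) = lead g"
proof -
  obtain p c q where *: "signs g = p @ c" "signs h = inv_signs c @ q"
    "signs (g \<otimes>\<^bsub>P\<^esub> h) = p @ q" "p \<noteq> [] \<longrightarrow> lead (g \<otimes>\<^bsub>P\<^esub> h) = lead g"
    using cancellation[OF g h] by blast
  have "inv\<^bsub>P\<^esub> g \<otimes>\<^bsub>P\<^esub> (g \<otimes>\<^bsub>P\<^esub> h) = h"
    using g h by (simp add: P.m_assoc[symmetric])
  then obtain p' c' q' where **: "signs (inv\<^bsub>P\<^esub> g) = p' @ c'" "p @ q = inv_signs c' @ q'"
    "signs h = p' @ q'" "p' \<noteq> [] \<longrightarrow> lead h = lead (inv\<^bsub>P\<^esub> g)"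
    using cancellation[of "inv\<^bsub>P\<^esub> g" "g \<otimes>\<^bsub>P\<^esub> h"] g h * by auto
  \<comment> \<open>Counting shows that the part \<open>p'\<close> surviving in the second product
    is as long as the part \<open>c\<close> lost in the first.\<close>
  have "length p + length c = length p' + length c'"
    using arg_cong[OF **(1), of length] * by (simp add: signs_inv[OF g])
  moreover have "length p + length q = length c' + length q'"
    using arg_cong[OF **(2), of length] by simp
  moreover have "length c + length q = length p' + length q'"
    using arg_cong[OF **(3), of length] * by simp
  ultimately have "length p' = length c" by linarith
  have "c = []"
  proof (rule ccontr)
    assume "c \<noteq> []"
    then have "p' \<noteq> []" using \<open>length p' = length c\<close> by auto
    moreover from this have "hd (signs (inv\<^bsub>P\<^esub> g)) = hd (signs h)"
      using **(1,3) by simp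
    ultimately show False using neq *(1) **(3,4) \<open>c \<noteq> []\<close> by auto
  qed
  then show "signs (g \<otimes>\<^bsub>P\<^esub> h) = signs g @ signs h"
    "signs g \<noteq> [] \<Longrightarrow> lead (g \<otimes>\<^bsub>P\<^esub> h) = lead g"
    using * by auto
qed

lemma signs_mult_\<beta>:
  assumes "g \<in> carrier P" "b \<in> carrier B"
  shows "signs (g \<otimes>\<^bsub>P\<^esub> \<beta> b) = signs g"
    and "start_sign (g \<otimes>\<^bsub>P\<^esub> \<beta> b) = start_sign g"
    and "signs g \<noteq> [] \<Longrightarrow> lead (g \<otimes>\<^bsub>P\<^esub> \<beta> b) = lead g"
proof -
  show *: "signs (g \<otimes>\<^bsub>P\<^esub> \<beta> b) = signs g"
    using no_cancellation(1)[OF assms(1) \<beta>.hom_closed[OF assms(2)]] by simp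
  show **: "lead (g \<otimes>\<^bsub>P\<^esub> \<beta> b) = lead g" if "signs g \<noteq> []"
    using no_cancellation(2)[OF assms(1) \<beta>.hom_closed[OF assms(2)] _ that] by simp
  show "start_sign (g \<otimes>\<^bsub>P\<^esub> \<beta> b) = start_sign g"
    using * ** assms by (cases "signs g = []") (simp_all add: start_sign_eq)
qed

text \<open>Right multiplication by \<open>T s\<close> crosses one edge. It changes the side of the
  edge from \<open>B\<close> to the vertex of \<open>T s\<close> only if it crosses that very edge,
  which happens for the identity alone.\<close>

lemma start_sign_mult_T:
  assumes x: "x \<in> carrier P" "x \<noteq> \<one>\<^bsub>P\<^esub>" and s: "\<bar>s\<bar> = 1"
  shows "start_sign (x \<otimes>\<^bsub>P\<^esub> T s) = s \<longleftrightarrow> start_sign x = s"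
proof -
  obtain p c q where *: "signs x = p @ c" "[s] = inv_signs c @ q"
    "signs (x \<otimes>\<^bsub>P\<^esub> T s) = p @ q" "p \<noteq> [] \<longrightarrow> lead (x \<otimes>\<^bsub>P\<^esub> T s) = lead x"
    using cancellation[OF x(1) T_closed, of s] unfolding signs_T[OF s] by blast
  have "s \<noteq> 0" "s \<noteq> - s" using s by auto
  show ?thesis
  proof (cases "p = []")
    case False
    then show ?thesis using *(1,3,4) x by (simp add: start_sign_eq)
  next
    case p: True
    show ?thesis
    proof (cases "c = []")
      case True
      then have "\<beta> (lead x) = x" using *(1) p x signs_Nil_eq[of x] by simp
      moreover from this have "lead x \<noteq> \<one>\<^bsub>B\<^esub>" using x(2) by (metis \<beta>.hom_one)
      ultimately have "lead (x \<otimes>\<^bsub>P\<^esub> T s) \<noteq> \<one>\<^bsub>B\<^esub>" "start_sign x = 0"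
        using lead_\<beta>_mult[of "lead x" "T s"] x start_sign_\<beta>[of "lead x"] by simp_all
      then show ?thesis using x \<open>s \<noteq> 0\<close> by (auto simp: start_sign_eq)
    next
      case False
      then have "inv_signs c = [s]" and "q = []"
        using *(2) by (simp_all add: Cons_eq_append_conv)
      then have "c = [- s]"
        by (metis inv_signs_simps(3,4))
      with \<open>q = []\<close> show ?thesis
        using *(1,3) p x \<open>s \<noteq> 0\<close> \<open>s \<noteq> - s\<close> by (auto simp: start_sign_eq)
    qed
  qed
qed

text \<open>With \<open>U\<close> the set of elements whose reduced form starts with a positive integer,
  the next two lemmas say that \<open>U\<close> and each of its translates are nested.\<close>

lemma start_sign_translate:
  assumes k: "k \<in> carrier P" "k \<noteq> \<one>\<^bsub>P\<^esub>" "start_sign k \<noteq> s"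
    and x: "x \<in> carrier P" "start_sign x = s" and s: "\<bar>s\<bar> = 1"
  shows "start_sign (inv\<^bsub>P\<^esub> k \<otimes>\<^bsub>P\<^esub> x) = start_sign (inv\<^bsub>P\<^esub> k)"
proof -
  have lx: "lead x = \<one>\<^bsub>B\<^esub>" "hd (signs x) = s" "signs x \<noteq> []"
    using x s by (auto simp: start_sign_eq split: if_splits)
  \<comment> \<open>The paths from \<open>B\<close> to \<open>k\<close> and to \<open>x\<close>
    leave along different edges, so the path from \<open>k\<close> to \<open>x\<close> passes
    through \<open>B\<close> and begins like the path from \<open>k\<close> to
    \<open>B\<close>.\<close>
  have "lead k \<noteq> lead x \<or> signs (inv\<^bsub>P\<^esub> k) = [] \<or> signs x = [] \<or> hd (signs k) \<noteq> hd (signs x)"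
    using k lx by (auto simp: start_sign_eq signs_inv split: if_splits)
  then have *: "signs (inv\<^bsub>P\<^esub> k \<otimes>\<^bsub>P\<^esub> x) = signs (inv\<^bsub>P\<^esub> k) @ signs x"
     "signs (inv\<^bsub>P\<^esub> k) \<noteq> [] \<Longrightarrow> lead (inv\<^bsub>P\<^esub> k \<otimes>\<^bsub>P\<^esub> x) = lead (inv\<^bsub>P\<^esub> k)"
    using no_cancellation[of "inv\<^bsub>P\<^esub> k" x] k x by auto
  show ?thesis
  proof (cases "signs (inv\<^bsub>P\<^esub> k) = []")
    case True
    then have eq: "inv\<^bsub>P\<^esub> k = \<beta> (lead (inv\<^bsub>P\<^esub> k))" using k signs_Nil_eq by simp
    moreover have "lead (inv\<^bsub>P\<^esub> k) \<noteq> \<one>\<^bsub>B\<^esub>"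
    proof
      assume "lead (inv\<^bsub>P\<^esub> k) = \<one>\<^bsub>B\<^esub>"
      with eq have "inv\<^bsub>P\<^esub> k = \<one>\<^bsub>P\<^esub>" by (metis \<beta>.hom_one)
      then show False using k by simp
    qed
    ultimately have "lead (inv\<^bsub>P\<^esub> k \<otimes>\<^bsub>P\<^esub> x) \<noteq> \<one>\<^bsub>B\<^esub>"
      using lead_\<beta>_mult[of "lead (inv\<^bsub>P\<^esub> k)" x] k x lx by simp
    then show ?thesis
      using k x True by (simp add: start_sign_eq)
  next
    case False
    then show ?thesis using * k x by (simp add: start_sign_eq)
  qed
qed

lemma start_sign_translate':
  assumes k: "k \<in> carrier P" "start_sign k = s"
    and x: "x \<in> carrier P" "start_sign x \<noteq> s" and s: "\<bar>s\<bar> = 1"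
  shows "start_sign (inv\<^bsub>P\<^esub> k \<otimes>\<^bsub>P\<^esub> x) = start_sign (inv\<^bsub>P\<^esub> k)"
proof -
  have lk: "lead k = \<one>\<^bsub>B\<^esub>" "hd (signs k) = s" "signs k \<noteq> []"
    using k s by (auto simp: start_sign_eq split: if_splits)
  have "lead k \<noteq> lead x \<or> signs (inv\<^bsub>P\<^esub> k) = [] \<or> signs x = [] \<or> hd (signs k) \<noteq> hd (signs x)"
    using x lk by (auto simp: start_sign_eq signs_inv split: if_splits)
  then have *: "signs (inv\<^bsub>P\<^esub> k \<otimes>\<^bsub>P\<^esub> x) = signs (inv\<^bsub>P\<^esub> k) @ signs x"
     "lead (inv\<^bsub>P\<^esub> k \<otimes>\<^bsub>P\<^esub> x) = lead (inv\<^bsub>P\<^esub> k)"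
    using no_cancellation[of "inv\<^bsub>P\<^esub> k" x] k x lk by (auto simp: signs_inv)
  then show ?thesis using k x lk by (simp add: start_sign_eq signs_inv)
qed

end

section \<open>Subgroups acting on the tree of the free product\<close>

text \<open>Think of \<open>P\<close> acting on the tree with vertices \<open>g B\<close> and edges \<open>g\<close> from \<open>g B\<close> to \<open>g t B\<close>.
  The elements with start sign \<open>1\<close> form one half-tree of the edge \<open>1\<close>; collapsing all edges outside the
  \<open>H\<close>-orbit of this edge identifies \<open>x\<close> and \<open>y\<close> exactly when \<open>eqv x y\<close>.\<close>

context free_product_Z
begin

abbreviation pos :: "(int + 'b) list \<Rightarrow> bool" where "pos x \<equiv> start_sign x = 1"

lemma pos_mult_T: "x \<in> carrier P \<Longrightarrow> x \<noteq> \<one>\<^bsub>P\<^esub> \<Longrightarrow> pos (x \<otimes>\<^bsub>P\<^esub> T 1) \<longleftrightarrow> pos x"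
  by (simp add: start_sign_mult_T)

text \<open>Appending steps on the right follows a path in the tree outwards from the vertex
  \<open>B\<close>, whereas multiplying on the left would move the whole path.\<close>

lemma P_right_induct [consumes 1, case_names one \<beta> T]:
  assumes "x \<in> carrier P"
    and "Q \<one>\<^bsub>P\<^esub>"
    and \<beta>: "\<And>y b. y \<in> carrier P \<Longrightarrow> b \<in> carrier B \<Longrightarrow> Q y \<Longrightarrow> Q (y \<otimes>\<^bsub>P\<^esub> \<beta> b)"
    and T: "\<And>y s. y \<in> carrier P \<Longrightarrow> \<bar>s\<bar> = 1 \<Longrightarrow> Q y \<Longrightarrow> Q (y \<otimes>\<^bsub>P\<^esub> T s)"
  shows "Q x"
proof -
  have "\<forall>y\<in>carrier P. Q y \<longrightarrow> Q (y \<otimes>\<^bsub>P\<^esub> x)"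
    using assms(1)
  proof (induction x rule: P_induct)
    case one
    then show ?case by simp
  next
    case (\<beta> b w)
    show ?case
    proof (intro ballI impI)
      fix y assume y: "y \<in> carrier P" "Q y"
      have "Q (y \<otimes>\<^bsub>P\<^esub> \<beta> b \<otimes>\<^bsub>P\<^esub> w)"
        using \<beta>.IH y \<beta>.hyps assms(3)[OF y(1) \<beta>.hyps(1) y(2)] by simp
      then show "Q (y \<otimes>\<^bsub>P\<^esub> (\<beta> b \<otimes>\<^bsub>P\<^esub> w))" using y \<beta>.hyps by (simp add: P.m_assoc)
    qed
  next
    case (T s w)
    show ?case
    proof (intro ballI impI)
      fix y assume y: "y \<in> carrier P" "Q y"
      have "Q (y \<otimes>\<^bsub>P\<^esub> T s \<otimes>\<^bsub>P\<^esub> w)"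
        using T.IH y T.hyps assms(4)[OF y(1) T.hyps(1) y(2)] by simp
      then show "Q (y \<otimes>\<^bsub>P\<^esub> (T s \<otimes>\<^bsub>P\<^esub> w))" using y T.hyps by (simp add: P.m_assoc)
    qed
  qed
  then show ?thesis using assms(1,2) by (metis P.l_one P.one_closed)
qed

end

locale subgroup_of_free_product_Z = free_product_Z B for B :: "('b, 'm) monoid_scheme" +
  fixes H :: "(int + 'b) list set"
  assumes H: "subgroup H P"
begin

sublocale H: subgroup H P by (fact H)

definition eqv :: "(int + 'b) list \<Rightarrow> (int + 'b) list \<Rightarrow> bool" where
  "eqv x y \<longleftrightarrow> (\<forall>k\<in>H. pos (k \<otimes>\<^bsub>P\<^esub> x) \<longleftrightarrow> pos (k \<otimes>\<^bsub>P\<^esub> y))"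

text \<open>The vertex stabilisers of the collapsed tree: \<open>H0\<close> and \<open>H1\<close>
  fix the classes of the two ends of the edge 1.\<close>

definition H0 :: "(int + 'b) list set" where "H0 = {h \<in> H. eqv h \<one>\<^bsub>P\<^esub>}"
definition H1 :: "(int + 'b) list set" where "H1 = {h \<in> H. eqv (h \<otimes>\<^bsub>P\<^esub> T 1) (T 1)}"

lemma eqv_refl [simp]: "eqv x x"
  and eqv_sym: "eqv x y \<Longrightarrow> eqv y x"
  and eqv_trans: "eqv x y \<Longrightarrow> eqv y z \<Longrightarrow> eqv x z"
  by (auto simp: eqv_def)

lemma eqv_mult:
  assumes "h \<in> H" "x \<in> carrier P" "y \<in> carrier P" "eqv x y"
  shows "eqv (h \<otimes>\<^bsub>P\<^esub> x) (h \<otimes>\<^bsub>P\<^esub> y)"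
  using assms by (simp add: eqv_def P.m_assoc[symmetric])

lemma eqv_pos:
  assumes "eqv x y" "x \<in> carrier P" "y \<in> carrier P"
  shows "pos x \<longleftrightarrow> pos y"
proof -
  have "pos (\<one>\<^bsub>P\<^esub> \<otimes>\<^bsub>P\<^esub> x) \<longleftrightarrow> pos (\<one>\<^bsub>P\<^esub> \<otimes>\<^bsub>P\<^esub> y)"
    using assms(1) H.one_closed unfolding eqv_def by blast
  then show ?thesis using assms by simp
qed

lemma eqv_\<beta>: "x \<in> carrier P \<Longrightarrow> b \<in> carrier B \<Longrightarrow> eqv (x \<otimes>\<^bsub>P\<^esub> \<beta> b) x"
  by (simp add: eqv_def P.m_assoc[symmetric] signs_mult_\<beta>)

text \<open>The edge \<open>x\<close> is not in the orbit of the edge 1, so no translate of it by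
  \<open>H\<close> is the edge 1 and its ends are never separated.\<close>

lemma eqv_T:
  assumes "x \<in> carrier P" "x \<notin> H"
  shows "eqv (x \<otimes>\<^bsub>P\<^esub> T 1) x"
proof -
  have "pos (k \<otimes>\<^bsub>P\<^esub> x \<otimes>\<^bsub>P\<^esub> T 1) \<longleftrightarrow> pos (k \<otimes>\<^bsub>P\<^esub> x)" if "k \<in> H" for k
  proof (rule pos_mult_T)
    show "k \<otimes>\<^bsub>P\<^esub> x \<noteq> \<one>\<^bsub>P\<^esub>"
      using assms that by (metis H.m_inv_closed H.mem_carrier P.inv_equality P.inv_inv)
  qed (use assms that in auto)
  then show ?thesis using assms by (simp add: eqv_def P.m_assoc)
qed

lemma eqv_cancel:
  assumes "k \<in> H" "x \<in> carrier P" "y \<in> carrier P" "eqv x (k \<otimes>\<^bsub>P\<^esub> y)"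
  shows "eqv (inv\<^bsub>P\<^esub> k \<otimes>\<^bsub>P\<^esub> x) y"
  using eqv_mult[of "inv\<^bsub>P\<^esub> k" x "k \<otimes>\<^bsub>P\<^esub> y"] assms by (simp add: P.m_assoc[symmetric])

text \<open>The tree is connected: walking from the class of 1, every class met is an end of an edge
  \<open>k\<close> with \<open>k\<close> in \<open>L\<close>. Crossing an edge outside
  \<open>H\<close> stays in the class. An edge in \<open>H\<close> shares an end with an edge of
  \<open>L\<close>, hence is itself in \<open>L\<close>; of the four ways to share an end,
  \<open>H0\<close> and \<open>H1\<close> settle start with start and end with end, and the elements
  \<open>s\<close> the two mixed ones.\<close>

lemma subset_of_generated:
  assumes L: "subgroup L P" "L \<subseteq> H"
    and H0: "H0 \<subseteq> L" and H1: "H1 \<subseteq> L" and s: "\<And>s. s \<in> H \<Longrightarrow> eqv s (T 1) \<Longrightarrow> s \<in> L"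
  shows "H \<subseteq> L"
proof -
  interpret L: subgroup L P by (fact L(1))
  have Lq: "p \<in> L" if "k \<in> L" "p \<in> H" "inv\<^bsub>P\<^esub> k \<otimes>\<^bsub>P\<^esub> p \<in> L" for k p
    using L.m_closed[OF that(1,3)] that by (simp add: P.m_assoc[symmetric])
  have reach0: "p \<in> L" if p: "p \<in> H" and k: "k \<in> L" and eqv: "eqv p k \<or> eqv p (k \<otimes>\<^bsub>P\<^esub> T 1)" for p k
  proof (rule Lq[OF k p])
    show "inv\<^bsub>P\<^esub> k \<otimes>\<^bsub>P\<^esub> p \<in> L"
      using eqv
    proof
      assume "eqv p k"
      then have "inv\<^bsub>P\<^esub> k \<otimes>\<^bsub>P\<^esub> p \<in> H0"
        using eqv_cancel[of k p "\<one>\<^bsub>P\<^esub>"] p k L(2) by (auto simp: H0_def)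
      then show ?thesis using H0 by blast
    next
      assume "eqv p (k \<otimes>\<^bsub>P\<^esub> T 1)"
      then show ?thesis
        using eqv_cancel[of k p "T 1"] p k L(2) by (intro s) auto
    qed
  qed
  have reach1: "p \<in> L"
    if p: "p \<in> H" and k: "k \<in> L" and eqv: "eqv (p \<otimes>\<^bsub>P\<^esub> T 1) k \<or> eqv (p \<otimes>\<^bsub>P\<^esub> T 1) (k \<otimes>\<^bsub>P\<^esub> T 1)" for p k
    using eqv
  proof
    assume "eqv (p \<otimes>\<^bsub>P\<^esub> T 1) k"
    then have "inv\<^bsub>P\<^esub> p \<otimes>\<^bsub>P\<^esub> k \<in> L"
      using eqv_cancel[of p k "T 1"] p k L(2) by (intro s) (auto intro: eqv_sym)
    then have "k \<otimes>\<^bsub>P\<^esub> inv\<^bsub>P\<^esub> (inv\<^bsub>P\<^esub> p \<otimes>\<^bsub>P\<^esub> k) \<in> L"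
      using k by blast
    then show ?thesis
      using p k L(2) by (auto simp: P.inv_mult_group P.m_assoc[symmetric])
  next
    assume "eqv (p \<otimes>\<^bsub>P\<^esub> T 1) (k \<otimes>\<^bsub>P\<^esub> T 1)"
    then have "inv\<^bsub>P\<^esub> k \<otimes>\<^bsub>P\<^esub> p \<in> H1"
      using eqv_cancel[of k "p \<otimes>\<^bsub>P\<^esub> T 1" "T 1"] p k L(2) by (auto simp: H1_def P.m_assoc)
    then show ?thesis using H1 Lq[OF k p] by blast
  qed
  have "\<exists>k\<in>L. eqv p k \<or> eqv p (k \<otimes>\<^bsub>P\<^esub> T 1)" if "p \<in> carrier P" for p
    using that
  proof (induction p rule: P_right_induct)
    case one
    then show ?case by (intro bexI[of _ "\<one>\<^bsub>P\<^esub>"]) auto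
  next
    case (\<beta> y b)
    then show ?case using eqv_\<beta>[of y b] eqv_trans by blast
  next
    case (T y e)
    show ?case
    proof (cases "e = 1")
      case True
      then show ?thesis
        using T reach0[of y] eqv_T[of y] eqv_trans eqv_refl by (cases "y \<in> H") blast+
    next
      case False
      then have e: "e = - 1" using T.hyps by linarith
      \<comment> \<open>A step against the orientation crosses the edge \<open>y'\<close> that ends
        in \<open>y\<close>.\<close>
      define y' where "y' = y \<otimes>\<^bsub>P\<^esub> T e"
      have "y' \<otimes>\<^bsub>P\<^esub> T 1 = y"
        using T.hyps T.hom_one by (simp add: y'_def e P.m_assoc T_mult)
      moreover have "y' \<in> carrier P" using T.hyps by (simp add: y'_def)
      ultimately show ?thesis
        using T.IH reach1[of y'] eqv_T[of y'] eqv_trans eqv_sym eqv_refl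
        unfolding y'_def[symmetric] by (cases "y' \<in> H") (metis+)
    qed
  qed
  then show ?thesis using reach0 H.mem_carrier by blast
qed

section \<open>Vertex stabilisers and the half-tree\<close>

lemma subgroup_H0: "subgroup H0 P"
proof (rule P.subgroupI)
  show "inv\<^bsub>P\<^esub> a \<in> H0" if "a \<in> H0" for a
    using that eqv_cancel[of a "\<one>\<^bsub>P\<^esub>" "\<one>\<^bsub>P\<^esub>"] by (auto simp: H0_def intro: eqv_sym)
  show "a \<otimes>\<^bsub>P\<^esub> b \<in> H0" if "a \<in> H0" "b \<in> H0" for a b
    using that eqv_mult[of a b "\<one>\<^bsub>P\<^esub>"] by (auto simp: H0_def intro: eqv_trans)
qed (auto simp: H0_def intro!: exI[of _ "\<one>\<^bsub>P\<^esub>"])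

lemma subgroup_H1: "subgroup H1 P"
proof (rule P.subgroupI)
  show "inv\<^bsub>P\<^esub> a \<in> H1" if "a \<in> H1" for a
    using that eqv_cancel[of a "T 1" "T 1"] by (auto simp: H1_def intro: eqv_sym)
  show "a \<otimes>\<^bsub>P\<^esub> b \<in> H1" if "a \<in> H1" "b \<in> H1" for a b
    using that eqv_mult[of a "b \<otimes>\<^bsub>P\<^esub> T 1" "T 1"] by (auto simp: H1_def P.m_assoc intro: eqv_trans)
qed (auto simp: H1_def intro!: exI[of _ "\<one>\<^bsub>P\<^esub>"])

lemma pos_mult:
  assumes "h \<in> carrier P" "h \<noteq> \<one>\<^bsub>P\<^esub>" "\<not> pos (inv\<^bsub>P\<^esub> h)" "x \<in> carrier P" "pos x"
  shows "pos (h \<otimes>\<^bsub>P\<^esub> x) \<longleftrightarrow> pos h"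
  using start_sign_translate[of "inv\<^bsub>P\<^esub> h" 1 x] assms by simp

lemma pos_mult':
  assumes "h \<in> carrier P" "pos (inv\<^bsub>P\<^esub> h)" "x \<in> carrier P" "\<not> pos x"
  shows "pos (h \<otimes>\<^bsub>P\<^esub> x) \<longleftrightarrow> pos h"
  using start_sign_translate'[of "inv\<^bsub>P\<^esub> h" 1 x] assms by simp

lemma H0_not_pos: "h \<in> H0 \<Longrightarrow> \<not> pos h"
  using eqv_pos[of h "\<one>\<^bsub>P\<^esub>"] by (auto simp: H0_def)

lemma H1_pos:
  assumes "h \<in> H1" "h \<noteq> \<one>\<^bsub>P\<^esub>" shows "pos h"
  using eqv_pos[of "h \<otimes>\<^bsub>P\<^esub> T 1" "T 1"] pos_mult_T[of h] assms by (auto simp: H1_def)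

text \<open>A nontrivial \<open>h\<close> in \<open>H0\<close> takes the edge 1 to another edge
  leaving the same class, and the half-trees beyond two such edges are disjoint.
  \<open>H1_moves\<close> is the mirror image at the other end.\<close>

lemma H0_moves:
  assumes h: "h \<in> H0" "h \<noteq> \<one>\<^bsub>P\<^esub>" and x: "x \<in> carrier P" "pos x"
  shows "\<not> pos (h \<otimes>\<^bsub>P\<^esub> x)"
proof -
  have "inv\<^bsub>P\<^esub> h \<in> H0" using h subgroup.m_inv_closed[OF subgroup_H0] by blast
  then show ?thesis
    using pos_mult[of h x] H0_not_pos h x subgroup.mem_carrier[OF subgroup_H0] by blast
qed

lemma H1_moves:
  assumes h: "h \<in> H1" "h \<noteq> \<one>\<^bsub>P\<^esub>" and x: "x \<in> carrier P" "\<not> pos x"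
  shows "pos (h \<otimes>\<^bsub>P\<^esub> x)"
proof -
  have hP: "h \<in> carrier P" using h subgroup.mem_carrier[OF subgroup_H1] by blast
  have "inv\<^bsub>P\<^esub> h \<in> H1" "inv\<^bsub>P\<^esub> h \<noteq> \<one>\<^bsub>P\<^esub>"
    using h hP subgroup.m_inv_closed[OF subgroup_H1] by auto
  then show ?thesis
    using pos_mult'[of h x] H1_pos h x hP by blast
qed

text \<open>Common end of the two decompositions below: ping-pong supplies injectivity and
  \<open>subset_of_generated\<close> surjectivity. The latter also asks for \<open>H1\<close> and
  the elements \<open>s\<close>, which \<open>gen\<close> obtains from the two factors, differently
  in each case.\<close>

lemma iso_free_product_imageI:
  fixes G1 :: "('c, 'k) monoid_scheme" and G2 :: "('d, 'l) monoid_scheme"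
  assumes G: "group G1" "group G2" and f: "f \<in> hom G1 P" and g: "g \<in> hom G2 P"
    and inj: "inj_on (fp_lift P f g) (carrier (free_product G1 G2))"
    and fH: "f ` carrier G1 \<subseteq> H" and gH: "g ` carrier G2 \<subseteq> H"
    and H0: "H0 \<subseteq> g ` carrier G2"
    and gen: "\<And>L. subgroup L P \<Longrightarrow> L \<subseteq> H \<Longrightarrow> f ` carrier G1 \<subseteq> L \<Longrightarrow> g ` carrier G2 \<subseteq> L \<Longrightarrow>
                 H1 \<subseteq> L \<and> (\<forall>s\<in>H. eqv s (T 1) \<longrightarrow> s \<in> L)"
  shows "free_product G1 G2 \<cong> P\<lparr>carrier := H\<rparr>"
proof -
  let ?F = "fp_lift P f g" and ?Q = "free_product G1 G2"
  interpret Q: group ?Q using group_free_product[OF G] .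
  interpret F: group_hom ?Q P ?F
    using fp_lift_hom[OF G P.is_group f g] by unfold_locales
  interpret G1: group G1 by (fact G)
  interpret G2: group G2 by (fact G)
  have f1: "f \<one>\<^bsub>G1\<^esub> = \<one>\<^bsub>P\<^esub>" and g1: "g \<one>\<^bsub>G2\<^esub> = \<one>\<^bsub>P\<^esub>"
    using hom_one[OF f G(1) P.is_group] hom_one[OF g G(2) P.is_group] .
  have sub: "?F ` carrier ?Q \<subseteq> H"
  proof (intro image_subsetI)
    fix w assume "w \<in> carrier ?Q"
    then have "set w \<subseteq> Inl ` carrier G1 \<union> Inr ` carrier G2"
      using reduced_word_subset[OF G] by (simp add: carrier_free_product)
    then show "?F w \<in> H"
      using fH gH by (induction w) auto
  qed
  have "f a \<in> ?F ` carrier ?Q" if "a \<in> carrier G1" for a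
    using that f hom_in_carrier[OF f that] f1
    by (intro image_eqI[of _ _ "fp_inl G1 a"]) (auto simp: fp_inl_def carrier_free_product reduced_word_Cons)
  moreover have "g a \<in> ?F ` carrier ?Q" if "a \<in> carrier G2" for a
    using that hom_in_carrier[OF g that] g1
    by (intro image_eqI[of _ _ "fp_inr G2 a"]) (auto simp: fp_inr_def carrier_free_product reduced_word_Cons)
  ultimately have "f ` carrier G1 \<subseteq> ?F ` carrier ?Q" "g ` carrier G2 \<subseteq> ?F ` carrier ?Q" by blast+
  then have "H \<subseteq> ?F ` carrier ?Q"
    using gen[OF F.img_is_subgroup sub] H0
    by (intro subset_of_generated F.img_is_subgroup sub) auto
  with sub have "?F ` carrier ?Q = H" by blast
  then have "?F \<in> iso ?Q (P\<lparr>carrier := H\<rparr>)"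
    using inj F.homh by (auto simp: iso_def hom_def bij_betw_def)
  then show ?thesis by (rule is_isoI)
qed

text \<open>If no element of \<open>H\<close> takes the class of 1 to that of \<open>t\<close>, then
  \<open>H\<close> is the free product of \<open>H1\<close> and \<open>H0\<close>; otherwise one
  such \<open>s\<close> generates an infinite cyclic factor complementary to \<open>H0\<close>.
  Indecomposability makes \<open>H\<close> infinite cyclic in the second case and contradicts
  \<open>h0\<close> in the first.\<close>

lemma iso_integer_group_if_translation:
  fixes A :: "('c, 'k) monoid_scheme"
  assumes A: "group A" "freely_indecomposable A" "A \<cong> P\<lparr>carrier := H\<rparr>"
    and h0: "h0 \<in> H" "h0 \<noteq> \<one>\<^bsub>P\<^esub>" "\<And>x. x \<in> carrier P \<Longrightarrow> pos x \<Longrightarrow> pos (h0 \<otimes>\<^bsub>P\<^esub> x)"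
  shows "A \<cong> integer_group"
proof -
  have indec: "carrier G1 = {\<one>\<^bsub>G1\<^esub>} \<or> carrier G2 = {\<one>\<^bsub>G2\<^esub>}"
    if "group G1" "group G2" "free_product G1 G2 \<cong> P\<lparr>carrier := H\<rparr>"
    for G1 :: "('p, 'q) monoid_scheme" and G2 :: "('r, 's) monoid_scheme"
  proof -
    have "P\<lparr>carrier := H\<rparr> \<cong> free_product G1 G2"
      using that group.iso_sym[OF group_free_product] by blast
    then show ?thesis
      using freely_indecomposableD[OF A(2,1) that(1,2)] iso_trans[OF A(3)] by blast
  qed
  have h0P: "h0 \<in> carrier P" using h0 H.mem_carrier by blast
  show ?thesis
  proof (cases "\<exists>s\<in>H. eqv s (T 1)")
    case False
    let ?G0 = "P\<lparr>carrier := H0\<rparr>" and ?G1 = "P\<lparr>carrier := H1\<rparr>"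
    have grp: "group ?G0" "group ?G1"
      using subgroup.subgroup_is_group[OF subgroup_H0] subgroup.subgroup_is_group[OF subgroup_H1] P.is_group by auto
    have hom: "id \<in> hom ?G0 P" "id \<in> hom ?G1 P"
      using subgroup.mem_carrier[OF subgroup_H0] subgroup.mem_carrier[OF subgroup_H1] by (auto simp: hom_def)
    have sub: "H0 \<subseteq> H" "H1 \<subseteq> H" by (auto simp: H0_def H1_def)
    have inj: "inj_on (fp_lift P id id) (carrier (free_product ?G1 ?G0))"
    proof (rule inj_on_fp_liftI[OF grp(2,1) P.is_group hom(2,1), where Y = "{x \<in> carrier P. pos x}" and p = "\<one>\<^bsub>P\<^esub>"])
      show "id a \<otimes>\<^bsub>P\<^esub> x \<in> {x \<in> carrier P. pos x}"
        if "a \<in> carrier ?G1" "a \<noteq> \<one>\<^bsub>?G1\<^esub>" "x \<in> carrier P - {x \<in> carrier P. pos x}" for a x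
        using that H1_moves[of a x] subgroup.mem_carrier[OF subgroup_H1] by auto
      show "id b \<otimes>\<^bsub>P\<^esub> x \<notin> {x \<in> carrier P. pos x}"
        if "b \<in> carrier ?G0" "b \<noteq> \<one>\<^bsub>?G0\<^esub>" "x \<in> {x \<in> carrier P. pos x}" for b x
        using that H0_moves[of b x] by auto
      show "id b \<otimes>\<^bsub>P\<^esub> \<one>\<^bsub>P\<^esub> \<notin> {x \<in> carrier P. pos x}" if "b \<in> carrier ?G0" for b
        using that H0_not_pos[of b] subgroup.mem_carrier[OF subgroup_H0] by auto
    qed auto
    have "free_product ?G1 ?G0 \<cong> P\<lparr>carrier := H\<rparr>"
      using sub False by (intro iso_free_product_imageI[OF grp(2,1) hom(2,1) inj]) auto
    from indec[OF grp(2,1) this] have "H1 = {\<one>\<^bsub>P\<^esub>} \<or> H0 = {\<one>\<^bsub>P\<^esub>}" by simp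
    \<comment> \<open>With one factor trivial, all of \<open>H\<close> fixes an end of the edge 1,
      but \<open>h0\<close> maps the half-tree into itself: in \<open>H0\<close> it would move the
      half-tree off itself, and if \<open>H\<close> were \<open>H1\<close>, the inverse of
      \<open>h0\<close> would lie in the half-tree and be sent by \<open>h0\<close> to 1, which does
      not.\<close>
    then have False
    proof
      assume "H1 = {\<one>\<^bsub>P\<^esub>}"
      then have "H \<subseteq> H0"
        using sub False subgroup.one_closed[OF subgroup_H0]
        by (intro subset_of_generated subgroup_H0) auto
      then show False
        using H0_moves[of h0 "T 1"] h0(3)[of "T 1"] h0 by auto
    next
      assume "H0 = {\<one>\<^bsub>P\<^esub>}"
      then have "H \<subseteq> H1"
        using sub False subgroup.one_closed[OF subgroup_H1]
        by (intro subset_of_generated subgroup_H1) auto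
      then have "pos (inv\<^bsub>P\<^esub> h0)"
        using H1_pos[of "inv\<^bsub>P\<^esub> h0"] h0 h0P by auto
      then show False
        using h0(3)[of "inv\<^bsub>P\<^esub> h0"] h0P by simp
    qed
    then show ?thesis ..
  next
    case True
    then obtain s where s: "s \<in> H" "eqv s (T 1)" by blast
    have sP [simp]: "s \<in> carrier P" using s H.mem_carrier by blast
    let ?G0 = "P\<lparr>carrier := H0\<rparr>" and ?f = "\<lambda>n::int. s [^]\<^bsub>P\<^esub> n"
    have grp: "group ?G0"
      using subgroup.subgroup_is_group[OF subgroup_H0] P.is_group by auto
    have hom: "?f \<in> hom integer_group P" "id \<in> hom ?G0 P"
      using subgroup.mem_carrier[OF subgroup_H0] by (auto simp: hom_def P.int_pow_mult)
    have "pos s" using eqv_pos[OF s(2)] by simp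
    \<comment> \<open>The inverse of \<open>s\<close> takes the class of \<open>t\<close> to that of
      1, outside the half-tree. Together with \<open>pos s\<close> this says that \<open>s\<close>
      translates the half-tree into itself.\<close>
    have "eqv (inv\<^bsub>P\<^esub> s \<otimes>\<^bsub>P\<^esub> s) (inv\<^bsub>P\<^esub> s \<otimes>\<^bsub>P\<^esub> T 1)"
      using eqv_mult[of "inv\<^bsub>P\<^esub> s" s "T 1"] s by simp
    then have "\<not> pos (inv\<^bsub>P\<^esub> s \<otimes>\<^bsub>P\<^esub> T 1)"
      using eqv_pos[of "inv\<^bsub>P\<^esub> s \<otimes>\<^bsub>P\<^esub> s" "inv\<^bsub>P\<^esub> s \<otimes>\<^bsub>P\<^esub> T 1"] by simp
    moreover have "s \<noteq> \<one>\<^bsub>P\<^esub>" using \<open>pos s\<close> by auto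
    ultimately have not_pos_inv: "\<not> pos (inv\<^bsub>P\<^esub> s)"
      using pos_mult_T[of "inv\<^bsub>P\<^esub> s"] by auto
    have s_pos: "pos (s \<otimes>\<^bsub>P\<^esub> x)" if "x \<in> carrier P" "pos x" for x
      using pos_mult[OF _ \<open>s \<noteq> \<one>\<^bsub>P\<^esub>\<close> not_pos_inv that] \<open>pos s\<close> by simp
    have not_pos_pow: "\<not> pos (inv\<^bsub>P\<^esub> (s [^]\<^bsub>P\<^esub> n) \<otimes>\<^bsub>P\<^esub> x)" if "x \<in> carrier P" "\<not> pos x" for x and n :: nat
      using that
    proof (induction n arbitrary: x)
      case (Suc n)
      have "inv\<^bsub>P\<^esub> (s [^]\<^bsub>P\<^esub> Suc n) \<otimes>\<^bsub>P\<^esub> x = inv\<^bsub>P\<^esub> s \<otimes>\<^bsub>P\<^esub> (inv\<^bsub>P\<^esub> (s [^]\<^bsub>P\<^esub> n) \<otimes>\<^bsub>P\<^esub> x)"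
        using Suc.prems by (simp add: P.inv_mult_group P.m_assoc)
      moreover have "\<not> pos (inv\<^bsub>P\<^esub> s \<otimes>\<^bsub>P\<^esub> y)" if "y \<in> carrier P" "\<not> pos y" for y
        using s_pos[of "inv\<^bsub>P\<^esub> s \<otimes>\<^bsub>P\<^esub> y"] that by (auto simp: P.m_assoc[symmetric])
      ultimately show ?case using Suc by simp
    qed simp
    have pos_pow: "pos (s [^]\<^bsub>P\<^esub> n \<otimes>\<^bsub>P\<^esub> x)" if "x \<in> carrier P" "pos x" for x and n :: nat
      using not_pos_pow[of "s [^]\<^bsub>P\<^esub> n \<otimes>\<^bsub>P\<^esub> x" n] that by (auto simp: P.m_assoc[symmetric])
    \<comment> \<open>The complement of \<open>?Y\<close> is the region between the edge of the
      inverse of \<open>s\<close> and the edge 1. It contains the base point 1, and its translates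
      by the powers of \<open>s\<close> are disjoint.\<close>
    let ?Y = "{x \<in> carrier P. pos x \<or> \<not> pos (s \<otimes>\<^bsub>P\<^esub> x)}"
    have f_Y: "?f n \<otimes>\<^bsub>P\<^esub> x \<in> ?Y" if "n \<noteq> 0" "x \<in> carrier P - ?Y" for n x
    proof (cases "n > 0")
      case True
      then obtain m where m: "n = int (Suc m)"
        by (metis Suc_pred zero_less_imp_eq_int of_nat_0_less_iff)
      have "?f n \<otimes>\<^bsub>P\<^esub> x = s [^]\<^bsub>P\<^esub> m \<otimes>\<^bsub>P\<^esub> (s \<otimes>\<^bsub>P\<^esub> x)"
        using that unfolding m int_pow_int by (simp add: P.m_assoc)
      then show ?thesis using pos_pow[of "s \<otimes>\<^bsub>P\<^esub> x" m] that by simp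
    next
      case False
      then obtain m where m: "n = - int (Suc m)"
        using \<open>n \<noteq> 0\<close> by (metis int_cases of_nat_0 of_nat_0_less_iff bot_nat_0.not_eq_extremum)
      have "?f n \<otimes>\<^bsub>P\<^esub> x = inv\<^bsub>P\<^esub> s \<otimes>\<^bsub>P\<^esub> (inv\<^bsub>P\<^esub> (s [^]\<^bsub>P\<^esub> m) \<otimes>\<^bsub>P\<^esub> x)"
        using that unfolding m P.int_pow_neg[OF sP] int_pow_int by (simp add: P.inv_mult_group P.m_assoc)
      then have "s \<otimes>\<^bsub>P\<^esub> (?f n \<otimes>\<^bsub>P\<^esub> x) = inv\<^bsub>P\<^esub> (s [^]\<^bsub>P\<^esub> m) \<otimes>\<^bsub>P\<^esub> x"
        using that by (simp add: P.m_assoc[symmetric])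
      then show ?thesis using not_pos_pow[of x m] that by simp
    qed
    have H0P: "h \<in> carrier P" "h \<in> H" if "h \<in> H0" for h using that by (auto simp: H0_def)
    \<comment> \<open>Like \<open>s\<close>, every \<open>s \<otimes> h\<close> takes the class of 1
      to that of \<open>t\<close> and so translates the half-tree into itself.\<close>
    have pos_sh: "pos (s \<otimes>\<^bsub>P\<^esub> h)" "\<not> pos (inv\<^bsub>P\<^esub> (s \<otimes>\<^bsub>P\<^esub> h))" "s \<otimes>\<^bsub>P\<^esub> h \<noteq> \<one>\<^bsub>P\<^esub>" if h: "h \<in> H0" for h
    proof -
      have "eqv (s \<otimes>\<^bsub>P\<^esub> h) (s \<otimes>\<^bsub>P\<^esub> \<one>\<^bsub>P\<^esub>)"
        using h s H0P[OF h] by (intro eqv_mult) (auto simp: H0_def)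
      then show p: "pos (s \<otimes>\<^bsub>P\<^esub> h)"
        using eqv_pos[of "s \<otimes>\<^bsub>P\<^esub> h" s] H0P[OF h] \<open>pos s\<close> by simp
      then show ne: "s \<otimes>\<^bsub>P\<^esub> h \<noteq> \<one>\<^bsub>P\<^esub>" by auto
      let ?k = "inv\<^bsub>P\<^esub> (s \<otimes>\<^bsub>P\<^esub> h)"
      have "?k \<in> H" using h H0P s by blast
      then have "eqv (?k \<otimes>\<^bsub>P\<^esub> s) (?k \<otimes>\<^bsub>P\<^esub> T 1)"
        using s by (intro eqv_mult) auto
      moreover have "?k \<otimes>\<^bsub>P\<^esub> s = inv\<^bsub>P\<^esub> h"
        using H0P[OF h] by (simp add: P.inv_mult_group P.m_assoc)
      moreover have "\<not> pos (inv\<^bsub>P\<^esub> h)"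
        using h subgroup.m_inv_closed[OF subgroup_H0] H0_not_pos by blast
      ultimately have "\<not> pos (?k \<otimes>\<^bsub>P\<^esub> T 1)"
        using eqv_pos[of "?k \<otimes>\<^bsub>P\<^esub> s" "?k \<otimes>\<^bsub>P\<^esub> T 1"] H0P[OF h] by simp
      then show "\<not> pos ?k"
        using pos_mult_T[of ?k] ne H0P[OF h] by simp
    qed
    \<comment> \<open>Since \<open>s\<close> takes the class of 1 to that of \<open>t\<close>, it
      conjugates the stabiliser of the former into that of the latter.\<close>
    have conj_H1: "s \<otimes>\<^bsub>P\<^esub> h \<otimes>\<^bsub>P\<^esub> inv\<^bsub>P\<^esub> s \<in> H1" if h: "h \<in> H0" for h
    proof -
      have "eqv (inv\<^bsub>P\<^esub> s \<otimes>\<^bsub>P\<^esub> T 1) \<one>\<^bsub>P\<^esub>"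
        using eqv_cancel[of s "T 1" "\<one>\<^bsub>P\<^esub>"] s by (auto intro: eqv_sym)
      then have "eqv (s \<otimes>\<^bsub>P\<^esub> h \<otimes>\<^bsub>P\<^esub> (inv\<^bsub>P\<^esub> s \<otimes>\<^bsub>P\<^esub> T 1)) (s \<otimes>\<^bsub>P\<^esub> h \<otimes>\<^bsub>P\<^esub> \<one>\<^bsub>P\<^esub>)"
        using h s H0P[OF h] by (intro eqv_mult) auto
      moreover have "eqv (s \<otimes>\<^bsub>P\<^esub> h) (s \<otimes>\<^bsub>P\<^esub> \<one>\<^bsub>P\<^esub>)"
        using h s H0P[OF h] by (intro eqv_mult) (auto simp: H0_def)
      ultimately show ?thesis
        using s h H0P[OF h] by (auto simp: H1_def P.m_assoc intro: eqv_trans)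
    qed
    have inj: "inj_on (fp_lift P ?f id) (carrier (free_product integer_group ?G0))"
    proof (rule inj_on_fp_liftI[OF group_integer_group grp P.is_group hom, where Y = ?Y and p = "\<one>\<^bsub>P\<^esub>"])
      show "?f a \<otimes>\<^bsub>P\<^esub> x \<in> ?Y"
        if "a \<in> carrier integer_group" "a \<noteq> \<one>\<^bsub>integer_group\<^esub>" "x \<in> carrier P - ?Y" for a x
        using that f_Y by simp
      show "id b \<otimes>\<^bsub>P\<^esub> \<one>\<^bsub>P\<^esub> \<notin> ?Y" if "b \<in> carrier ?G0" for b
        using that H0_not_pos[of b] pos_sh[of b] H0P[of b] by simp
      show "id b \<otimes>\<^bsub>P\<^esub> x \<notin> ?Y" if "b \<in> carrier ?G0" "b \<noteq> \<one>\<^bsub>?G0\<^esub>" "x \<in> ?Y" for b x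
      proof -
        have b: "b \<in> H0" "b \<noteq> \<one>\<^bsub>P\<^esub>" "b \<in> carrier P" using that H0P by auto
        have ib: "inv\<^bsub>P\<^esub> b \<in> H0" using b subgroup.m_inv_closed[OF subgroup_H0] by blast
        show ?thesis
        proof (cases "pos x")
          case True
          then show ?thesis
            using H0_moves[OF b(1,2), of x] pos_mult[of "s \<otimes>\<^bsub>P\<^esub> b" x] pos_sh[OF b(1)] that b
            by (simp add: P.m_assoc)
        next
          case False
          \<comment> \<open>Translation by \<open>s\<close> carries this part of \<open>?Y\<close>
            to the complement of the half-tree and turns \<open>b\<close> into its conjugate in
            \<open>H1\<close>.\<close>
          define y where "y = s \<otimes>\<^bsub>P\<^esub> x"
          have y: "y \<in> carrier P" "\<not> pos y" "x = inv\<^bsub>P\<^esub> s \<otimes>\<^bsub>P\<^esub> y"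
            using False that by (auto simp: y_def P.m_assoc[symmetric])
          have "s \<otimes>\<^bsub>P\<^esub> b \<otimes>\<^bsub>P\<^esub> inv\<^bsub>P\<^esub> s \<noteq> \<one>\<^bsub>P\<^esub>"
            using P.inv_equality[of "s \<otimes>\<^bsub>P\<^esub> b" "inv\<^bsub>P\<^esub> s"] b by auto
          then have "pos (s \<otimes>\<^bsub>P\<^esub> b \<otimes>\<^bsub>P\<^esub> inv\<^bsub>P\<^esub> s \<otimes>\<^bsub>P\<^esub> y)"
            using H1_moves[OF conj_H1[OF b(1)] _ y(1,2)] by simp
          moreover have "\<not> pos (b \<otimes>\<^bsub>P\<^esub> inv\<^bsub>P\<^esub> s \<otimes>\<^bsub>P\<^esub> y)"
          proof -
            have eq: "inv\<^bsub>P\<^esub> (s \<otimes>\<^bsub>P\<^esub> inv\<^bsub>P\<^esub> b) = b \<otimes>\<^bsub>P\<^esub> inv\<^bsub>P\<^esub> s"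
              using b by (simp add: P.inv_mult_group)
            show ?thesis
              using pos_mult'[of "b \<otimes>\<^bsub>P\<^esub> inv\<^bsub>P\<^esub> s" y] pos_sh[OF ib] y b
              by (simp add: eq P.inv_mult_group)
          qed
          ultimately show ?thesis using y b by (simp add: P.m_assoc)
        qed
      qed
    qed (use \<open>pos s\<close> in auto)
    have sub: "H0 \<subseteq> H" "range ?f \<subseteq> H"
      using s P.subgroup_int_pow_closed[OF H] by (auto simp: H0_def)
    have gen: "H1 \<subseteq> L \<and> (\<forall>s\<in>H. eqv s (T 1) \<longrightarrow> s \<in> L)"
      if L: "subgroup L P" "L \<subseteq> H" "range ?f \<subseteq> L" "H0 \<subseteq> L" for L
    proof -
      interpret L: subgroup L P by (fact L)
      have sL: "s \<in> L" using L(3) by (metis P.int_pow_1 rangeI sP subset_iff)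
      have *: "r \<in> L" if r: "r \<in> H" "eqv r (T 1)" for r
      proof -
        have "eqv r (s \<otimes>\<^bsub>P\<^esub> \<one>\<^bsub>P\<^esub>)" using r s by (auto intro: eqv_trans eqv_sym)
        then have "inv\<^bsub>P\<^esub> s \<otimes>\<^bsub>P\<^esub> r \<in> H0"
          using eqv_cancel[of s r "\<one>\<^bsub>P\<^esub>"] r s by (auto simp: H0_def)
        then have "s \<otimes>\<^bsub>P\<^esub> (inv\<^bsub>P\<^esub> s \<otimes>\<^bsub>P\<^esub> r) \<in> L" using L(4) sL by blast
        then show ?thesis using r by (simp add: P.m_assoc[symmetric])
      qed
      moreover have "h \<in> L" if h: "h \<in> H1" for h
      proof -
        have hH: "h \<in> H" "eqv (h \<otimes>\<^bsub>P\<^esub> T 1) (T 1)" using h by (auto simp: H1_def)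
        have "eqv (h \<otimes>\<^bsub>P\<^esub> s) (T 1)"
          using eqv_mult[of h s "T 1"] hH s by (auto intro: eqv_trans)
        then have "h \<otimes>\<^bsub>P\<^esub> s \<in> L" using * hH s by blast
        then have "h \<otimes>\<^bsub>P\<^esub> s \<otimes>\<^bsub>P\<^esub> inv\<^bsub>P\<^esub> s \<in> L" using sL by blast
        then show ?thesis using hH by (simp add: P.m_assoc)
      qed
      ultimately show ?thesis by blast
    qed
    have iso: "free_product integer_group ?G0 \<cong> P\<lparr>carrier := H\<rparr>"
      by (rule iso_free_product_imageI[OF group_integer_group grp hom inj]) (use sub gen in auto)
    have "(UNIV :: int set) \<noteq> {0}" by (metis UNIV_I singletonD zero_neq_one)
    with indec[OF group_integer_group grp iso] have H0: "H0 = {\<one>\<^bsub>P\<^esub>}" by simp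
    interpret f: group_hom integer_group P ?f
      using hom(1) by (intro group_hom.intro group_hom_axioms.intro P.is_group group_integer_group)
    have "range ?f = H"
      using f.img_is_subgroup sub gen[of "range ?f"] H0 subset_of_generated[of "range ?f"]
        subgroup.one_closed[OF f.img_is_subgroup] by auto
    moreover have "inj ?f"
    proof -
      have "n = 0" if "?f n = \<one>\<^bsub>P\<^esub>" for n
        using f_Y[of n "\<one>\<^bsub>P\<^esub>"] that \<open>pos s\<close> by auto
      then show ?thesis
        using f.inj_on_one_iff by simp
    qed
    ultimately have "?f \<in> iso integer_group (P\<lparr>carrier := H\<rparr>)"
      by (auto simp: iso_def hom_def bij_betw_def P.int_pow_mult)
    then have "P\<lparr>carrier := H\<rparr> \<cong> integer_group"
      using group.iso_sym[OF group_integer_group] is_isoI by blast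
    then show ?thesis using iso_trans[OF A(3)] by blast
  qed
qed

end

section \<open>Automorphisms preserve the conjugacy class of the indecomposable factor\<close>

context free_product_Z
begin

definition conjugate :: "(int + 'b) list \<Rightarrow> (int + 'b) list \<Rightarrow> (int + 'b) list" where
  "conjugate k x = inv\<^bsub>P\<^esub> k \<otimes>\<^bsub>P\<^esub> x \<otimes>\<^bsub>P\<^esub> k"

lemma conjugate_closed [simp]: "k \<in> carrier P \<Longrightarrow> x \<in> carrier P \<Longrightarrow> conjugate k x \<in> carrier P"
  by (simp add: conjugate_def)

lemma conjugate_one [simp]: "x \<in> carrier P \<Longrightarrow> conjugate \<one>\<^bsub>P\<^esub> x = x" "k \<in> carrier P \<Longrightarrow> conjugate k \<one>\<^bsub>P\<^esub> = \<one>\<^bsub>P\<^esub>"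
  by (simp_all add: conjugate_def)

lemma conjugate_mult:
  "k \<in> carrier P \<Longrightarrow> x \<in> carrier P \<Longrightarrow> y \<in> carrier P \<Longrightarrow> conjugate k (x \<otimes>\<^bsub>P\<^esub> y) = conjugate k x \<otimes>\<^bsub>P\<^esub> conjugate k y"
proof -
  assume *: "k \<in> carrier P" "x \<in> carrier P" "y \<in> carrier P"
  have "k \<otimes>\<^bsub>P\<^esub> (inv\<^bsub>P\<^esub> k \<otimes>\<^bsub>P\<^esub> (y \<otimes>\<^bsub>P\<^esub> k)) = y \<otimes>\<^bsub>P\<^esub> k"
    using * by (simp add: P.m_assoc[symmetric])
  with * show ?thesis by (simp add: conjugate_def P.m_assoc)
qed

lemma conjugate_conjugate: "k \<in> carrier P \<Longrightarrow> g \<in> carrier P \<Longrightarrow> x \<in> carrier P \<Longrightarrow> conjugate g (conjugate k x) = conjugate (k \<otimes>\<^bsub>P\<^esub> g) x"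
  by (simp add: conjugate_def P.inv_mult_group P.m_assoc)

lemma conjugate_hom: "k \<in> carrier P \<Longrightarrow> conjugate k \<in> hom P P"
  by (simp add: hom_def conjugate_mult)

lemma conjugate_inv: "k \<in> carrier P \<Longrightarrow> x \<in> carrier P \<Longrightarrow> inv\<^bsub>P\<^esub> (conjugate k x) = conjugate k (inv\<^bsub>P\<^esub> x)"
  by (simp add: conjugate_def P.inv_mult_group P.m_assoc)

lemma conjugate_cancel [simp]:
  "k \<in> carrier P \<Longrightarrow> x \<in> carrier P \<Longrightarrow> conjugate k (conjugate (inv\<^bsub>P\<^esub> k) x) = x"
  "k \<in> carrier P \<Longrightarrow> x \<in> carrier P \<Longrightarrow> conjugate (inv\<^bsub>P\<^esub> k) (conjugate k x) = x"
  by (simp_all add: conjugate_conjugate)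

lemma conjugate_eq_one_iff [simp]: "k \<in> carrier P \<Longrightarrow> x \<in> carrier P \<Longrightarrow> conjugate k x = \<one>\<^bsub>P\<^esub> \<longleftrightarrow> x = \<one>\<^bsub>P\<^esub>"
  by (metis P.inv_closed conjugate_cancel(2) conjugate_one(2))

lemma conjugate_\<beta>: "b \<in> carrier B \<Longrightarrow> c \<in> carrier B \<Longrightarrow> conjugate (\<beta> b) (\<beta> c) = \<beta> (inv\<^bsub>B\<^esub> b \<otimes>\<^bsub>B\<^esub> c \<otimes>\<^bsub>B\<^esub> b)"
  by (simp add: conjugate_def)

lemma inj_conjugate: "k \<in> carrier P \<Longrightarrow> inj_on (conjugate k) (carrier P)"
  by (rule inj_on_inverseI[of _ "conjugate (inv\<^bsub>P\<^esub> k)"]) simp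

lemma subgroup_B: "subgroup (\<beta> ` carrier B) P"
  by (rule \<beta>.img_is_subgroup)

lemma \<beta>_eq_one_iff [simp]: "\<beta> b = \<one>\<^bsub>P\<^esub> \<longleftrightarrow> b = \<one>\<^bsub>B\<^esub>"
  by (simp add: fp_inr_def one_P)

section \<open>Cyclic reduction\<close>

definition strip :: "(int + 'b) list \<Rightarrow> (int + 'b) list" where
  "strip x = \<beta> (inv\<^bsub>B\<^esub> (lead x)) \<otimes>\<^bsub>P\<^esub> x"

lemma strip:
  assumes "x \<in> carrier P"
  shows strip_closed: "strip x \<in> carrier P" and signs_strip: "signs (strip x) = signs x"
    and lead_strip: "lead (strip x) = \<one>\<^bsub>B\<^esub>" and \<beta>_strip: "x = \<beta> (lead x) \<otimes>\<^bsub>P\<^esub> strip x"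
    and start_strip: "signs x \<noteq> [] \<Longrightarrow> start_sign (strip x) = hd (signs x)"
proof -
  have i: "inv\<^bsub>B\<^esub> (lead x) \<in> carrier B" using assms by simp
  show c: "strip x \<in> carrier P" and s: "signs (strip x) = signs x" and l: "lead (strip x) = \<one>\<^bsub>B\<^esub>"
    using P.m_closed[OF \<beta>.hom_closed[OF i] assms] signs_\<beta>_mult[OF i assms] lead_\<beta>_mult[OF i assms]
      B.l_inv[OF lead_closed[OF assms]] by (simp_all only: strip_def)
  show "start_sign (strip x) = hd (signs x)" if "signs x \<noteq> []"
    using start_sign_eq[OF c] s l that by simp
  have "\<beta> (lead x) \<otimes>\<^bsub>P\<^esub> strip x = (\<beta> (lead x) \<otimes>\<^bsub>P\<^esub> \<beta> (inv\<^bsub>B\<^esub> (lead x))) \<otimes>\<^bsub>P\<^esub> x"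
    unfolding strip_def using assms by (intro P.m_assoc[symmetric]) auto
  also have "\<dots> = x" using assms by simp
  finally show "x = \<beta> (lead x) \<otimes>\<^bsub>P\<^esub> strip x" ..
qed

lemma abs_hd_signs: "x \<in> carrier P \<Longrightarrow> signs x \<noteq> [] \<Longrightarrow> \<bar>hd (signs x)\<bar> = 1"
  using abs_signs by simp

lemma start_sign_conjugate_lead:
  assumes "x \<in> carrier P" "signs x \<noteq> []"
  shows "start_sign (conjugate (\<beta> (lead x)) x) = hd (signs x)" "signs (conjugate (\<beta> (lead x)) x) = signs x"
proof -
  have "conjugate (\<beta> (lead x)) x = strip x \<otimes>\<^bsub>P\<^esub> \<beta> (lead x)"
    using assms by (simp add: conjugate_def strip_def)
  with assms show "start_sign (conjugate (\<beta> (lead x)) x) = hd (signs x)" "signs (conjugate (\<beta> (lead x)) x) = signs x"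
    using signs_mult_\<beta>(1,2)[OF strip_closed lead_closed] by (simp_all add: start_strip signs_strip)
qed

lemma start_sign_conj_T:
  assumes y: "y \<in> carrier P" "start_sign y = s" and s: "\<bar>s\<bar> = 1"
  shows "start_sign (conjugate (T s) y) \<noteq> - s"
proof -
  have ne: "y \<noteq> \<one>\<^bsub>P\<^esub>" using y s by auto
  have "conjugate (T s) y \<otimes>\<^bsub>P\<^esub> T (- s) = T (- s) \<otimes>\<^bsub>P\<^esub> y"
    using y T.hom_one by (simp add: conjugate_def P.m_assoc T_mult inv_T)
  moreover have "start_sign (T (- s) \<otimes>\<^bsub>P\<^esub> y) \<noteq> - s"
    using y s by (intro T_mult_unreduced) auto
  ultimately show ?thesis
    using start_sign_mult_T[of "conjugate (T s) y" "- s"] ne y s by auto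
qed

text \<open>The conjugation surrounds \<open>z\<close> with \<open>T s\<close> and its inverse. The
  hypotheses on both ends of \<open>z\<close> keep the new letters from cancelling against
  \<open>z\<close>, and nontriviality of \<open>z\<close> keeps them from cancelling each
  other.\<close>

lemma unpeel:
  assumes z: "z \<in> carrier P" "z \<noteq> \<one>\<^bsub>P\<^esub>" "start_sign z \<noteq> - s" "start_sign (inv\<^bsub>P\<^esub> z) \<noteq> - s"
    and s: "\<bar>s\<bar> = 1"
  shows "signs (conjugate (T (- s)) z) = s # signs z @ [- s]" "start_sign (conjugate (T (- s)) z) = s"
proof -
  define y where "y = z \<otimes>\<^bsub>P\<^esub> T (- s)"
  have yP: "y \<in> carrier P" using z by (simp add: y_def)
  have "inv\<^bsub>P\<^esub> y = T s \<otimes>\<^bsub>P\<^esub> inv\<^bsub>P\<^esub> z"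
    using z by (simp add: y_def P.inv_mult_group inv_T)
  then have "signs (inv\<^bsub>P\<^esub> y) = s # signs (inv\<^bsub>P\<^esub> z)"
    using T_mult_reduced(1)[OF s P.inv_closed[OF z(1)] z(4)] by simp
  then have "inv_signs (inv_signs (signs y)) = inv_signs (s # inv_signs (signs z))"
    unfolding signs_inv[OF yP] signs_inv[OF z(1)] by simp
  then have "signs y = signs z @ [- s]" by simp
  moreover have "start_sign y \<noteq> - s"
    using start_sign_mult_T[of z "- s"] z s by (simp add: y_def)
  moreover have "conjugate (T (- s)) z = T s \<otimes>\<^bsub>P\<^esub> y"
    using z by (simp add: conjugate_def y_def inv_T P.m_assoc)
  ultimately show "signs (conjugate (T (- s)) z) = s # signs z @ [- s]" "start_sign (conjugate (T (- s)) z) = s"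
    using T_mult_reduced[OF s yP] by simp_all
qed

text \<open>An element that begins with \<open>T s\<close> and ends with its inverse is not
  cyclically reduced, and conjugation shortens it by two. The other conclusions are exactly what
  \<open>unpeel\<close> needs to restore it.\<close>

lemma peel:
  assumes y: "y \<in> carrier P" "start_sign y = s" "start_sign (inv\<^bsub>P\<^esub> y) = s" and s: "\<bar>s\<bar> = 1"
  shows "signs y = s # signs (conjugate (T s) y) @ [- s]"
    and "start_sign (conjugate (T s) y) \<noteq> - s" "start_sign (inv\<^bsub>P\<^esub> (conjugate (T s) y)) \<noteq> - s" "conjugate (T s) y \<noteq> \<one>\<^bsub>P\<^esub>"
proof -
  show *: "start_sign (conjugate (T s) y) \<noteq> - s" "start_sign (inv\<^bsub>P\<^esub> (conjugate (T s) y)) \<noteq> - s" "conjugate (T s) y \<noteq> \<one>\<^bsub>P\<^esub>"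
    using start_sign_conj_T[of y s] start_sign_conj_T[of "inv\<^bsub>P\<^esub> y" s] y s by (auto simp: conjugate_inv)
  have "conjugate (T (- s)) (conjugate (T s) y) = y" using y by (simp add: flip: inv_T)
  then show "signs y = s # signs (conjugate (T s) y) @ [- s]"
    using unpeel(1)[OF _ *(3,1,2) s] y by simp
qed

text \<open>For nontrivial \<open>h\<close> these are the elements acting on the tree without a
  fixed vertex; conjugates and inverses make the condition independent of the choice of edge and
  direction. The identity satisfies it as well, so later hypotheses exclude it.\<close>

definition translates :: "(int + 'b) list \<Rightarrow> bool" where
  "translates h \<longleftrightarrow>
     (\<exists>g\<in>carrier P. \<exists>h'\<in>{h, inv\<^bsub>P\<^esub> h}. \<forall>x\<in>carrier P. pos x \<longrightarrow> pos (conjugate g h' \<otimes>\<^bsub>P\<^esub> x))"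

lemma translates_conjugate:
  assumes "g \<in> carrier P" "h \<in> carrier P" "translates (conjugate g h)"
  shows "translates h"
proof -
  obtain k h'' where k: "k \<in> carrier P" "h'' \<in> {conjugate g h, inv\<^bsub>P\<^esub> (conjugate g h)}"
    "\<forall>x\<in>carrier P. pos x \<longrightarrow> pos (conjugate k h'' \<otimes>\<^bsub>P\<^esub> x)"
    using assms(3) unfolding translates_def by blast
  obtain h' where h': "h' \<in> {h, inv\<^bsub>P\<^esub> h}" "h'' = conjugate g h'"
    using k(2) conjugate_inv[OF assms(1,2)] by blast
  then have "conjugate k h'' = conjugate (g \<otimes>\<^bsub>P\<^esub> k) h'"
    using conjugate_conjugate assms k(1) by auto
  then show ?thesis
    unfolding translates_def using assms(1) k h'(1) by (metis P.m_closed)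
qed

lemma translates_inv: "h \<in> carrier P \<Longrightarrow> translates (inv\<^bsub>P\<^esub> h) \<Longrightarrow> translates h"
  by (auto simp: translates_def)

lemma translates_pos:
  assumes "h \<in> carrier P" "pos h" "\<not> pos (inv\<^bsub>P\<^esub> h)"
  shows "translates h"
proof -
  have "h \<noteq> \<one>\<^bsub>P\<^esub>" using assms by auto
  then have "pos (h \<otimes>\<^bsub>P\<^esub> x)" if "x \<in> carrier P" "pos x" for x
    using start_sign_translate[of "inv\<^bsub>P\<^esub> h" 1 x] assms that by simp
  then show ?thesis
    unfolding translates_def using assms(1)
    by (intro bexI[of _ "\<one>\<^bsub>P\<^esub>"] bexI[where x = h and A = "{h, _}"]) auto
qed

text \<open>The words beginning with a negative integer are the complement of the half-tree
  translated by the inverse of \<open>t\<close>. If \<open>h\<close> maps them into themselves, then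
  its inverse, conjugated by \<open>t\<close>, does so with the half-tree; hence the element
  \<open>k\<close> for \<open>s = -1\<close>.\<close>

lemma translates_start_sign:
  assumes h: "h \<in> carrier P" "start_sign h = s" "start_sign (inv\<^bsub>P\<^esub> h) \<noteq> s" and s: "\<bar>s\<bar> = 1"
  shows "translates h"
proof (cases "s = 1")
  case True
  then show ?thesis using h translates_pos by blast
next
  case False
  then have s: "s = - 1" using s by linarith
  have ne: "h \<noteq> \<one>\<^bsub>P\<^esub>" using h s by auto
  define k where "k = conjugate (T (- 1)) (inv\<^bsub>P\<^esub> h)"
  have kP: "k \<in> carrier P" "k \<noteq> \<one>\<^bsub>P\<^esub>" "inv\<^bsub>P\<^esub> k \<noteq> \<one>\<^bsub>P\<^esub>" using h ne by (simp_all add: k_def)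
  have "k \<otimes>\<^bsub>P\<^esub> T 1 = T 1 \<otimes>\<^bsub>P\<^esub> inv\<^bsub>P\<^esub> h" "inv\<^bsub>P\<^esub> k \<otimes>\<^bsub>P\<^esub> T 1 = T 1 \<otimes>\<^bsub>P\<^esub> h"
    unfolding k_def conjugate_inv[OF T_closed P.inv_closed[OF h(1)]]
    using h T.hom_one by (simp_all add: conjugate_def inv_T P.m_assoc T_mult)
  then have "pos k" "\<not> pos (inv\<^bsub>P\<^esub> k)"
    using pos_mult_T[of k] pos_mult_T[of "inv\<^bsub>P\<^esub> k"] kP h s T_mult_reduced(2)[of 1 "inv\<^bsub>P\<^esub> h"]
      T_mult_unreduced[of 1 h] by auto
  then have "translates k" using translates_pos kP by blast
  then have "translates (inv\<^bsub>P\<^esub> h)"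
    using translates_conjugate[OF T_closed P.inv_closed[OF h(1)]] unfolding k_def by blast
  then show ?thesis by (rule translates_inv[OF h(1)])
qed

text \<open>An isometry of the tree fixes a vertex or has an axis; here this is cyclic reduction.
  Once the leading letter is conjugated away, an element that begins like its inverse is peeled, and
  any other one translates.\<close>

lemma translates_or_conjugate_into_B:
  assumes "x \<in> carrier P"
  shows "translates x \<or> (\<exists>g\<in>carrier P. conjugate g x \<in> \<beta> ` carrier B)"
  using assms
proof (induction "length (signs x)" arbitrary: x rule: less_induct)
  case (less x)
  show ?case
  proof (cases "signs x = []")
    case True
    then show ?thesis
      using less.prems signs_Nil_iff by (intro disjI2 bexI[of _ "\<one>\<^bsub>P\<^esub>"]) auto
  next
    case False
    define k s where "k = \<beta> (lead x)" and "s = hd (signs x)"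
    have k: "k \<in> carrier P" and s: "\<bar>s\<bar> = 1"
      using less.prems False abs_hd_signs by (simp_all add: k_def s_def)
    define y where "y = conjugate k x"
    have y: "y \<in> carrier P" "start_sign y = s" "signs y = signs x"
      using start_sign_conjugate_lead[OF less.prems False] k less.prems by (simp_all add: y_def k_def s_def)
    show ?thesis
    proof (cases "start_sign (inv\<^bsub>P\<^esub> y) = s")
      case False
      then have "translates y" using translates_start_sign y s by blast
      then show ?thesis using translates_conjugate k less.prems unfolding y_def by blast
    next
      case True
      have "length (signs (conjugate (T s) y)) < length (signs x)"
        using peel(1)[OF y(1,2) True s] y(3) by simp
      from less.hyps[OF this] have "translates y \<or> (\<exists>g\<in>carrier P. conjugate g (conjugate (T s) y) \<in> \<beta> ` carrier B)"
        using y(1) translates_conjugate[of "T s" y] by auto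
      then show ?thesis
      proof
        assume "translates y"
        then show ?thesis using translates_conjugate[OF k less.prems] by (simp add: y_def)
      next
        assume "\<exists>g\<in>carrier P. conjugate g (conjugate (T s) y) \<in> \<beta> ` carrier B"
        then obtain g where "g \<in> carrier P" "conjugate g (conjugate (T s) y) \<in> \<beta> ` carrier B" by blast
        then have "conjugate (k \<otimes>\<^bsub>P\<^esub> (T s \<otimes>\<^bsub>P\<^esub> g)) x \<in> \<beta> ` carrier B" "k \<otimes>\<^bsub>P\<^esub> (T s \<otimes>\<^bsub>P\<^esub> g) \<in> carrier P"
          using k less.prems by (simp_all add: y_def conjugate_conjugate P.m_assoc)
        then show ?thesis by blast
      qed
    qed
  qed
qed

text \<open>If, after conjugating the leading letter away, \<open>h\<close> begins like its inverse,
  a nontrivial letter of \<open>B\<close> at its right end shields it: the inverse of the product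
  begins in \<open>B\<close>, while the product still begins as \<open>h\<close> does.\<close>

lemma translates_mult_B:
  assumes b: "b \<in> carrier B" "b \<noteq> \<one>\<^bsub>B\<^esub>" and h: "h \<in> carrier P" "h \<notin> \<beta> ` carrier B"
  shows "translates h \<or> translates (h \<otimes>\<^bsub>P\<^esub> \<beta> b)"
proof -
  define k s where "k = \<beta> (lead h)" and "s = hd (signs h)"
  have ne: "signs h \<noteq> []" using h signs_Nil_iff by blast
  have k: "k \<in> carrier P" and s: "\<bar>s\<bar> = 1"
    using h ne abs_hd_signs by (simp_all add: k_def s_def)
  define y where "y = conjugate k h"
  define c where "c = inv\<^bsub>B\<^esub> (lead h) \<otimes>\<^bsub>B\<^esub> b \<otimes>\<^bsub>B\<^esub> lead h"
  have c: "c \<in> carrier B" "conjugate k (\<beta> b) = \<beta> c"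
    using b h by (simp_all add: c_def k_def conjugate_\<beta>)
  have c1: "c \<noteq> \<one>\<^bsub>B\<^esub>"
    using conjugate_eq_one_iff[OF k, of "\<beta> b"] b c by auto
  have y: "y \<in> carrier P" "start_sign y = s" "signs y = signs h"
    using start_sign_conjugate_lead[OF h(1) ne] k h by (simp_all add: y_def k_def s_def)
  show ?thesis
  proof (cases "start_sign (inv\<^bsub>P\<^esub> y) = s")
    case False
    then show ?thesis using translates_start_sign y s translates_conjugate[OF k h(1)] y_def by blast
  next
    case True
    then have "lead (inv\<^bsub>P\<^esub> y) = \<one>\<^bsub>B\<^esub>" using start_sign_lead[of "inv\<^bsub>P\<^esub> y"] y s by auto
    then have "lead (inv\<^bsub>P\<^esub> (y \<otimes>\<^bsub>P\<^esub> \<beta> c)) = inv\<^bsub>B\<^esub> c"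
      using y c by (simp add: P.inv_mult_group flip: \<beta>.hom_inv)
    then have "start_sign (inv\<^bsub>P\<^esub> (y \<otimes>\<^bsub>P\<^esub> \<beta> c)) = 0"
      using y c c1 by (simp add: start_sign_eq)
    then have "translates (y \<otimes>\<^bsub>P\<^esub> \<beta> c)"
      using y c s signs_mult_\<beta>(2)[of y c] by (intro translates_start_sign[where s = s]) auto
    moreover have "y \<otimes>\<^bsub>P\<^esub> \<beta> c = conjugate k (h \<otimes>\<^bsub>P\<^esub> \<beta> b)"
      using h b k c by (simp add: y_def conjugate_mult)
    ultimately show ?thesis using translates_conjugate[OF k, of "h \<otimes>\<^bsub>P\<^esub> \<beta> b"] h b by simp
  qed
qed

text \<open>A subgroup all of whose elements fix vertices has a common fixed vertex: once a
  nontrivial \<open>h1\<close> is conjugated into \<open>B\<close>, an \<open>h2\<close> left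
  outside \<open>B\<close> would make \<open>h2\<close> or \<open>h2 \<otimes> h1\<close>
  translate.\<close>

lemma conjugate_into_B:
  assumes H: "subgroup H P" and nt: "\<And>h. h \<in> H \<Longrightarrow> h \<noteq> \<one>\<^bsub>P\<^esub> \<Longrightarrow> \<not> translates h"
  shows "\<exists>g\<in>carrier P. conjugate g ` H \<subseteq> \<beta> ` carrier B"
proof (cases "H = {\<one>\<^bsub>P\<^esub>}")
  case True
  then show ?thesis using subgroup.one_closed[OF subgroup_B] by (intro bexI[of _ "\<one>\<^bsub>P\<^esub>"]) auto
next
  case False
  interpret H: subgroup H P by (fact H)
  obtain h1 where h1: "h1 \<in> H" "h1 \<noteq> \<one>\<^bsub>P\<^esub>" "h1 \<in> carrier P" using False by auto
  obtain g where g: "g \<in> carrier P" "conjugate g h1 \<in> \<beta> ` carrier B"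
    using translates_or_conjugate_into_B[OF h1(3)] nt h1 by blast
  have "conjugate g h2 \<in> \<beta> ` carrier B" if h2: "h2 \<in> H" for h2
  proof (rule ccontr)
    assume n: "conjugate g h2 \<notin> \<beta> ` carrier B"
    have h2P: "h2 \<in> carrier P" using h2 by (rule H.mem_carrier)
    obtain b where b: "b \<in> carrier B" "conjugate g h1 = \<beta> b" using g by blast
    then have "b \<noteq> \<one>\<^bsub>B\<^esub>" using conjugate_eq_one_iff[OF g(1) h1(3)] h1 by auto
    then have "translates (conjugate g h2) \<or> translates (conjugate g (h2 \<otimes>\<^bsub>P\<^esub> h1))"
      using translates_mult_B[OF b(1) _ _ n] g h1 h2P b by (simp add: conjugate_mult)
    then have "translates h2 \<or> translates (h2 \<otimes>\<^bsub>P\<^esub> h1)"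
      using translates_conjugate[OF g(1)] h1 h2P by blast
    moreover have "h2 \<noteq> \<one>\<^bsub>P\<^esub>"
      using n g subgroup.one_closed[OF subgroup_B] conjugate_one(2)[OF g(1)] by metis
    moreover have "h2 \<otimes>\<^bsub>P\<^esub> h1 \<noteq> \<one>\<^bsub>P\<^esub>"
    proof
      assume "h2 \<otimes>\<^bsub>P\<^esub> h1 = \<one>\<^bsub>P\<^esub>"
      then have "h2 = inv\<^bsub>P\<^esub> h1" using h1 h2P by (simp add: P.inv_equality)
      then have "conjugate g h2 = inv\<^bsub>P\<^esub> (conjugate g h1)" using g h1 by (simp add: conjugate_inv)
      then show False using n g subgroup.m_inv_closed[OF subgroup_B] by metis
    qed
    ultimately show False using nt h1 h2 by blast
  qed
  then show ?thesis using g by blast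
qed

lemma image_conjugate_into_B:
  assumes ind: "freely_indecomposable B" and nZ: "\<not> B \<cong> integer_group"
    and f: "f \<in> hom B P" "inj_on f (carrier B)"
  shows "\<exists>g\<in>carrier P. conjugate g ` f ` carrier B \<subseteq> \<beta> ` carrier B"
proof (rule conjugate_into_B)
  interpret f: group_hom B P f using f by unfold_locales
  show "subgroup (f ` carrier B) P" by (rule f.img_is_subgroup)
  show "\<not> translates h" if h: "h \<in> f ` carrier B" "h \<noteq> \<one>\<^bsub>P\<^esub>" for h
  proof
    assume "translates h"
    then obtain g h' where g: "g \<in> carrier P" "h' \<in> {h, inv\<^bsub>P\<^esub> h}"
      "\<And>x. x \<in> carrier P \<Longrightarrow> pos x \<Longrightarrow> pos (conjugate g h' \<otimes>\<^bsub>P\<^esub> x)"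
      by (auto simp: translates_def)
    obtain b where b: "b \<in> carrier B" "h' = f b"
      using h g by (metis B.inv_closed f.hom_inv imageE insertE singletonD)
    define f' where "f' = conjugate g \<circ> f"
    have f': "f' \<in> hom B P" "inj_on f' (carrier B)"
      unfolding f'_def using f conjugate_hom[OF g(1)]
      by (auto intro!: hom_compose comp_inj_on inj_on_subset[OF inj_conjugate[OF g(1)]])
    interpret f': group_hom B P f' using f' by unfold_locales
    interpret S: subgroup_of_free_product_Z B "f' ` carrier B"
      by (intro subgroup_of_free_product_Z.intro subgroup_of_free_product_Z_axioms.intro
          free_product_Z_axioms f'.img_is_subgroup)
    have "f' \<in> iso B (P\<lparr>carrier := f' ` carrier B\<rparr>)"
      using f' by (auto simp: iso_def hom_def bij_betw_def)
    moreover have "conjugate g h' \<noteq> \<one>\<^bsub>P\<^esub>" using g h b by auto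
    moreover have "conjugate g h' \<in> f' ` carrier B" using b by (simp add: f'_def)
    ultimately have "B \<cong> integer_group"
      using g(3) by (intro S.iso_integer_group_if_translation[OF B.is_group ind]) (auto intro: is_isoI)
    then show False using nZ by blast
  qed
qed

text \<open>Edge stabilisers are trivial, so nothing but the identity fixes two vertices. In words:
  with the leading letter of \<open>m\<close> absorbed into \<open>b\<close>, the nontrivial letter
  in the middle prevents all cancellation, and the conjugate is twice as long as
  \<open>m\<close>.\<close>

lemma malnormal_B:
  assumes m: "m \<in> carrier P" and b: "b \<in> carrier B" "b \<noteq> \<one>\<^bsub>B\<^esub>" and c: "conjugate m (\<beta> b) \<in> \<beta> ` carrier B"
  shows "m \<in> \<beta> ` carrier B"
proof (rule ccontr)
  assume n: "m \<notin> \<beta> ` carrier B"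
  define b' where "b' = inv\<^bsub>B\<^esub> (lead m) \<otimes>\<^bsub>B\<^esub> b \<otimes>\<^bsub>B\<^esub> lead m"
  have b': "b' \<in> carrier B" "conjugate (\<beta> (lead m)) (\<beta> b) = \<beta> b'"
    using b m by (simp_all add: b'_def conjugate_\<beta>)
  have "b' \<noteq> \<one>\<^bsub>B\<^esub>"
    using conjugate_eq_one_iff[of "\<beta> (lead m)" "\<beta> b"] b b' m by auto
  have s: "strip m \<in> carrier P" by (rule strip_closed[OF m])
  have "conjugate m (\<beta> b) = conjugate (strip m) (\<beta> b')"
    using conjugate_conjugate[of "\<beta> (lead m)" "strip m" "\<beta> b"] b b' m s \<beta>_strip[OF m] by simp
  also have "\<dots> = inv\<^bsub>P\<^esub> (strip m) \<otimes>\<^bsub>P\<^esub> (\<beta> b' \<otimes>\<^bsub>P\<^esub> strip m)"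
    using s b' by (simp add: conjugate_def P.m_assoc)
  finally have "signs (conjugate m (\<beta> b)) = signs (inv\<^bsub>P\<^esub> (strip m)) @ signs (\<beta> b' \<otimes>\<^bsub>P\<^esub> strip m)"
    using no_cancellation(1)[of "inv\<^bsub>P\<^esub> (strip m)" "\<beta> b' \<otimes>\<^bsub>P\<^esub> strip m"] s b' \<open>b' \<noteq> \<one>\<^bsub>B\<^esub>\<close> lead_strip[OF m]
    by simp
  moreover have "signs m \<noteq> []" using n m signs_Nil_iff by blast
  ultimately show False
    using c s b' signs_strip[OF m] by auto
qed

text \<open>The automorphism and its inverse both take \<open>B\<close> into a conjugate of
  \<open>B\<close>. Their composite is conjugation by some \<open>m\<close> that takes
  \<open>B\<close> into itself, so \<open>m\<close> lies in \<open>B\<close> by malnormality, the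
  composite is onto \<open>B\<close>, and the first inclusion is an equality.\<close>

lemma iso_preserves_B:
  assumes ind: "freely_indecomposable B" and nZ: "\<not> B \<cong> integer_group" and \<phi>: "\<phi> \<in> iso P P"
  shows "\<exists>g\<in>carrier P. (conjugate g \<circ> \<phi>) ` \<beta> ` carrier B = \<beta> ` carrier B"
proof -
  have into: "\<exists>g\<in>carrier P. conjugate g ` f ` \<beta> ` carrier B \<subseteq> \<beta> ` carrier B" if f: "f \<in> iso P P" for f
  proof -
    have "f \<circ> \<beta> \<in> hom B P" "inj_on (f \<circ> \<beta>) (carrier B)"
      using f \<beta>.homh
      by (auto simp: iso_def bij_betw_def intro!: hom_compose comp_inj_on inj_fp_inr elim!: inj_on_subset)
    from image_conjugate_into_B[OF ind nZ this] show ?thesis by (simp add: image_comp)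
  qed
  interpret \<phi>: group_hom P P \<phi> using \<phi> by unfold_locales (auto simp: iso_def)
  define \<chi> where "\<chi> = inv_into (carrier P) \<phi>"
  have \<chi>: "\<chi> \<in> iso P P" unfolding \<chi>_def by (rule P.iso_set_sym[OF \<phi>])
  have \<chi>\<phi>: "\<phi> (\<chi> x) = x" if "x \<in> carrier P" for x
    using \<phi> that by (auto simp: iso_def bij_betw_def \<chi>_def f_inv_into_f)
  have \<chi>P: "\<chi> x \<in> carrier P" if "x \<in> carrier P" for x
    using \<chi> that by (auto simp: iso_def hom_def)
  obtain g where g: "g \<in> carrier P" "conjugate g ` \<phi> ` \<beta> ` carrier B \<subseteq> \<beta> ` carrier B" using into[OF \<phi>] by blast
  obtain h where h: "h \<in> carrier P" "conjugate h ` \<chi> ` \<beta> ` carrier B \<subseteq> \<beta> ` carrier B" using into[OF \<chi>] by blast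
  define m where "m = \<phi> h \<otimes>\<^bsub>P\<^esub> g"
  have m: "m \<in> carrier P" using g h by (simp add: m_def)
  have key: "conjugate m (\<beta> b) \<in> conjugate g ` \<phi> ` \<beta> ` carrier B" if b: "b \<in> carrier B" for b
  proof -
    have "conjugate h (\<chi> (\<beta> b)) \<in> \<beta> ` carrier B" using h b by blast
    then have "conjugate g (\<phi> (conjugate h (\<chi> (\<beta> b)))) \<in> conjugate g ` \<phi> ` \<beta> ` carrier B" by blast
    moreover have "\<phi> (conjugate h (\<chi> (\<beta> b))) = conjugate (\<phi> h) (\<beta> b)"
      using h b \<chi>P[of "\<beta> b"] \<chi>\<phi>[of "\<beta> b"] by (simp add: conjugate_def)
    ultimately show ?thesis using g h b by (simp add: conjugate_conjugate m_def)
  qed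
  obtain b0 where b0: "b0 \<in> carrier B" "b0 \<noteq> \<one>\<^bsub>B\<^esub>"
    using ind by (auto simp: freely_indecomposable_def)
  obtain c where c: "c \<in> carrier B" "m = \<beta> c"
    using malnormal_B[OF m b0] key[OF b0(1)] g by blast
  have "\<beta> b \<in> conjugate g ` \<phi> ` \<beta> ` carrier B" if b: "b \<in> carrier B" for b
  proof -
    have "conjugate m (conjugate (inv\<^bsub>P\<^esub> m) (\<beta> b)) = \<beta> b" using m b by simp
    moreover have "conjugate (inv\<^bsub>P\<^esub> m) (\<beta> b) = \<beta> (c \<otimes>\<^bsub>B\<^esub> b \<otimes>\<^bsub>B\<^esub> inv\<^bsub>B\<^esub> c)"
      using c b conjugate_\<beta>[of "inv\<^bsub>B\<^esub> c" b] by (simp flip: \<beta>.hom_inv)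
    ultimately show ?thesis using key[of "c \<otimes>\<^bsub>B\<^esub> b \<otimes>\<^bsub>B\<^esub> inv\<^bsub>B\<^esub> c"] b c(1) by (metis B.inv_closed B.m_closed)
  qed
  then have "conjugate g ` \<phi> ` \<beta> ` carrier B = \<beta> ` carrier B" using g by blast
  then show ?thesis using g by (intro bexI[of _ g]) (simp_all only: image_comp[symmetric])
qed

end

section \<open>Sign sequences under automorphisms\<close>

context free_product_Z
begin

lemma conjugate_pow: "k \<in> carrier P \<Longrightarrow> x \<in> carrier P \<Longrightarrow> conjugate k x [^]\<^bsub>P\<^esub> (n::nat) = conjugate k (x [^]\<^bsub>P\<^esub> n)"
  by (induction n) (simp_all add: conjugate_mult)

lemma start_sign_cong:
  assumes "x \<in> carrier P" "y \<in> carrier P" "lead x = lead y" "signs x \<noteq> []" "signs y \<noteq> []"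
    "hd (signs x) = hd (signs y)"
  shows "start_sign x = start_sign y"
  using assms by (simp add: start_sign_eq)

text \<open>A power of \<open>v\<close> starts like \<open>v\<close>: this is clear when \<open>v\<close> and its inverse start differently,
  and otherwise \<open>v\<close> is a conjugate of a shorter element.\<close>

lemma power_start:
  assumes "v \<in> carrier P" "signs v \<noteq> []" "v [^]\<^bsub>P\<^esub> Suc n \<noteq> \<one>\<^bsub>P\<^esub>"
  shows "lead (v [^]\<^bsub>P\<^esub> Suc n) = lead v \<and> signs (v [^]\<^bsub>P\<^esub> Suc n) \<noteq> [] \<and>
         hd (signs (v [^]\<^bsub>P\<^esub> Suc n)) = hd (signs v) \<and>
         length (signs v) \<le> length (signs (v [^]\<^bsub>P\<^esub> Suc n))"
  using assms
proof (induction "length (signs v)" arbitrary: v rule: less_induct)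
  case (less v)
  have v: "v \<in> carrier P" "signs v \<noteq> []" and ne: "v [^]\<^bsub>P\<^esub> Suc n \<noteq> \<one>\<^bsub>P\<^esub>" by fact+
  show ?case
  proof (cases "lead (inv\<^bsub>P\<^esub> v) = lead v \<and> hd (signs (inv\<^bsub>P\<^esub> v)) = hd (signs v)")
    case False
    have "lead (v [^]\<^bsub>P\<^esub> Suc m) = lead v \<and> signs (v [^]\<^bsub>P\<^esub> Suc m) \<noteq> [] \<and>
         hd (signs (v [^]\<^bsub>P\<^esub> Suc m)) = hd (signs v) \<and>
         length (signs v) \<le> length (signs (v [^]\<^bsub>P\<^esub> Suc m))" for m
    proof (induction m)
      case 0
      then show ?case using v by simp
    next
      case (Suc m)
      have eq: "v [^]\<^bsub>P\<^esub> Suc (Suc m) = v \<otimes>\<^bsub>P\<^esub> v [^]\<^bsub>P\<^esub> Suc m"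
        by (rule P.nat_pow_Suc2[OF v(1)])
      have d: "lead (inv\<^bsub>P\<^esub> v) \<noteq> lead (v [^]\<^bsub>P\<^esub> Suc m) \<or> signs v = [] \<or> signs (v [^]\<^bsub>P\<^esub> Suc m) = [] \<or>
                hd (signs (inv\<^bsub>P\<^esub> v)) \<noteq> hd (signs (v [^]\<^bsub>P\<^esub> Suc m))"
        using Suc.IH False by argo
      have c: "v [^]\<^bsub>P\<^esub> Suc m \<in> carrier P" using v(1) by blast
      show ?case
        using no_cancellation[OF v(1) c d] v(2) unfolding eq by simp
    qed
    then show ?thesis .
  next
    case True
    define b s where "b = \<beta> (lead v)" and "s = hd (signs v)"
    have b: "b \<in> carrier P" and s: "\<bar>s\<bar> = 1"
      using v abs_hd_signs by (simp_all add: b_def s_def)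
    define y where "y = conjugate b v"
    have y: "y \<in> carrier P" "start_sign y = s" "signs y = signs v"
      using start_sign_conjugate_lead[OF v] b v by (simp_all add: y_def b_def s_def)
    have "signs (inv\<^bsub>P\<^esub> v) \<noteq> []" using v by (simp add: signs_inv)
    then have y': "start_sign (inv\<^bsub>P\<^esub> y) = s"
      using start_sign_conjugate_lead(1)[of "inv\<^bsub>P\<^esub> v"] v b True by (simp add: y_def conjugate_inv s_def b_def)
    define z where "z = conjugate (T s) y"
    have z: "z \<in> carrier P" using y by (simp add: z_def)
    note peel = peel[OF y(1,2) y' s, folded z_def]
    \<comment> \<open>A power of a conjugate is the conjugate of the power; what remains is that the
      power of \<open>z\<close> can be put back between the same two letters.\<close>
    have y_pow: "y [^]\<^bsub>P\<^esub> Suc n = conjugate (T (- s)) (z [^]\<^bsub>P\<^esub> Suc n)"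
    proof -
      have "conjugate (T (- s)) z = y" using y by (simp add: z_def flip: inv_T)
      then show ?thesis using conjugate_pow[of "T (- s)" z "Suc n"] z by simp
    qed
    have y_pow': "y [^]\<^bsub>P\<^esub> Suc n = conjugate b (v [^]\<^bsub>P\<^esub> Suc n)"
      unfolding y_def using conjugate_pow b v by blast
    have z_ne: "z [^]\<^bsub>P\<^esub> Suc n \<noteq> \<one>\<^bsub>P\<^esub>"
    proof
      assume "z [^]\<^bsub>P\<^esub> Suc n = \<one>\<^bsub>P\<^esub>"
      then have "conjugate b (v [^]\<^bsub>P\<^esub> Suc n) = \<one>\<^bsub>P\<^esub>" using y_pow y_pow' conjugate_one(2)[OF T_closed] by metis
      then show False using ne b v by (metis conjugate_eq_one_iff P.nat_pow_closed)
    qed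
    have zn: "z [^]\<^bsub>P\<^esub> Suc n \<in> carrier P" using z by blast
    have inv_zn: "inv\<^bsub>P\<^esub> (z [^]\<^bsub>P\<^esub> Suc n) = inv\<^bsub>P\<^esub> z [^]\<^bsub>P\<^esub> Suc n"
      by (rule P.nat_pow_inv[OF z, symmetric])
    have "start_sign (z [^]\<^bsub>P\<^esub> Suc n) \<noteq> - s \<and> start_sign (inv\<^bsub>P\<^esub> (z [^]\<^bsub>P\<^esub> Suc n)) \<noteq> - s \<and>
          length (signs z) \<le> length (signs (z [^]\<^bsub>P\<^esub> Suc n))"
    \<comment> \<open>If \<open>z\<close> is in \<open>B\<close>, so are its powers. Otherwise the
      induction hypothesis is used for \<open>z\<close> and for its inverse, since
      \<open>unpeel\<close> looks at both ends.\<close>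
    proof (cases "signs z = []")
      case True
      have "z [^]\<^bsub>P\<^esub> Suc n \<in> \<beta> ` carrier B"
        using True z signs_Nil_iff \<beta>.img_is_subgroup
        by (metis P.subgroup_int_pow_closed int_pow_int)
      then have "signs (z [^]\<^bsub>P\<^esub> Suc n) = []"
        using signs_Nil_iff zn by blast
      then show ?thesis
        using True s zn by (simp add: start_sign_eq signs_inv)
    next
      case False
      have lt: "length (signs z) < length (signs v)"
        using peel(1) y(3) by simp
      have 1: "lead (z [^]\<^bsub>P\<^esub> Suc n) = lead z" "signs (z [^]\<^bsub>P\<^esub> Suc n) \<noteq> []"
         "hd (signs (z [^]\<^bsub>P\<^esub> Suc n)) = hd (signs z)" "length (signs z) \<le> length (signs (z [^]\<^bsub>P\<^esub> Suc n))"
        using less.hyps[OF lt z False z_ne] by blast+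
      have inv: "inv\<^bsub>P\<^esub> z \<in> carrier P" "signs (inv\<^bsub>P\<^esub> z) \<noteq> []" "length (signs (inv\<^bsub>P\<^esub> z)) < length (signs v)"
        using z False lt by (simp_all add: signs_inv)
      have "inv\<^bsub>P\<^esub> z [^]\<^bsub>P\<^esub> Suc n \<noteq> \<one>\<^bsub>P\<^esub>"
        using z_ne zn inv_zn by (metis P.inv_eq_1_iff)
      then have 2: "lead (inv\<^bsub>P\<^esub> z [^]\<^bsub>P\<^esub> Suc n) = lead (inv\<^bsub>P\<^esub> z)" "signs (inv\<^bsub>P\<^esub> z [^]\<^bsub>P\<^esub> Suc n) \<noteq> []"
         "hd (signs (inv\<^bsub>P\<^esub> z [^]\<^bsub>P\<^esub> Suc n)) = hd (signs (inv\<^bsub>P\<^esub> z))"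
        using less.hyps[OF inv(3,1,2)] by blast+
      show ?thesis
        using start_sign_cong[OF zn z 1(1,2) False 1(3)] peel(2,3) 1(4)
          start_sign_cong[OF P.nat_pow_closed[OF inv(1)] inv(1) 2(1,2) inv(2) 2(3)] inv_zn by metis
    qed
    then have "signs (y [^]\<^bsub>P\<^esub> Suc n) = s # signs (z [^]\<^bsub>P\<^esub> Suc n) @ [- s]"
      "start_sign (y [^]\<^bsub>P\<^esub> Suc n) = s" "length (signs z) \<le> length (signs (z [^]\<^bsub>P\<^esub> Suc n))"
      using unpeel[OF zn z_ne _ _ s] unfolding y_pow by blast+
    note yn = this
    have ynP: "y [^]\<^bsub>P\<^esub> Suc n \<in> carrier P" using y by blast
    have "lead (y [^]\<^bsub>P\<^esub> Suc n) = \<one>\<^bsub>B\<^esub>"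
      using yn(2) s ynP start_sign_lead by force
    moreover have "v [^]\<^bsub>P\<^esub> Suc n = \<beta> (lead v) \<otimes>\<^bsub>P\<^esub> (y [^]\<^bsub>P\<^esub> Suc n \<otimes>\<^bsub>P\<^esub> \<beta> (inv\<^bsub>B\<^esub> (lead v)))"
    proof -
      have "v [^]\<^bsub>P\<^esub> Suc n = conjugate (inv\<^bsub>P\<^esub> b) (y [^]\<^bsub>P\<^esub> Suc n)"
        unfolding y_pow' using b v by (metis conjugate_cancel(2) P.nat_pow_closed)
      then show ?thesis using b v ynP by (simp add: conjugate_def b_def P.m_assoc)
    qed
    ultimately have "signs (v [^]\<^bsub>P\<^esub> Suc n) = signs (y [^]\<^bsub>P\<^esub> Suc n) \<and> lead (v [^]\<^bsub>P\<^esub> Suc n) = lead v"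
      using signs_mult_\<beta>[OF ynP B.inv_closed[OF lead_closed[OF v(1)]]] yn(1) ynP v(1)
        signs_\<beta>_mult[OF lead_closed[OF v(1)]] lead_\<beta>_mult[OF lead_closed[OF v(1)]]
      by (metis B.inv_closed B.r_one P.m_closed \<beta>.hom_closed lead_closed list.discI)
    moreover have "length (signs v) = Suc (Suc (length (signs z)))"
      using arg_cong[OF peel(1), of length] y(3) by simp
    ultimately show ?thesis using yn by (simp add: s_def)
  qed
qed

lemma int_power_start:
  assumes u: "u \<in> carrier P" "start_sign u \<noteq> 0" "start_sign (inv\<^bsub>P\<^esub> u) \<noteq> 0"
    and tf: "\<And>n::nat. n > 0 \<Longrightarrow> u [^]\<^bsub>P\<^esub> n \<noteq> \<one>\<^bsub>P\<^esub>" and n: "(n::int) \<noteq> 0"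
  shows "start_sign (u [^]\<^bsub>P\<^esub> n) \<noteq> 0 \<and> length (signs u) \<le> length (signs (u [^]\<^bsub>P\<^esub> n))"
proof -
  have ne: "signs u \<noteq> []" "signs (inv\<^bsub>P\<^esub> u) \<noteq> []"
    using u by (auto simp: start_sign_eq split: if_splits)
  have *: "start_sign (v [^]\<^bsub>P\<^esub> Suc m) \<noteq> 0 \<and> length (signs v) \<le> length (signs (v [^]\<^bsub>P\<^esub> Suc m))"
    if "v \<in> carrier P" "signs v \<noteq> []" "start_sign v \<noteq> 0" "v [^]\<^bsub>P\<^esub> Suc m \<noteq> \<one>\<^bsub>P\<^esub>" for v m
    using power_start[OF that(1,2,4)] start_sign_cong[OF P.nat_pow_closed[OF that(1)] that(1)] that by metis
  show ?thesis
  proof (cases "n > 0")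
    case True
    then obtain m where "n = int (Suc m)" by (metis gr0_implies_Suc zero_less_imp_eq_int)
    then show ?thesis using *[OF u(1) ne(1) u(2) tf, of m] by (metis int_pow_int zero_less_Suc)
  next
    case False
    then obtain m where m: "n = - int (Suc m)"
      using n by (metis linorder_neqE_linordered_idom negD)
    have "inv\<^bsub>P\<^esub> u [^]\<^bsub>P\<^esub> Suc m \<noteq> \<one>\<^bsub>P\<^esub>"
      using tf[of "Suc m"] u by (metis P.nat_pow_inv P.inv_eq_1_iff P.nat_pow_closed zero_less_Suc)
    moreover have "u [^]\<^bsub>P\<^esub> n = inv\<^bsub>P\<^esub> u [^]\<^bsub>P\<^esub> Suc m"
      using u unfolding m P.int_pow_neg_int[OF u(1)] by (metis P.nat_pow_inv)
    moreover have "length (signs (inv\<^bsub>P\<^esub> u)) = length (signs u)"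
      using signs_inv[OF u(1)] by simp
    ultimately show ?thesis using *[of "inv\<^bsub>P\<^esub> u" m] u ne by (metis P.inv_closed)
  qed
qed

text \<open>In the image of a reduced word, powers of \<open>u\<close> alternate with nontrivial
  letters of \<open>B\<close>. As these powers have integers at both ends, nothing cancels and their
  sign sequences, none shorter than that of \<open>u\<close>, are concatenated. The claim on
  \<open>lead\<close> carries the induction.\<close>

lemma generator_length:
  assumes u: "u \<in> carrier P" "start_sign u \<noteq> 0" "start_sign (inv\<^bsub>P\<^esub> u) \<noteq> 0"
    and tf: "\<And>n::nat. n > 0 \<Longrightarrow> u [^]\<^bsub>P\<^esub> n \<noteq> \<one>\<^bsub>P\<^esub>"
    and w: "w \<in> carrier P"
  defines "\<chi> \<equiv> fp_lift P (\<lambda>n::int. u [^]\<^bsub>P\<^esub> n) \<beta>"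
  shows "lead (\<chi> w) = lead w \<and> (signs (\<chi> w) = [] \<or> length (signs u) \<le> length (signs (\<chi> w)))"
proof -
  have hom: "(\<lambda>n::int. u [^]\<^bsub>P\<^esub> n) \<in> hom integer_group P"
    using u by (auto simp: hom_def P.int_pow_mult)
  have \<chi>_closed: "\<chi> v \<in> carrier P" if "v \<in> carrier P" for v
    unfolding \<chi>_def
    using that reduced_word_subset[OF group_integer_group B.is_group]
    by (intro fp_lift_closed[OF group_integer_group B.is_group P.is_group hom \<beta>.homh])
       (simp add: carrier_free_product)
  show ?thesis
    using w
  proof (induction w)
    case Nil
    then show ?case by (simp add: \<chi>_def)
  next
    case (Cons x w)
    show ?case
    proof (cases x)
      case (Inl n)
      then have w: "n \<noteq> 0" "w \<in> carrier P" "start_sign w = 0"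
        using Cons.prems by (simp_all add: carrier_P_Cons)
      note IH = Cons.IH[OF w(2)]
      have \<chi>: "\<chi> (x # w) = u [^]\<^bsub>P\<^esub> n \<otimes>\<^bsub>P\<^esub> \<chi> w" by (simp add: \<chi>_def Inl)
      have un: "u [^]\<^bsub>P\<^esub> n \<in> carrier P" "start_sign (u [^]\<^bsub>P\<^esub> n) \<noteq> 0"
        "length (signs u) \<le> length (signs (u [^]\<^bsub>P\<^esub> n))"
        using int_power_start[OF u tf w(1)] u(1) by auto
      have "start_sign (inv\<^bsub>P\<^esub> (u [^]\<^bsub>P\<^esub> n)) \<noteq> 0"
        using int_power_start[OF u tf, of "- n"] w(1) u(1) by (simp add: P.int_pow_neg)
      then have li: "lead (inv\<^bsub>P\<^esub> (u [^]\<^bsub>P\<^esub> n)) = \<one>\<^bsub>B\<^esub>"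
        using un by (intro start_sign_lead) auto
      have "w = [] \<or> lead w \<noteq> \<one>\<^bsub>B\<^esub>"
        using w by (cases w rule: P_cases) (auto simp: carrier_P_Cons sgn_if split: if_splits)
      moreover have "w = [] \<Longrightarrow> signs (\<chi> w) = []" by (simp add: \<chi>_def)
      ultimately have "lead (inv\<^bsub>P\<^esub> (u [^]\<^bsub>P\<^esub> n)) \<noteq> lead (\<chi> w) \<or> signs (u [^]\<^bsub>P\<^esub> n) = [] \<or>
          signs (\<chi> w) = [] \<or> hd (signs (inv\<^bsub>P\<^esub> (u [^]\<^bsub>P\<^esub> n))) \<noteq> hd (signs (\<chi> w))"
        using li IH by metis
      note no_cancellation[OF un(1) \<chi>_closed[OF w(2)] this, folded \<chi>]
      moreover have "lead (u [^]\<^bsub>P\<^esub> n) = \<one>\<^bsub>B\<^esub>" "signs (u [^]\<^bsub>P\<^esub> n) \<noteq> []"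
        using start_sign_lead[OF un(1,2)] start_sign_eq[OF un(1)] un(2) by (auto split: if_splits)
      ultimately show ?thesis using un(3) by (simp add: Inl)
    next
      case (Inr b)
      then have w: "b \<in> carrier B" "w \<in> carrier P" "lead w = \<one>\<^bsub>B\<^esub>"
        using Cons.prems by (simp_all add: carrier_P_Cons)
      have "\<chi> (x # w) = \<beta> b \<otimes>\<^bsub>P\<^esub> \<chi> w" by (simp add: \<chi>_def Inr)
      then show ?thesis using Cons.IH[OF w(2)] w \<chi>_closed[OF w(2)] by (simp add: Inr)
    qed
  qed
qed

text \<open>The homomorphism to the integers that kills \<open>B\<close> and sends \<open>t\<close>
  to 1; it serves to recognise elements of infinite order.\<close>

definition deg :: "(int + 'b) list \<Rightarrow> int" where "deg x = sum_list (signs x)"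

lemma deg_mult: "g \<in> carrier P \<Longrightarrow> h \<in> carrier P \<Longrightarrow> deg (g \<otimes>\<^bsub>P\<^esub> h) = deg g + deg h"
proof -
  assume "g \<in> carrier P" "h \<in> carrier P"
  then obtain p c q where "signs g = p @ c" "signs h = inv_signs c @ q" "signs (g \<otimes>\<^bsub>P\<^esub> h) = p @ q"
    using cancellation by blast
  moreover have "sum_list (inv_signs c) = - sum_list c" for c
    by (induction c) simp_all
  ultimately show ?thesis by (simp add: deg_def)
qed

lemma deg_pow: "g \<in> carrier P \<Longrightarrow> deg (g [^]\<^bsub>P\<^esub> (n::nat)) = int n * deg g"
  by (induction n) (simp_all add: deg_mult algebra_simps, simp add: deg_def)

lemma deg_one: "deg \<one>\<^bsub>P\<^esub> = 0"
  by (simp add: deg_def)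

text \<open>Strip the image of \<open>t\<close> of elements of \<open>B\<close> on both sides to get
  \<open>u\<close>. By surjectivity \<open>B\<close> and \<open>u\<close> generate the group, and
  \<open>generator_length\<close> for a word representing \<open>T 1\<close> bounds the length of
  \<open>u\<close> by 1.\<close>

lemma iso_T_normal_form:
  assumes \<psi>: "\<psi> \<in> iso P P" and \<psi>B: "\<psi> ` \<beta> ` carrier B = \<beta> ` carrier B"
  shows "\<exists>c d s. c \<in> carrier B \<and> d \<in> carrier B \<and> \<bar>s\<bar> = 1 \<and> \<psi> (T 1) = \<beta> c \<otimes>\<^bsub>P\<^esub> T s \<otimes>\<^bsub>P\<^esub> \<beta> d"
proof -
  interpret \<psi>: group_hom P P \<psi> using \<psi> by unfold_locales (auto simp: iso_def)
  have inj: "inj_on \<psi> (carrier P)" and surj: "\<psi> ` carrier P = carrier P"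
    using \<psi> by (auto simp: iso_def bij_betw_def)
  define w where "w = \<psi> (T 1)"
  have w: "w \<in> carrier P" by (simp add: w_def)
  have "signs w \<noteq> []"
  proof
    assume "signs w = []"
    then have "w \<in> \<psi> ` \<beta> ` carrier B" using signs_Nil_iff[OF w] \<psi>B by blast
    then obtain b where "b \<in> carrier B" "\<psi> (T 1) = \<psi> (\<beta> b)" by (auto simp: w_def)
    then have "T 1 = \<beta> b" using inj by (auto dest: inj_onD)
    then show False using signs_\<beta>[of b] signs_T[of 1] by simp
  qed
  define c where "c = lead w"
  define w1 where "w1 = strip w"
  have c: "c \<in> carrier B" "w = \<beta> c \<otimes>\<^bsub>P\<^esub> w1" "w1 \<in> carrier P" "start_sign w1 \<noteq> 0"
    using w \<open>signs w \<noteq> []\<close> start_strip[OF w] abs_hd_signs[OF w] \<beta>_strip[OF w] strip_closed[OF w]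
    by (auto simp: c_def w1_def)
  define d where "d = lead (inv\<^bsub>P\<^esub> w1)"
  define u where "u = w1 \<otimes>\<^bsub>P\<^esub> \<beta> d"
  have d: "d \<in> carrier B" using c by (simp add: d_def)
  have u: "u \<in> carrier P" "start_sign u \<noteq> 0" using c d by (simp_all add: u_def signs_mult_\<beta>)
  have "inv\<^bsub>P\<^esub> u = strip (inv\<^bsub>P\<^esub> w1)"
    using c d by (simp add: u_def strip_def P.inv_mult_group d_def)
  moreover have "signs (inv\<^bsub>P\<^esub> w1) \<noteq> []"
    using c(3,4) by (auto simp: signs_inv start_sign_eq split: if_splits)
  ultimately have u': "start_sign (inv\<^bsub>P\<^esub> u) \<noteq> 0"
    using start_strip[of "inv\<^bsub>P\<^esub> w1"] abs_hd_signs[of "inv\<^bsub>P\<^esub> w1"] c by auto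
  have wu: "w = \<beta> c \<otimes>\<^bsub>P\<^esub> u \<otimes>\<^bsub>P\<^esub> \<beta> (inv\<^bsub>B\<^esub> d)"
  proof -
    have "u \<otimes>\<^bsub>P\<^esub> \<beta> (inv\<^bsub>B\<^esub> d) = w1" using c d by (simp add: u_def P.m_assoc)
    then show ?thesis using c u d by (simp add: P.m_assoc)
  qed
  \<comment> \<open>The stripped elements are images of elements of \<open>B\<close>, so
    \<open>u\<close> is the image of some \<open>v\<close> of degree 1; injectivity transfers
    infinite order from \<open>v\<close> to \<open>u\<close>.\<close>
  have tf: "u [^]\<^bsub>P\<^esub> n \<noteq> \<one>\<^bsub>P\<^esub>" if "n > 0" for n :: nat
  proof
    assume eq: "u [^]\<^bsub>P\<^esub> n = \<one>\<^bsub>P\<^esub>"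
    obtain x y where xy: "x \<in> carrier B" "y \<in> carrier B" "\<psi> (\<beta> x) = \<beta> (inv\<^bsub>B\<^esub> c)" "\<psi> (\<beta> y) = \<beta> d"
    proof -
      have "\<beta> (inv\<^bsub>B\<^esub> c) \<in> \<psi> ` \<beta> ` carrier B" "\<beta> d \<in> \<psi> ` \<beta> ` carrier B"
        unfolding \<psi>B using c d by blast+
      then show thesis by (auto intro: that[OF _ _ sym sym])
    qed
    define v where "v = \<beta> x \<otimes>\<^bsub>P\<^esub> T 1 \<otimes>\<^bsub>P\<^esub> \<beta> y"
    have v: "v \<in> carrier P" "deg v = 1"
      using xy by (simp_all add: v_def deg_mult) (simp add: deg_def)
    have "u = \<beta> (inv\<^bsub>B\<^esub> c) \<otimes>\<^bsub>P\<^esub> w \<otimes>\<^bsub>P\<^esub> \<beta> d"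
    proof -
      have "\<beta> (inv\<^bsub>B\<^esub> c) \<otimes>\<^bsub>P\<^esub> w = w1" using c by (simp add: P.m_assoc[symmetric])
      then show ?thesis by (simp add: u_def)
    qed
    then have "\<psi> v = u"
      unfolding v_def using xy by (simp add: w_def)
    then have "\<psi> (v [^]\<^bsub>P\<^esub> n) = \<psi> \<one>\<^bsub>P\<^esub>" using v eq \<psi>.hom_nat_pow[OF v(1)] by simp
    then have "v [^]\<^bsub>P\<^esub> n = \<one>\<^bsub>P\<^esub>" using inj v by (metis P.nat_pow_closed P.one_closed inj_onD)
    then show False using deg_pow[OF v(1), of n] deg_one v(2) that by simp
  qed
  define \<chi> where "\<chi> = fp_lift P (\<lambda>n::int. u [^]\<^bsub>P\<^esub> n) \<beta>"
  have hom: "(\<lambda>n::int. u [^]\<^bsub>P\<^esub> n) \<in> hom integer_group P"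
    using u by (auto simp: hom_def P.int_pow_mult)
  interpret \<chi>: group_hom P P \<chi>
    unfolding \<chi>_def using fp_lift_hom[OF group_integer_group B.is_group P.is_group hom \<beta>.homh] by unfold_locales
  have img: "subgroup (\<chi> ` carrier P) P" by (rule \<chi>.img_is_subgroup)
  have \<chi>\<beta>: "\<chi> (\<beta> b) = \<beta> b" if "b \<in> carrier B" for b
  proof (cases "b = \<one>\<^bsub>B\<^esub>")
    case False
    then have "\<beta> b = [Inr b]" by (simp add: fp_inr_def)
    moreover have "\<chi> [Inr b] = \<beta> b" using that by (simp add: \<chi>_def)
    ultimately show ?thesis by metis
  qed simp
  have \<chi>T: "\<chi> (T 1) = u"
    using u(1) by (simp add: \<chi>_def fp_inl_def)
  have \<beta>_img: "\<beta> b \<in> \<chi> ` carrier P" if "b \<in> carrier B" for b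
    using \<chi>\<beta>[OF that] that by (metis \<beta>.hom_closed imageI)
  have u_img: "u \<in> \<chi> ` carrier P" using \<chi>T by (metis T_closed imageI)
  have w_img: "w \<in> \<chi> ` carrier P"
    unfolding wu
    by (intro subgroup.m_closed[OF img] \<beta>_img[OF c(1)] u_img \<beta>_img[OF B.inv_closed[OF d]])
  have "\<psi> x \<in> \<chi> ` carrier P" if "x \<in> carrier P" for x
    using that
  proof (induction x rule: P_induct)
    case one
    then show ?case using subgroup.one_closed[OF img] by simp
  next
    case (\<beta> b x)
    obtain d' where "d' \<in> carrier B" "\<psi> (\<beta> b) = \<beta> d'" using \<beta>.hyps(1) \<psi>B by blast
    then have "\<psi> (\<beta> b) \<in> \<chi> ` carrier P" using \<beta>_img by simp
    from subgroup.m_closed[OF img this \<beta>.IH]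
    show ?case using \<psi>.hom_mult[OF \<beta>.hom_closed[OF \<beta>.hyps(1)] \<beta>.hyps(3)] by (simp only:)
  next
    case (T s x)
    have "\<psi> (T s) \<in> \<chi> ` carrier P"
    proof (cases "s = 1")
      case True
      then show ?thesis using w_img by (simp add: w_def)
    next
      case False
      then have "s = - 1" using T.hyps by linarith
      then have "\<psi> (T s) = inv\<^bsub>P\<^esub> w" using \<psi>.hom_inv[of "T 1"] by (simp add: w_def inv_T)
      then show ?thesis using w_img subgroup.m_inv_closed[OF img] by simp
    qed
    from subgroup.m_closed[OF img this T.IH]
    show ?case using \<psi>.hom_mult[OF T_closed T.hyps(2)] by (simp only:)
  qed
  note \<psi>_img = this
  have "T 1 \<in> \<psi> ` carrier P" unfolding surj by (rule T_closed)
  then have "T 1 \<in> \<chi> ` carrier P" using \<psi>_img by (metis imageE)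
  then obtain z where z: "z \<in> carrier P" "\<chi> z = T 1" by (metis imageE)
  have "length (signs u) \<le> 1"
    using generator_length[OF u u' tf z(1), folded \<chi>_def] unfolding z(2) by simp
  define s where "s = start_sign u"
  have s: "\<bar>s\<bar> = 1" unfolding s_def by (rule start_sign_abs[OF u])
  define x where "x = T (- s) \<otimes>\<^bsub>P\<^esub> u"
  have x: "x \<in> carrier P" "u = T s \<otimes>\<^bsub>P\<^esub> x"
    unfolding x_def using u(1) T_cancel(2)[OF u(1)] by simp_all
  have "\<bar>- s\<bar> = 1" "start_sign u = - (- s)" using s by (simp_all add: s_def)
  from signs_T_mult_unreduced[OF this(1) u(1) this(2), folded x_def]
  have "signs u = s # signs x" by simp
  then have "signs x = []" using \<open>length (signs u) \<le> 1\<close> by simp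
  then obtain e where e: "e \<in> carrier B" "x = \<beta> e"
    using signs_Nil_iff[OF x(1)] by (metis imageE)
  have "\<psi> (T 1) = \<beta> c \<otimes>\<^bsub>P\<^esub> T s \<otimes>\<^bsub>P\<^esub> \<beta> (e \<otimes>\<^bsub>B\<^esub> inv\<^bsub>B\<^esub> d)"
    unfolding w_def[symmetric] wu using c(1) d e x(2) by (simp add: P.m_assoc)
  then show ?thesis
    using c(1) B.m_closed[OF e(1) B.inv_closed[OF d]] s
    by (intro exI[of _ c] exI[of _ "e \<otimes>\<^bsub>B\<^esub> inv\<^bsub>B\<^esub> d"] exI[of _ s] conjI)
qed

text \<open>The map sends \<open>t\<close> to \<open>c\<close> followed by \<open>T s\<close>, and
  the inverse of \<open>t\<close> to \<open>T (- s)\<close> followed by the inverse of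
  \<open>c\<close>. To exclude cancellation, a new \<open>t\<close> needs a condition on the start
  of \<open>\<psi> w\<close>, and a new inverse of \<open>t\<close> one on the start of
  \<open>\<psi> w\<close> multiplied by the inverse of \<open>c\<close>. The induction carries both,
  sharpened according to the first letter of \<open>w\<close>.\<close>

lemma signs_normal_automorphism:
  assumes \<psi>: "\<psi> \<in> hom P P" and \<psi>B: "\<And>b. b \<in> carrier B \<Longrightarrow> \<psi> (\<beta> b) \<in> \<beta> ` carrier B"
    and inj: "inj_on \<psi> (carrier P)"
    and c: "c \<in> carrier B" "\<bar>s\<bar> = 1" "\<psi> (T 1) = \<beta> c \<otimes>\<^bsub>P\<^esub> T s"
    and w: "w \<in> carrier P"
  shows "signs (\<psi> w) = map ((*) s) (signs w)"
proof -
  interpret \<psi>: group_hom P P \<psi> using \<psi> by unfold_locales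
  have s0: "s \<noteq> 0" "s \<noteq> - s" using c by auto
  let ?c = "\<beta> (inv\<^bsub>B\<^esub> c)"
  have cP: "inv\<^bsub>B\<^esub> c \<in> carrier B" "?c \<in> carrier P" using c by simp_all
  have T1: "\<psi> (T (- 1)) = T (- s) \<otimes>\<^bsub>P\<^esub> ?c"
    using \<psi>.hom_inv[of "T 1"] c by (simp add: inv_T P.inv_mult_group)
  have start_hd: "start_sign x \<noteq> - e" if "x \<in> carrier P" "signs x = e # r" "\<bar>e\<bar> = 1" for x e r
    using that by (auto simp: start_sign_eq)
  have "signs (\<psi> w) = map ((*) s) (signs w) \<and>
        (start_sign w = 1 \<longrightarrow> start_sign (?c \<otimes>\<^bsub>P\<^esub> \<psi> w) = s) \<and>
        (start_sign w = - 1 \<longrightarrow> start_sign (\<psi> w) = - s) \<and>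
        (start_sign w = 0 \<longrightarrow> start_sign (\<psi> w) \<noteq> - s \<and> start_sign (?c \<otimes>\<^bsub>P\<^esub> \<psi> w) \<noteq> s)"
    using w
  proof (induction w rule: P_induct)
    case one
    then show ?case using s0 cP(2) start_sign_\<beta>[of "inv\<^bsub>B\<^esub> c"] by (simp del: \<beta>.hom_inv)
  next
    case (\<beta> b w)
    obtain d where d: "d \<in> carrier B" "\<psi> (\<beta> b) = \<beta> d" using \<psi>B[OF \<beta>.hyps(1)] by blast
    have "d \<noteq> \<one>\<^bsub>B\<^esub>"
    proof
      assume "d = \<one>\<^bsub>B\<^esub>"
      then have "\<psi> (\<beta> b) = \<psi> \<one>\<^bsub>P\<^esub>" using d by simp
      then have "\<beta> b = \<one>\<^bsub>P\<^esub>" using inj \<beta>.hyps(1) by (metis P.one_closed \<beta>.hom_closed inj_onD)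
      then show False using \<beta>.hyps(2) by simp
    qed
    have eq: "\<psi> (\<beta> b \<otimes>\<^bsub>P\<^esub> w) = \<beta> d \<otimes>\<^bsub>P\<^esub> \<psi> w" using d \<beta>.hyps by simp
    have cd: "inv\<^bsub>B\<^esub> c \<otimes>\<^bsub>B\<^esub> d \<in> carrier B" using c d by simp
    have eq': "?c \<otimes>\<^bsub>P\<^esub> (\<beta> d \<otimes>\<^bsub>P\<^esub> \<psi> w) = \<beta> (inv\<^bsub>B\<^esub> c \<otimes>\<^bsub>B\<^esub> d) \<otimes>\<^bsub>P\<^esub> \<psi> w"
      using c d \<beta>.hyps by (simp add: P.m_assoc)
    have \<psi>w: "\<psi> w \<in> carrier P" using \<beta>.hyps by simp
    have sg: "signs (\<beta> d \<otimes>\<^bsub>P\<^esub> \<psi> w) = map ((*) s) (signs w)"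
      "signs (\<beta> (inv\<^bsub>B\<^esub> c \<otimes>\<^bsub>B\<^esub> d) \<otimes>\<^bsub>P\<^esub> \<psi> w) = map ((*) s) (signs w)"
      using signs_\<beta>_mult[OF d(1) \<psi>w] signs_\<beta>_mult[OF cd \<psi>w] \<beta>.IH by simp_all
    have cl: "\<beta> d \<otimes>\<^bsub>P\<^esub> \<psi> w \<in> carrier P" "\<beta> (inv\<^bsub>B\<^esub> c \<otimes>\<^bsub>B\<^esub> d) \<otimes>\<^bsub>P\<^esub> \<psi> w \<in> carrier P"
      using d(1) \<psi>w P.m_closed[OF \<beta>.hom_closed[OF cd] \<psi>w] by simp_all
    have start0: "start_sign (\<beta> b \<otimes>\<^bsub>P\<^esub> w) = 0"
      using \<beta>.hyps by (simp add: start_sign_eq)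
    have goal: "start_sign (\<beta> d \<otimes>\<^bsub>P\<^esub> \<psi> w) \<noteq> - s \<and> start_sign (\<beta> (inv\<^bsub>B\<^esub> c \<otimes>\<^bsub>B\<^esub> d) \<otimes>\<^bsub>P\<^esub> \<psi> w) \<noteq> s"
    proof -
      consider "signs w = []" | "start_sign w = 1" | "start_sign w = - 1"
        using start_sign_abs[of w] start_sign_eq[of w] \<beta>.hyps(3,4) abs_hd_signs[of w] by force
      then show ?thesis
      proof cases
        case 1
        then show ?thesis using sg cl s0 by (simp add: start_sign_eq)
      next
        case 2
        then obtain r where r: "signs w = 1 # r"
          using \<beta>.hyps by (cases "signs w") (auto simp: start_sign_eq split: if_splits)
        \<comment> \<open>The image of \<open>w\<close> begins with \<open>c\<close>, so the new
          leading letter, after removal of \<open>c\<close>, is a conjugate of \<open>d\<close> and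
          hence nontrivial.\<close>
        have "start_sign (?c \<otimes>\<^bsub>P\<^esub> \<psi> w) = s" using \<beta>.IH 2 by blast
        then have "lead (?c \<otimes>\<^bsub>P\<^esub> \<psi> w) = \<one>\<^bsub>B\<^esub>"
          using s0 \<psi>w cP by (intro start_sign_lead) auto
        then have "inv\<^bsub>B\<^esub> c \<otimes>\<^bsub>B\<^esub> lead (\<psi> w) = \<one>\<^bsub>B\<^esub>"
          using lead_\<beta>_mult[OF cP(1) \<psi>w] by simp
        then have "lead (\<psi> w) = c"
          using c \<psi>w by (metis B.inv_equality B.inv_inv B.inv_closed lead_closed B.inv_comm)
        then have "lead (\<beta> (inv\<^bsub>B\<^esub> c \<otimes>\<^bsub>B\<^esub> d) \<otimes>\<^bsub>P\<^esub> \<psi> w) = inv\<^bsub>B\<^esub> c \<otimes>\<^bsub>B\<^esub> d \<otimes>\<^bsub>B\<^esub> c"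
          using lead_\<beta>_mult[OF cd \<psi>w] by simp
        moreover have "inv\<^bsub>B\<^esub> c \<otimes>\<^bsub>B\<^esub> d \<otimes>\<^bsub>B\<^esub> c \<noteq> \<one>\<^bsub>B\<^esub>"
          using \<open>d \<noteq> \<one>\<^bsub>B\<^esub>\<close> c d
          by (metis B.inv_closed B.inv_solve_left B.inv_solve_right' B.l_inv B.m_assoc B.m_closed B.r_cancel_one' B.inv_equality B.inv_inv B.l_cancel_one B.one_closed B.r_one)
        ultimately have "start_sign (\<beta> (inv\<^bsub>B\<^esub> c \<otimes>\<^bsub>B\<^esub> d) \<otimes>\<^bsub>P\<^esub> \<psi> w) = 0"
          using start_sign_eq[OF cl(2)] by simp
        then show ?thesis using s0 start_hd[OF cl(1), of s] sg(1) r c by simp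
      next
        case 3
        then obtain r where r: "signs w = (- 1) # r"
          using \<beta>.hyps by (cases "signs w") (auto simp: start_sign_eq split: if_splits)
        have "start_sign (\<psi> w) = - s" using \<beta>.IH 3 by blast
        then have "lead (\<psi> w) = \<one>\<^bsub>B\<^esub>"
          using s0 \<psi>w by (intro start_sign_lead) auto
        then have "lead (\<beta> d \<otimes>\<^bsub>P\<^esub> \<psi> w) = d" using lead_\<beta>_mult[OF d(1) \<psi>w] d by simp
        then have "start_sign (\<beta> d \<otimes>\<^bsub>P\<^esub> \<psi> w) = 0"
          using start_sign_eq[OF cl(1)] \<open>d \<noteq> \<one>\<^bsub>B\<^esub>\<close> by simp
        then show ?thesis using s0 start_hd[OF cl(2), of "- s"] sg(2) r c by simp
      qed
    qed
    show ?case
      unfolding eq eq' start0 using sg(1) goal \<beta>.hyps by simp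
  next
    case (T e w)
    have \<psi>w: "\<psi> w \<in> carrier P" using T.hyps by simp
    have lift: "signs (T e \<otimes>\<^bsub>P\<^esub> w) = e # signs w" "start_sign (T e \<otimes>\<^bsub>P\<^esub> w) = e"
      using T_mult_reduced T.hyps by blast+
    consider "start_sign w = 0" | "start_sign w = e"
      using start_sign_abs[of w] T.hyps by force
    note w_cases = this
    have hd: "\<exists>r. signs (\<psi> w) = s * e # r" if "start_sign w = e"
      using that T.IH T.hyps by (cases "signs w") (auto simp: start_sign_eq split: if_splits)
    show ?case
    proof (cases "e = 1")
      case True
      have "start_sign (\<psi> w) \<noteq> - s"
        using w_cases T.IH hd start_hd[OF \<psi>w] c True by cases auto
      then have *: "signs (T s \<otimes>\<^bsub>P\<^esub> \<psi> w) = s # signs (\<psi> w)" "start_sign (T s \<otimes>\<^bsub>P\<^esub> \<psi> w) = s"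
        using T_mult_reduced c \<psi>w by blast+
      have eq: "\<psi> (T e \<otimes>\<^bsub>P\<^esub> w) = \<beta> c \<otimes>\<^bsub>P\<^esub> (T s \<otimes>\<^bsub>P\<^esub> \<psi> w)"
        using T.hyps c True by (simp add: P.m_assoc)
      have "?c \<otimes>\<^bsub>P\<^esub> (\<beta> c \<otimes>\<^bsub>P\<^esub> (T s \<otimes>\<^bsub>P\<^esub> \<psi> w)) = T s \<otimes>\<^bsub>P\<^esub> \<psi> w"
        using c \<psi>w by (simp add: P.m_assoc[symmetric])
      then show ?thesis
        unfolding eq lift using * c \<psi>w T.IH True by simp
    next
      case False
      then have e: "e = - 1" using T.hyps by linarith
      have cw: "?c \<otimes>\<^bsub>P\<^esub> \<psi> w \<in> carrier P" using P.m_closed[OF cP(2) \<psi>w] .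
      have sgc: "signs (?c \<otimes>\<^bsub>P\<^esub> \<psi> w) = signs (\<psi> w)" by (rule signs_\<beta>_mult[OF cP(1) \<psi>w])
      have "start_sign (?c \<otimes>\<^bsub>P\<^esub> \<psi> w) \<noteq> s"
        using w_cases
      proof cases
        case 1
        then show ?thesis using T.IH by blast
      next
        case 2
        then obtain r where "signs (\<psi> w) = - s # r" using hd e by auto
        then show ?thesis using start_hd[OF cw, of "- s"] sgc c by simp
      qed
      then have *: "signs (T (- s) \<otimes>\<^bsub>P\<^esub> (?c \<otimes>\<^bsub>P\<^esub> \<psi> w)) = - s # signs (\<psi> w)"
        "start_sign (T (- s) \<otimes>\<^bsub>P\<^esub> (?c \<otimes>\<^bsub>P\<^esub> \<psi> w)) = - s"
        using T_mult_reduced[of "- s", OF _ cw] c sgc by simp_all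
      have eq: "\<psi> (T e \<otimes>\<^bsub>P\<^esub> w) = T (- s) \<otimes>\<^bsub>P\<^esub> (?c \<otimes>\<^bsub>P\<^esub> \<psi> w)"
        using T.hyps T1 cP(2) \<psi>w by (simp add: P.m_assoc e del: \<beta>.hom_inv)
      show ?thesis
        unfolding eq lift using * T.IH e by simp
    qed
  qed
  then show ?thesis by blast
qed

theorem signs_automorphism:
  assumes ind: "freely_indecomposable B" and nZ: "\<not> B \<cong> integer_group" and \<phi>: "\<phi> \<in> iso P P"
  shows "\<exists>g\<in>carrier P. \<exists>s. \<bar>s\<bar> = 1 \<and> (\<forall>x\<in>carrier P. signs (conjugate g (\<phi> x)) = map ((*) s) (signs x))"
proof -
  obtain g where g: "g \<in> carrier P" "(conjugate g \<circ> \<phi>) ` \<beta> ` carrier B = \<beta> ` carrier B"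
    using iso_preserves_B[OF assms] by blast
  have conjugate_iso: "conjugate k \<circ> f \<in> iso P P" if "k \<in> carrier P" "f \<in> iso P P" for k f
  proof -
    have "conjugate k \<in> iso P P"
      using that(1) conjugate_hom by (intro isoI bij_betwI[where g = "conjugate (inv\<^bsub>P\<^esub> k)"]) auto
    then show ?thesis using that(2) iso_set_trans by blast
  qed
  obtain c d s where c: "c \<in> carrier B" "d \<in> carrier B" "\<bar>s\<bar> = 1"
    "(conjugate g \<circ> \<phi>) (T 1) = \<beta> c \<otimes>\<^bsub>P\<^esub> T s \<otimes>\<^bsub>P\<^esub> \<beta> d"
    using iso_T_normal_form[OF conjugate_iso[OF g(1) \<phi>] g(2)] by blast
  \<comment> \<open>Conjugation by this element moves \<open>d\<close> from the right of the image
    of \<open>t\<close> to its left, where it joins \<open>c\<close>.\<close>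
  let ?k = "\<beta> (inv\<^bsub>B\<^esub> d)"
  define \<psi> where "\<psi> = conjugate ?k \<circ> (conjugate g \<circ> \<phi>)"
  have k: "?k \<in> carrier P" using c \<beta>.hom_closed by blast
  have \<psi>: "\<psi> \<in> iso P P" unfolding \<psi>_def using conjugate_iso k g \<phi> by blast
  have "\<psi> (\<beta> b) \<in> \<beta> ` carrier B" if b: "b \<in> carrier B" for b
  proof -
    obtain b' where "b' \<in> carrier B" "(conjugate g \<circ> \<phi>) (\<beta> b) = \<beta> b'" using g(2) b by blast
    then have "\<psi> (\<beta> b) = \<beta> (inv\<^bsub>B\<^esub> (inv\<^bsub>B\<^esub> d) \<otimes>\<^bsub>B\<^esub> b' \<otimes>\<^bsub>B\<^esub> inv\<^bsub>B\<^esub> d)"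
      using conjugate_\<beta>[of "inv\<^bsub>B\<^esub> d" b'] c(2) unfolding \<psi>_def by (metis B.inv_closed comp_apply)
    then show ?thesis using \<open>b' \<in> carrier B\<close> c(2) by blast
  qed
  moreover have "\<psi> (T 1) = \<beta> (d \<otimes>\<^bsub>B\<^esub> c) \<otimes>\<^bsub>P\<^esub> T s"
    using c unfolding \<psi>_def by (simp add: conjugate_def P.m_assoc)
  ultimately have "signs (\<psi> x) = map ((*) s) (signs x)" if "x \<in> carrier P" for x
    using \<psi> c that by (intro signs_normal_automorphism[where c = "d \<otimes>\<^bsub>B\<^esub> c"]) (auto simp: iso_def bij_betw_def)
  moreover have "\<psi> x = conjugate (g \<otimes>\<^bsub>P\<^esub> ?k) (\<phi> x)" if "x \<in> carrier P" for x
  proof -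
    have "\<phi> x \<in> carrier P" using \<phi> that by (auto simp: iso_def hom_def)
    then show ?thesis using conjugate_conjugate[OF g(1) k] by (simp add: \<psi>_def)
  qed
  ultimately show ?thesis using g k c by (intro bexI[of _ "g \<otimes>\<^bsub>P\<^esub> ?k"] exI[of _ s]) auto
qed

end

section \<open>Disjoint appearances\<close>

definition disjoint_appearances :: "'a list \<Rightarrow> 'a list \<Rightarrow> nat set \<Rightarrow> bool" where
  "disjoint_appearances z xs S \<longleftrightarrow>
     S \<subseteq> appearances z xs \<and> (\<forall>i\<in>S. \<forall>j\<in>S. i < j \<longrightarrow> i + length z \<le> j)"

lemma finite_appearances: "finite (appearances z xs)"
  by (rule finite_subset[of _ "{..length xs}"]) (auto simp: appearances_def)

lemma disjoint_appearances_finite: "disjoint_appearances z xs S \<Longrightarrow> finite S"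
  using finite_appearances finite_subset by (auto simp: disjoint_appearances_def)

lemma finite_card_disjoint_appearances: "finite {card S | S. disjoint_appearances z xs S}"
proof (rule finite_subset)
  show "{card S | S. disjoint_appearances z xs S} \<subseteq> card ` Pow (appearances z xs)"
    by (auto simp: disjoint_appearances_def)
qed (simp add: finite_appearances)

lemma max_disjoint_appearances_eq:
  "max_disjoint_appearances z xs = Max {card S | S. disjoint_appearances z xs S}"
  by (simp add: max_disjoint_appearances_def disjoint_appearances_def)

lemma max_disjoint_appearances_ge:
  "disjoint_appearances z xs S \<Longrightarrow> card S \<le> max_disjoint_appearances z xs"
  unfolding max_disjoint_appearances_eq
  using finite_card_disjoint_appearances by (intro Max_ge) auto

lemma max_disjoint_appearances_obtain:
  obtains S where "disjoint_appearances z xs S" "card S = max_disjoint_appearances z xs"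
proof -
  have "disjoint_appearances z xs {}" by (simp add: disjoint_appearances_def)
  then have "Max {card S | S. disjoint_appearances z xs S} \<in> {card S | S. disjoint_appearances z xs S}"
    by (intro Max_in finite_card_disjoint_appearances) auto
  then show thesis using that by (auto simp: max_disjoint_appearances_eq)
qed

lemma max_disjoint_appearances_append_ge:
  assumes "z \<noteq> []"
  shows "max_disjoint_appearances z xs + max_disjoint_appearances z ys \<le> max_disjoint_appearances z (xs @ ys)"
proof -
  obtain S where S: "disjoint_appearances z xs S" "card S = max_disjoint_appearances z xs"
    by (rule max_disjoint_appearances_obtain)
  obtain R where R: "disjoint_appearances z ys R" "card R = max_disjoint_appearances z ys"
    by (rule max_disjoint_appearances_obtain)
  let ?R = "(+) (length xs) ` R"
  have Sb: "i + length z \<le> length xs" if "i \<in> S" for i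
    using S that by (auto simp: disjoint_appearances_def appearances_def)
  have "disjoint_appearances z (xs @ ys) (S \<union> ?R)"
    unfolding disjoint_appearances_def
  proof (intro conjI ballI impI)
    show "S \<union> ?R \<subseteq> appearances z (xs @ ys)"
      using S R by (auto simp: disjoint_appearances_def appearances_def)
    fix i j assume "i \<in> S \<union> ?R" "j \<in> S \<union> ?R" "i < j"
    then show "i + length z \<le> j"
      using S R Sb by (fastforce simp: disjoint_appearances_def)
  qed
  moreover have "S \<inter> ?R = {}"
    using Sb assms by fastforce
  then have "card (S \<union> ?R) = card S + card R"
    using disjoint_appearances_finite[OF S(1)] disjoint_appearances_finite[OF R(1)]
    by (simp add: card_Un_disjoint card_image)
  ultimately show ?thesis
    using max_disjoint_appearances_ge S(2) R(2) by metis
qed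

text \<open>At most one member of a disjoint family straddles the cut.\<close>

lemma max_disjoint_appearances_append_le:
  assumes "z \<noteq> []"
  shows "max_disjoint_appearances z (xs @ ys) \<le> max_disjoint_appearances z xs + max_disjoint_appearances z ys + 1"
proof -
  obtain S where S: "disjoint_appearances z (xs @ ys) S" "card S = max_disjoint_appearances z (xs @ ys)"
    by (rule max_disjoint_appearances_obtain)
  let ?m = "length xs"
  define S1 S2 S3 where "S1 = {i \<in> S. i + length z \<le> ?m}" and "S2 = {i \<in> S. ?m \<le> i}"
    and "S3 = {i \<in> S. i < ?m \<and> ?m < i + length z}"
  have fin: "finite S" by (rule disjoint_appearances_finite[OF S(1)])
  have "card S \<le> card (S1 \<union> S2 \<union> S3)"
    using fin by (intro card_mono) (auto simp: S1_def S2_def S3_def)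
  also have "\<dots> \<le> card S1 + card S2 + card S3"
    by (meson add_le_mono card_Un_le le_refl order_trans)
  finally have *: "card S \<le> card S1 + card S2 + card S3" .
  have "disjoint_appearances z xs S1"
    using S(1) by (auto simp: S1_def disjoint_appearances_def appearances_def)
  then have S1: "card S1 \<le> max_disjoint_appearances z xs" by (rule max_disjoint_appearances_ge)
  have S2: "card S2 \<le> max_disjoint_appearances z ys"
  proof -
    let ?R = "(\<lambda>i. i - ?m) ` S2"
    have "disjoint_appearances z ys ?R"
      using S(1) by (fastforce simp: S2_def disjoint_appearances_def appearances_def)
    moreover have "inj_on (\<lambda>i. i - ?m) S2" by (auto simp: S2_def inj_on_def)
    ultimately show ?thesis using max_disjoint_appearances_ge card_image by metis
  qed
  have S3: "card S3 \<le> 1"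
  proof -
    have "\<not> i < j" if "i \<in> S3" "j \<in> S3" for i j
    proof
      assume "i < j"
      then have "i + length z \<le> j"
        using S(1) that unfolding S3_def disjoint_appearances_def by blast
      then show False using that unfolding S3_def by simp
    qed
    then have "i = j" if "i \<in> S3" "j \<in> S3" for i j
      using that by (meson linorder_neqE_nat)
    then have "S3 = {} \<or> (\<exists>i. S3 = {i})" by blast
    then show ?thesis by auto
  qed
  show ?thesis using * S1 S2 S3 unfolding S(2) by linarith
qed

lemma max_disjoint_appearances_short:
  assumes "z \<noteq> []" "length xs \<le> 1"
  shows "max_disjoint_appearances z xs \<le> 1"
proof -
  obtain S where S: "disjoint_appearances z xs S" "card S = max_disjoint_appearances z xs"
    by (rule max_disjoint_appearances_obtain)
  have "S \<subseteq> {0}"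
  proof
    fix i assume "i \<in> S"
    then have "i + length z \<le> length xs"
      using S(1) by (auto simp: disjoint_appearances_def appearances_def)
    moreover have "length z > 0" using assms(1) by simp
    ultimately have "i = 0" using assms(2) by linarith
    then show "i \<in> {0}" by simp
  qed
  from card_mono[OF _ this] show ?thesis using S(2) by simp
qed

lemma max_disjoint_appearances_self:
  shows "1 \<le> max_disjoint_appearances z z"
  using max_disjoint_appearances_ge[of z z "{0}"]
  by (simp add: disjoint_appearances_def appearances_def)

lemma max_disjoint_appearances_eq_0:
  assumes "\<not> sublist z xs"
  shows "max_disjoint_appearances z xs = 0"
proof -
  have "appearances z xs = {}"
  proof (rule ccontr)
    assume "appearances z xs \<noteq> {}"
    then obtain i where "take (length z) (drop i xs) = z" by (auto simp: appearances_def)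
    then have "xs = take i xs @ z @ drop (length z) (drop i xs)"
      by (metis append_take_drop_id)
    then show False using assms by (metis sublist_appendI)
  qed
  then show ?thesis
    using max_disjoint_appearances_obtain[of z xs] unfolding disjoint_appearances_def
    by (metis card.empty subset_empty)
qed

section \<open>Run lengths\<close>

text \<open>Applied to \<open>signs w\<close> this is the weighted code, which therefore depends on
  the sign sequence alone.\<close>

fun run_lengths :: "'a list \<Rightarrow> nat list" where
  "run_lengths [] = []"
| "run_lengths (x # xs) =
     (if xs \<noteq> [] \<and> hd xs = x then Suc (hd (run_lengths xs)) # tl (run_lengths xs) else 1 # run_lengths xs)"

lemma run_lengths_eq_Nil [simp]: "run_lengths xs = [] \<longleftrightarrow> xs = []"
  by (cases xs) auto

lemma run_lengths_append:
  assumes "xs \<noteq> []" "ys \<noteq> []"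
  shows "run_lengths (xs @ ys) =
    (if last xs = hd ys
     then butlast (run_lengths xs) @ [last (run_lengths xs) + hd (run_lengths ys)] @ tl (run_lengths ys)
     else run_lengths xs @ run_lengths ys)"
  using assms(1)
proof (induction xs)
  case (Cons x xs)
  show ?case
  proof (cases "xs = []")
    case True
    then show ?thesis using assms(2) by simp
  next
    case False
    then obtain n ns where "run_lengths xs = n # ns" by (cases "run_lengths xs") auto
    with False Cons.IH show ?thesis by (auto simp: hd_append)
  qed
qed simp

lemma run_lengths_rev: "run_lengths (rev xs) = rev (run_lengths xs)"
proof (induction xs)
  case (Cons x xs)
  show ?case
  proof (cases "xs = []")
    case False
    then obtain n ns where n: "run_lengths xs = n # ns" by (cases "run_lengths xs") auto
    have "run_lengths (rev xs @ [x]) = (if hd xs = x then rev ns @ [Suc n] else rev (n # ns) @ [1])"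
      using False Cons.IH n by (subst run_lengths_append) (auto simp: last_rev)
    then show ?thesis using False n by auto
  qed simp
qed simp

lemma run_lengths_map: "inj f \<Longrightarrow> run_lengths (map f xs) = run_lengths xs"
  by (induction xs) (auto simp: hd_map inj_eq)

lemma run_lengths_replicate_append:
  assumes "n > 0"
  shows "run_lengths (replicate n x @ ys) =
    (if ys \<noteq> [] \<and> hd ys = x then (n + hd (run_lengths ys)) # tl (run_lengths ys) else n # run_lengths ys)"
  using assms
proof (induction n)
  case (Suc n)
  then show ?case by (cases "n = 0") (auto simp: hd_append)
qed simp

lemma run_lengths_inv_signs: "run_lengths (inv_signs xs) = rev (run_lengths xs)"
  by (simp add: inv_signs_def run_lengths_rev run_lengths_map)

definition run_count :: "nat list \<Rightarrow> 'a list \<Rightarrow> real" where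
  "run_count z xs = real (max_disjoint_appearances z (run_lengths xs))"

text \<open>Run lengths change only at the seam, where two runs may merge. Dropping an end entry
  lowers the count by at most 2, one for the entry and one for an appearance across the cut; doing
  so on both sides gives 4.\<close>

lemma run_count_append:
  assumes "z \<noteq> []"
  shows "\<bar>run_count z (xs @ ys) - run_count z xs - run_count z ys\<bar> \<le> 4"
proof (cases "xs = [] \<or> ys = []")
  case True
  have "run_count z ([] :: 'a list) = 0"
    using max_disjoint_appearances_eq_0[of z "[]"] assms by (simp add: run_count_def)
  then show ?thesis using True by auto
next
  case False
  then obtain p m where p: "run_lengths xs = p @ [m]" by (metis rev_exhaust run_lengths_eq_Nil)
  obtain n q where q: "run_lengths ys = n # q"
    using False by (cases "run_lengths ys") auto
  have r: "run_lengths (xs @ ys) = p @ [m + n] @ q \<or> run_lengths (xs @ ys) = (p @ [m]) @ (n # q)"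
    using False p q by (subst (1 2) run_lengths_append) auto
  let ?D = "\<lambda>u. max_disjoint_appearances z u"
  note ge = max_disjoint_appearances_append_ge[OF assms] and le = max_disjoint_appearances_append_le[OF assms]
  note short = max_disjoint_appearances_short[OF assms, of "[_]", simplified]
  show ?thesis
    using r
  proof
    assume r: "run_lengths (xs @ ys) = p @ [m + n] @ q"
    have "?D p + ?D q \<le> ?D (p @ [m + n] @ q)" "?D (p @ [m + n] @ q) \<le> ?D p + ?D q + 3"
      using ge[of p "[m + n] @ q"] le[of p "[m + n] @ q"] ge[of "[m + n]" q] le[of "[m + n]" q] short[of "m + n"]
      by linarith+
    moreover have "?D p \<le> ?D (p @ [m])" "?D (p @ [m]) \<le> ?D p + 2"
      using ge[of p "[m]"] le[of p "[m]"] short[of m] by linarith+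
    moreover have "?D q \<le> ?D ([n] @ q)" "?D ([n] @ q) \<le> ?D q + 2"
      using ge[of "[n]" q] le[of "[n]" q] short[of n] by linarith+
    ultimately show ?thesis
      unfolding run_count_def r p q by simp
  next
    assume r: "run_lengths (xs @ ys) = (p @ [m]) @ (n # q)"
    show ?thesis
      using ge[of "p @ [m]" "n # q"] le[of "p @ [m]" "n # q"]
      unfolding run_count_def r p q by linarith
  qed
qed

text \<open>The sign of the sum is recorded so that absolute values add when an integer of the same
  sign joins the run.\<close>

lemma sign_runs_spec:
  assumes "as \<noteq> []" "0 \<notin> set as"
  shows "\<exists>r rs. sign_runs as = r # rs \<and> r \<noteq> [] \<and> hd r = hd as \<and> sgn (sum_list r) = sgn (hd as)"
  using assms
proof (induction as)
  case (Cons a as)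
  show ?case
  proof (cases "as = []")
    case False
    then obtain r rs where r: "sign_runs as = r # rs" "r \<noteq> []" "hd r = hd as" "sgn (sum_list r) = sgn (hd as)"
      using Cons by auto
    then show ?thesis
      by (auto simp: sgn_if split: if_splits)
  qed simp
qed simp

lemma run_lengths_sign_runs:
  assumes "0 \<notin> set as"
  shows "map (\<lambda>r. nat \<bar>sum_list r\<bar>) (sign_runs as) =
         run_lengths (concat (map (\<lambda>a. replicate (nat \<bar>a\<bar>) (sgn a)) as))"
  using assms
proof (induction as)
  case (Cons a as)
  let ?E = "\<lambda>as::int list. concat (map (\<lambda>a. replicate (nat \<bar>a\<bar>) (sgn a)) as)"
  have a: "a \<noteq> 0" "nat \<bar>a\<bar> > 0" using Cons.prems by auto
  have IH: "map (\<lambda>r. nat \<bar>sum_list r\<bar>) (sign_runs as) = run_lengths (?E as)"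
    using Cons by auto
  show ?case
  proof (cases "as = []")
    case True
    then show ?thesis using run_lengths_replicate_append[OF a(2), of "sgn a" "[]"] by simp
  next
    case False
    then obtain r rs where r: "sign_runs as = r # rs" "r \<noteq> []" "hd r = hd as" "sgn (sum_list r) = sgn (hd as)"
      using sign_runs_spec Cons.prems by (metis list.set_intros(2))
    obtain b bs where b: "as = b # bs" "b \<noteq> 0" using False Cons.prems by (cases as) auto
    have E: "?E as \<noteq> []" "hd (?E as) = sgn b" using b by (auto simp: hd_append hd_replicate)
    have "run_lengths (?E (a # as)) = (if sgn b = sgn a
        then (nat \<bar>a\<bar> + hd (run_lengths (?E as))) # tl (run_lengths (?E as)) else nat \<bar>a\<bar> # run_lengths (?E as))"
      using run_lengths_replicate_append[OF a(2), of "sgn a" "?E as"] E by simp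
    moreover have "\<bar>a + sum_list r\<bar> = \<bar>a\<bar> + \<bar>sum_list r\<bar>" if "sgn a = sgn b"
      using r(4) that b by (auto simp: sgn_if split: if_splits)
    moreover have "nat \<bar>sum_list r\<bar> # map (\<lambda>r. nat \<bar>sum_list r\<bar>) rs = run_lengths (?E as)"
      using IH r(1) by simp
    note this[symmetric]
    moreover have "sign_runs (a # as) = (if sgn a = sgn b then (a # r) # rs else [a] # r # rs)"
      using r b by simp
    ultimately show ?thesis
      by (cases "sgn a = sgn b") (simp_all add: nat_add_distrib del: sign_runs.simps)
  qed
qed simp

section \<open>Homogenisation\<close>

lemma homogenisation_eqI:
  assumes "\<And>k::nat. \<bar>\<psi> (g [^]\<^bsub>G\<^esub> k) - real k * y\<bar> \<le> C"
  shows "homogenisation G \<psi> g = y"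
proof -
  have "(\<lambda>n::nat. \<psi> (g [^]\<^bsub>G\<^esub> n) / real n) \<longlonglongrightarrow> y"
  proof (rule LIM_zero_cancel, rule tendsto_0_le[where f = "\<lambda>n. C / real n" and K = 1])
    show "\<forall>\<^sub>F n in sequentially. norm (\<psi> (g [^]\<^bsub>G\<^esub> n) / real n - y) \<le> norm (C / real n) * 1"
      using eventually_gt_at_top[of 0]
    proof eventually_elim
      case (elim n)
      have "\<psi> (g [^]\<^bsub>G\<^esub> n) / real n - y = (\<psi> (g [^]\<^bsub>G\<^esub> n) - real n * y) / real n"
        using elim by (simp add: field_simps)
      then have "norm (\<psi> (g [^]\<^bsub>G\<^esub> n) / real n - y) \<le> C / real n"
        using assms[of n] elim by (simp add: divide_right_mono abs_divide)
      then show ?case by (smt (verit) mult_cancel_left1 real_norm_def mult.commute)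
    qed
    show "(\<lambda>n. C / real n) \<longlonglongrightarrow> 0" by (rule lim_const_over_n)
  qed
  then show ?thesis unfolding homogenisation_def by (rule limI)
qed

context group
begin

context
  fixes \<psi> :: "'a \<Rightarrow> real" and D :: real
  assumes D: "\<And>g h. g \<in> carrier G \<Longrightarrow> h \<in> carrier G \<Longrightarrow> \<bar>\<psi> g + \<psi> h - \<psi> (g \<otimes> h)\<bar> \<le> D"
begin

text \<open>The factor is \<open>m + 1\<close> because the induction starts at \<open>m = 0\<close>,
  where the value at the identity already costs \<open>D\<close>.\<close>

lemma quasimorphism_pow:
  assumes g: "g \<in> carrier G"
  shows "\<bar>\<psi> (g [^] (n * m)) - real m * \<psi> (g [^] n)\<bar> \<le> (real m + 1) * D"
proof -
  have D0: "0 \<le> D" using D[OF one_closed one_closed] by linarith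
  show ?thesis
  proof (induction m)
    case 0
    have "\<bar>\<psi> \<one>\<bar> \<le> D" using D[OF one_closed one_closed] by simp
    then show ?case by simp
  next
    case (Suc m)
    have "g [^] (n * m) \<otimes> g [^] n = g [^] (n * Suc m)"
      using g by (simp add: nat_pow_mult add.commute)
    then have "\<bar>\<psi> (g [^] (n * m)) + \<psi> (g [^] n) - \<psi> (g [^] (n * Suc m))\<bar> \<le> D"
      using D[of "g [^] (n * m)" "g [^] n"] g by simp
    then show ?case using Suc.IH by (simp add: algebra_simps abs_le_iff)
  qed
qed

text \<open>Comparing the exponents \<open>n\<close> and \<open>m\<close> through
  \<open>n * m\<close> shows that the sequence is Cauchy, so that \<open>lim\<close> is a genuine
  limit; letting \<open>m\<close> grow in the same comparison gives the bound. The factor 2 comes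
  from \<open>m + 1 \<le> 2 * m\<close>.\<close>

lemma homogenisation_bound:
  assumes g: "g \<in> carrier G"
  shows "\<bar>\<psi> (g [^] (n::nat)) - real n * homogenisation G \<psi> g\<bar> \<le> 2 * D"
proof -
  have D0: "0 \<le> D" using D[OF one_closed one_closed] by linarith
  let ?a = "\<lambda>n::nat. \<psi> (g [^] n)"
  have step: "\<bar>?a (n * m) / real (n * m) - ?a n / real n\<bar> \<le> 2 * D / real n" if "n > 0" "m > 0" for n m
  proof -
    have "\<bar>?a (n * m) - real m * ?a n\<bar> \<le> (real m + 1) * D" by (rule quasimorphism_pow[OF g])
    also have "\<dots> \<le> (2 * real m) * D" using D0 that by (intro mult_right_mono) auto
    finally have "\<bar>?a (n * m) - real m * ?a n\<bar> / real (n * m) \<le> (2 * real m) * D / real (n * m)"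
      by (intro divide_right_mono) auto
    moreover have "?a (n * m) / real (n * m) - ?a n / real n = (?a (n * m) - real m * ?a n) / real (n * m)"
      using that by (simp add: field_simps)
    ultimately show ?thesis using that by (simp add: abs_divide)
  qed
  have close: "\<bar>?a m / real m - ?a n / real n\<bar> \<le> 2 * D / real n + 2 * D / real m" if "n > 0" "m > 0" for n m
    using step[OF that] step[OF that(2,1)] by (simp add: mult.commute)
  have "Cauchy (\<lambda>n. ?a n / real n)"
  proof (rule metric_CauchyI)
    fix e :: real assume "e > 0"
    obtain M :: nat where M: "4 * D / e < real M" using reals_Archimedean2 by blast
    have "dist (?a m / real m) (?a n / real n) < e" if "m \<ge> Suc M" "n \<ge> Suc M" for m n
    proof -
      have half: "2 * D / real k < e / 2" if "k \<ge> Suc M" for k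
      proof -
        have "4 * D < e * real M" using M \<open>e > 0\<close> by (simp add: field_simps)
        also have "\<dots> \<le> e * real k" using that \<open>e > 0\<close> by (intro mult_left_mono) auto
        finally show ?thesis using that by (simp add: field_simps)
      qed
      have "\<bar>?a m / real m - ?a n / real n\<bar> \<le> 2 * D / real n + 2 * D / real m"
        using close[of n m] that by simp
      also have "\<dots> < e" using half[OF that(1)] half[OF that(2)] by linarith
      finally show ?thesis by (simp add: dist_real_def)
    qed
    then show "\<exists>M. \<forall>m\<ge>M. \<forall>n\<ge>M. dist (?a m / real m) (?a n / real n) < e" by blast
  qed
  then have lim: "(\<lambda>n. ?a n / real n) \<longlonglongrightarrow> homogenisation G \<psi> g"
    unfolding homogenisation_def by (simp add: Cauchy_convergent_iff convergent_LIMSEQ_iff)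
  show ?thesis
  proof (cases "n = 0")
    case True
    then show ?thesis using D[OF one_closed one_closed] by simp
  next
    case False
    have "(\<lambda>m. \<bar>?a m / real m - ?a n / real n\<bar>) \<longlonglongrightarrow> \<bar>homogenisation G \<psi> g - ?a n / real n\<bar>"
      by (intro tendsto_intros lim)
    moreover have "(\<lambda>m. 2 * D / real n + 2 * D / real m) \<longlonglongrightarrow> 2 * D / real n + 0"
      by (intro tendsto_intros lim_const_over_n)
    ultimately have "\<bar>homogenisation G \<psi> g - ?a n / real n\<bar> \<le> 2 * D / real n + 0"
      by (rule LIMSEQ_le) (use close False in \<open>auto intro!: exI[of _ 1]\<close>)
    moreover have "homogenisation G \<psi> g - ?a n / real n = (real n * homogenisation G \<psi> g - ?a n) / real n"
      using False by (simp add: field_simps)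
    ultimately have "\<bar>real n * homogenisation G \<psi> g - ?a n\<bar> \<le> 2 * D"
      using False by (simp add: abs_divide divide_le_cancel)
    then show ?thesis by (simp add: abs_minus_commute)
  qed
qed

lemma quasimorphism_homogenisation: "quasimorphism G (homogenisation G \<psi>)"
proof -
  have D0: "0 \<le> D" using D[OF one_closed one_closed] by linarith
  have b: "\<bar>\<psi> g - homogenisation G \<psi> g\<bar> \<le> 2 * D" if "g \<in> carrier G" for g
    using homogenisation_bound[OF that, of 1] that by simp
  \<comment> \<open>Each of the three values differs from that of \<open>\<psi>\<close> by at most
    \<open>2 * D\<close>, and the defect of \<open>\<psi>\<close> adds \<open>D\<close>.\<close>
  have "\<bar>homogenisation G \<psi> g + homogenisation G \<psi> h - homogenisation G \<psi> (g \<otimes> h)\<bar> \<le> 7 * D"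
    if "g \<in> carrier G" "h \<in> carrier G" for g h
    using b[OF that(1)] b[OF that(2)] b[OF m_closed[OF that]] D[OF that] by linarith
  then show ?thesis using D0 unfolding quasimorphism_def by (intro exI[of _ "7 * D"]) simp
qed

lemma homogenisation_nat_pow:
  assumes g: "g \<in> carrier G"
  shows "homogenisation G \<psi> (g [^] (n::nat)) = real n * homogenisation G \<psi> g"
proof (rule homogenisation_eqI[where C = "2 * D"])
  fix k :: nat
  show "\<bar>\<psi> ((g [^] n) [^] k) - real k * (real n * homogenisation G \<psi> g)\<bar> \<le> 2 * D"
    using homogenisation_bound[OF g, of "n * k"] g by (simp add: nat_pow_pow algebra_simps)
qed

lemma homogenisation_inv:
  assumes g: "g \<in> carrier G"
  shows "homogenisation G \<psi> (inv g) = - homogenisation G \<psi> g"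
proof (rule homogenisation_eqI[where C = "3 * D + \<bar>\<psi> \<one>\<bar>"])
  fix k :: nat
  have "inv g [^] k = inv (g [^] k)" using g by (rule nat_pow_inv)
  then have "\<bar>\<psi> (g [^] k) + \<psi> (inv g [^] k) - \<psi> \<one>\<bar> \<le> D"
    using D[of "g [^] k" "inv g [^] k"] g by simp
  then show "\<bar>\<psi> (inv g [^] k) - real k * - homogenisation G \<psi> g\<bar> \<le> 3 * D + \<bar>\<psi> \<one>\<bar>"
    using homogenisation_bound[OF g, of k] by simp
qed

lemma homogeneous_homogenisation: "homogeneous G (homogenisation G \<psi>)"
  unfolding homogeneous_def
proof (intro ballI allI)
  fix g n assume g: "g \<in> carrier G"
  show "homogenisation G \<psi> (g [^] (n::int)) = of_int n * homogenisation G \<psi> g"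
  proof (cases n rule: int_cases2)
    case (nonneg m)
    then show ?thesis using homogenisation_nat_pow[OF g] by (simp add: int_pow_int)
  next
    case (nonpos m)
    then show ?thesis
      using homogenisation_nat_pow[OF g] homogenisation_inv[of "g [^] m"] g by (simp add: int_pow_neg_int)
  qed
qed

text \<open>Conjugation commutes with powers, so it changes the values by an amount bounded
  independently of the exponent, which the limit forgets.\<close>

lemma homogenisation_conj:
  assumes g: "g \<in> carrier G" and x: "x \<in> carrier G"
  shows "homogenisation G \<psi> (inv x \<otimes> g \<otimes> x) = homogenisation G \<psi> g"
proof (rule homogenisation_eqI[where C = "4 * D + \<bar>\<psi> (inv x)\<bar> + \<bar>\<psi> x\<bar>"])
  fix k :: nat
  have pow: "(inv x \<otimes> g \<otimes> x) [^] k = inv x \<otimes> g [^] k \<otimes> x"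
  proof (induction k)
    case (Suc k)
    have "x \<otimes> (inv x \<otimes> (g \<otimes> x)) = g \<otimes> x" using g x by (simp add: m_assoc[symmetric])
    then show ?case using Suc g x by (simp add: m_assoc)
  qed (use x in simp)
  have "\<bar>\<psi> (inv x) + \<psi> (g [^] k) - \<psi> (inv x \<otimes> g [^] k)\<bar> \<le> D"
    "\<bar>\<psi> (inv x \<otimes> g [^] k) + \<psi> x - \<psi> (inv x \<otimes> g [^] k \<otimes> x)\<bar> \<le> D"
    using D g x by simp_all
  then show "\<bar>\<psi> ((inv x \<otimes> g \<otimes> x) [^] k) - real k * homogenisation G \<psi> g\<bar> \<le> 4 * D + \<bar>\<psi> (inv x)\<bar> + \<bar>\<psi> x\<bar>"
    using homogenisation_bound[OF g, of k] unfolding pow by linarith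
qed

end

end

section \<open>Weighted code quasimorphisms\<close>

text \<open>A window no longer than \<open>z\<close> meets at most two consecutive copies, so
  genericity, a condition on \<open>z @ z\<close>, controls all powers of \<open>z\<close>.\<close>

lemma sublist_concat_replicate:
  assumes "length x \<le> length z" "sublist x (concat (replicate m z))"
  shows "sublist x (z @ z)"
  using assms(2)
proof (induction m)
  case 0
  then show ?case by simp
next
  case (Suc m)
  let ?R = "concat (replicate m z)"
  from Suc.prems have "sublist x (z @ ?R)" by simp
  then consider "sublist x z" | "sublist x ?R" | x1 x2 where "x = x1 @ x2" "suffix x1 z" "prefix x2 ?R"
    unfolding sublist_append by blast
  then show ?case
  proof cases
    case 1
    then show ?thesis by (simp add: sublist_append)
  next
    case 2
    then show ?thesis by (rule Suc.IH)
  next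
    case 3
    have "prefix x2 z"
    proof (cases m)
      case 0
      then show ?thesis using 3 by simp
    next
      case (Suc k)
      then have "prefix x2 (z @ concat (replicate k z))" using 3 by simp
      moreover have "length x2 \<le> length z" using 3(1) assms(1) by simp
      ultimately show ?thesis by (meson prefixI prefix_length_prefix)
    qed
    then show ?thesis using 3 unfolding sublist_append by blast
  qed
qed

lemma max_disjoint_appearances_concat_replicate:
  assumes "z \<noteq> []"
  shows "n \<le> max_disjoint_appearances z (concat (replicate n z))"
proof (induction n)
  case (Suc n)
  then show ?case
    using max_disjoint_appearances_append_ge[OF assms, of z "concat (replicate n z)"]
      max_disjoint_appearances_self[of z] by simp
qed simp

text \<open>The alternating signs keep the runs apart and \<open>b\<close> separates the integers,
  so that any tuple of positive numbers is realised as a code.\<close>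

fun alternating_word :: "'b \<Rightarrow> int \<Rightarrow> nat list \<Rightarrow> (int + 'b) list" where
  "alternating_word b e [] = []"
| "alternating_word b e (n # ns) = Inl (e * int n) # Inr b # alternating_word b (- e) ns"

lemma alternating_word_append:
  "even (length xs) \<Longrightarrow> alternating_word b e (xs @ ys) = alternating_word b e xs @ alternating_word b e ys"
  by (induction xs arbitrary: e rule: induct_list012) auto

lemma concat_replicate_double: "concat (replicate n (z @ z)) = concat (replicate (2 * n) z)"
  by (induction n) simp_all

context free_product_Z
begin

lemma mult_append:
  assumes "u @ v \<in> carrier P" "v \<in> carrier P"
  shows "u \<otimes>\<^bsub>P\<^esub> v = u @ v"
  using foldr_fp_cons_Nil[OF group_integer_group B.is_group, of "u @ v"]
    foldr_fp_cons_Nil[OF group_integer_group B.is_group, of v] assms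
  by (simp add: free_product_simps)

context
  fixes b :: 'b
  assumes b: "b \<in> carrier B" "b \<noteq> \<one>\<^bsub>B\<^esub>"
begin

lemma alternating_word:
  assumes "0 \<notin> set ns" "\<bar>e\<bar> = 1"
  shows "alternating_word b e ns \<in> carrier P \<and>
         start_sign (alternating_word b e ns) = (if ns = [] then 0 else e) \<and>
         run_lengths (signs (alternating_word b e ns)) = ns"
  using assms
proof (induction ns arbitrary: e)
  case (Cons n ns)
  let ?v = "alternating_word b (- e) ns"
  have IH: "?v \<in> carrier P" "start_sign ?v = (if ns = [] then 0 else - e)" "run_lengths (signs ?v) = ns"
    using Cons.IH[of "- e"] Cons.prems by auto
  have e: "e * int n \<noteq> 0" "sgn (e * int n) = e" "nat \<bar>e * int n\<bar> = n" "n > 0" "e \<noteq> 0"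
    using sign_cases[OF Cons.prems(2)] Cons.prems(1) by auto
  have "lead ?v = \<one>\<^bsub>B\<^esub>" by (cases ns) auto
  then have "alternating_word b e (n # ns) \<in> carrier P"
    using IH b e by (simp add: carrier_P_Cons)
  moreover have "signs ?v \<noteq> [] \<Longrightarrow> hd (signs ?v) \<noteq> e"
    using start_sign_eq[OF IH(1)] \<open>lead ?v = \<one>\<^bsub>B\<^esub>\<close> IH(2) e(5) by (auto split: if_splits)
  then have "run_lengths (replicate n e @ signs ?v) = n # ns"
    using run_lengths_replicate_append[OF e(4), of e "signs ?v"] IH(3) by auto
  ultimately show ?case using e by simp
qed simp

lemma alternating_word_pow:
  assumes "0 \<notin> set ns" "even (length ns)"
  shows "alternating_word b 1 ns [^]\<^bsub>P\<^esub> n = alternating_word b 1 (concat (replicate n ns))"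
proof (induction n)
  case 0
  then show ?case by (simp add: one_P)
next
  case (Suc n)
  let ?w = "alternating_word b 1" and ?R = "concat (replicate n ns)"
  have z: "0 \<notin> set ?R" using assms(1) by (induction n) auto
  have "?w ns \<in> carrier P" using alternating_word[of ns 1] assms by simp
  then have "?w ns [^]\<^bsub>P\<^esub> Suc n = ?w ns \<otimes>\<^bsub>P\<^esub> ?w ?R"
    using P.nat_pow_Suc2 Suc by metis
  also have "\<dots> = ?w ns @ ?w ?R"
    using alternating_word[of ?R 1] alternating_word[of "ns @ ?R" 1] z assms
    by (intro mult_append) (simp_all add: alternating_word_append)
  also have "\<dots> = ?w (concat (replicate (Suc n) ns))"
    using assms by (simp add: alternating_word_append)
  finally show ?case .
qed

end

section \<open>The quasimorphism in terms of sign sequences\<close>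

lemma signs_Z_tuple: "signs w = concat (map (\<lambda>a. replicate (nat \<bar>a\<bar>) (sgn a)) (Z_tuple w))"
proof (induction w)
  case (Cons x w)
  then show ?case by (cases x) (simp_all add: Z_tuple_def)
qed (simp add: Z_tuple_def)

lemma weighted_code_eq:
  assumes "w \<in> carrier P"
  shows "weighted_code w = run_lengths (signs w)"
proof -
  have "0 \<notin> set (Z_tuple w)"
    using assms
  proof (induction w)
    case (Cons x w)
    then show ?case by (cases x) (auto simp: Z_tuple_def carrier_P_Cons)
  qed (simp add: Z_tuple_def)
  then show ?thesis
    unfolding weighted_code_def signs_Z_tuple by (rule run_lengths_sign_runs)
qed

lemma weighted_code_qm_eq:
  assumes "g \<in> carrier P"
  shows "weighted_code_qm B z g = run_count z (signs g) - run_count z (inv_signs (signs g))"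
  using assms by (simp add: weighted_code_qm_def theta_Z_def weighted_code_eq run_count_def signs_inv)

text \<open>The cancelled part \<open>c\<close> contributes with opposite signs to \<open>g\<close>
  and to \<open>h\<close>, so only seams remain: three words and their inverses, each cut once at a
  cost of 4.\<close>

lemma weighted_code_qm_bound:
  assumes "z \<noteq> []" "g \<in> carrier P" "h \<in> carrier P"
  shows "\<bar>weighted_code_qm B z g + weighted_code_qm B z h - weighted_code_qm B z (g \<otimes>\<^bsub>P\<^esub> h)\<bar> \<le> 24"
proof -
  obtain p c q where eq: "signs g = p @ c" "signs h = inv_signs c @ q" "signs (g \<otimes>\<^bsub>P\<^esub> h) = p @ q"
    using cancellation[OF assms(2,3)] by blast
  note a = run_count_append[OF assms(1)]
  show ?thesis
    unfolding weighted_code_qm_eq[OF assms(2)] weighted_code_qm_eq[OF assms(3)]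
      weighted_code_qm_eq[OF P.m_closed[OF assms(2,3)]] eq inv_signs_simps
    using a[of p c] a[of "inv_signs c" "inv_signs p"] a[of "inv_signs c" q] a[of "inv_signs q" c]
      a[of p q] a[of "inv_signs q" "inv_signs p"] by linarith
qed

abbreviation code_qm :: "nat list \<Rightarrow> (int + 'b) list \<Rightarrow> real" where
  "code_qm z \<equiv> homogenisation P (weighted_code_qm B z)"

text \<open>Followed by a suitable conjugation, an automorphism multiplies all signs by a common
  \<open>s\<close>. This leaves run lengths and hence the quasimorphism unchanged, and homogenising
  removes the conjugation.\<close>

lemma code_qm_Aut_invariant:
  assumes ind: "freely_indecomposable B" and nZ: "\<not> B \<cong> integer_group" and z: "z \<noteq> []"
  shows "Aut_invariant P (code_qm z)"
  unfolding Aut_invariant_def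
proof (intro ballI)
  fix x \<phi> assume x: "x \<in> carrier P" and \<phi>: "\<phi> \<in> auto P"
  have iso: "\<phi> \<in> iso P P" using \<phi> by (auto simp: auto_def Bij_def iso_def)
  interpret \<phi>: group_hom P P \<phi> using iso by unfold_locales (auto simp: iso_def)
  obtain g s where g: "g \<in> carrier P" "\<bar>s\<bar> = 1"
    and signs: "\<And>y. y \<in> carrier P \<Longrightarrow> signs (conjugate g (\<phi> y)) = map ((*) s) (signs y)"
    using signs_automorphism[OF ind nZ iso] by blast
  have s: "inj ((*) s)" using g(2) by (auto simp: inj_def)
  have "inv_signs (map ((*) s) ss) = map ((*) s) (inv_signs ss)" for ss
    by (simp add: inv_signs_def rev_map)
  then have same: "weighted_code_qm B z (conjugate g (\<phi> y)) = weighted_code_qm B z y" if "y \<in> carrier P" for y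
    using that g(1) by (simp add: weighted_code_qm_eq signs run_count_def run_lengths_map[OF s])
  have "code_qm z (\<phi> x) = code_qm z (conjugate g (\<phi> x))"
    unfolding conjugate_def using x g(1)
    by (intro P.homogenisation_conj[OF weighted_code_qm_bound[OF z], symmetric]) auto
  also have "\<dots> = code_qm z x"
  proof -
    have "conjugate g (\<phi> x) [^]\<^bsub>P\<^esub> n = conjugate g (\<phi> (x [^]\<^bsub>P\<^esub> n))" for n :: nat
      using x g(1) by (simp add: conjugate_pow \<phi>.hom_nat_pow)
    then show ?thesis
      unfolding homogenisation_def using same x by simp
  qed
  finally show "code_qm z (\<phi> x) = code_qm z x" .
qed

text \<open>The codes of all powers of a letter have at most one entry, so the values on powers stay
  bounded.\<close>

lemma code_qm_letter:
  assumes z: "z \<noteq> []" and g: "g \<in> letters integer_group B"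
  shows "code_qm z g = 0"
proof (rule homogenisation_eqI[where C = 1])
  fix k :: nat
  have gP: "g \<in> carrier P" using g by (auto simp: letters_def)
  have "length (run_lengths (signs (g [^]\<^bsub>P\<^esub> k))) \<le> 1"
    using g unfolding letters_def
  proof
    assume "g \<in> T ` carrier integer_group"
    then obtain a where a: "g = T a" by auto
    have "T a [^]\<^bsub>P\<^esub> k = T (int k * a)"
    proof (induction k)
      case 0
      then show ?case using T.hom_one by simp
    next
      case (Suc k)
      then show ?case by (simp add: T_mult algebra_simps)
    qed
    moreover have "signs (T c) = replicate (nat \<bar>c\<bar>) (sgn c)" for c
      by (simp add: fp_inl_def)
    moreover have "length (run_lengths (replicate n x)) \<le> 1" for n and x :: int
      using run_lengths_replicate_append[of n x "[]"] by (cases "n = 0") auto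
    ultimately show ?thesis using a by simp
  next
    assume "g \<in> \<beta> ` carrier B"
    then obtain b where b: "b \<in> carrier B" "g = \<beta> b" by auto
    have "g [^]\<^bsub>P\<^esub> k = \<beta> (b [^]\<^bsub>B\<^esub> k)" unfolding b(2) using \<beta>.hom_nat_pow[OF b(1)] by simp
    then have "signs (g [^]\<^bsub>P\<^esub> k) = []" using signs_\<beta> by metis
    then show ?thesis by simp
  qed
  then have "run_count z (signs (g [^]\<^bsub>P\<^esub> k)) \<in> {0..1}" "run_count z (inv_signs (signs (g [^]\<^bsub>P\<^esub> k))) \<in> {0..1}"
    using max_disjoint_appearances_short[OF z] by (auto simp: run_count_def run_lengths_inv_signs)
  then show "\<bar>weighted_code_qm B z (g [^]\<^bsub>P\<^esub> k) - real k * 0\<bar> \<le> 1"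
    using gP by (auto simp: weighted_code_qm_eq)
qed

section \<open>Test words\<close>

context
  fixes b :: 'b
  assumes b: "b \<in> carrier B" "b \<noteq> \<one>\<^bsub>B\<^esub>"
begin

text \<open>Doubling makes the number of entries even for every \<open>z\<close>, so that the signs
  still alternate where two powers meet.\<close>

definition test_word :: "nat list \<Rightarrow> (int + 'b) list" where
  "test_word z = alternating_word b 1 (z @ z)"

lemma test_word_closed: "0 \<notin> set z \<Longrightarrow> test_word z \<in> carrier P"
  using alternating_word[OF b, of "z @ z" 1] by (simp add: test_word_def)

lemma weighted_code_qm_test_word:
  assumes "0 \<notin> set z"
  shows "weighted_code_qm B y (test_word z [^]\<^bsub>P\<^esub> n) =
    real (max_disjoint_appearances y (concat (replicate (2 * n) z))) -
    real (max_disjoint_appearances y (rev (concat (replicate (2 * n) z))))"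
proof -
  have "test_word z [^]\<^bsub>P\<^esub> n = alternating_word b 1 (concat (replicate (2 * n) z))"
    unfolding test_word_def using assms
    by (subst alternating_word_pow[OF b]) (simp_all add: concat_replicate_double[simplified])
  moreover have "0 \<notin> set (concat (replicate (2 * n) z))" using assms by auto
  ultimately show ?thesis
    using alternating_word[OF b, of "concat (replicate (2 * n) z)" 1]
    by (simp add: weighted_code_qm_eq run_count_def run_lengths_inv_signs)
qed

text \<open>Genericity makes the count for the inverse vanish, so nothing is subtracted from the
  copies of \<open>z\<close> in the code.\<close>

lemma code_qm_test_word_pos:
  assumes "generic z"
  shows "0 < code_qm z (test_word z)"
proof (rule ccontr)
  assume n: "\<not> 0 < code_qm z (test_word z)"
  have z: "z \<noteq> []" "0 \<notin> set z" "\<not> sublist (rev z) (z @ z)" using assms by (auto simp: generic_def)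
  have "\<not> sublist z (rev (concat (replicate m z)))" for m
  proof
    assume "sublist z (rev (concat (replicate m z)))"
    then have "sublist (rev z) (concat (replicate m z))" by (metis rev_rev_ident sublist_rev)
    then show False using sublist_concat_replicate[of "rev z" z m] z(3) by simp
  qed
  \<comment> \<open>Any exponent \<open>n\<close> with \<open>2 * n\<close> above the error
    \<open>2 * 24\<close> from \<open>homogenisation_bound\<close> serves.\<close>
  then have "real (2 * 49) \<le> weighted_code_qm B z (test_word z [^]\<^bsub>P\<^esub> (49::nat))"
    using max_disjoint_appearances_concat_replicate[OF z(1), of "2 * 49"]
    unfolding weighted_code_qm_test_word[OF z(2)] by (simp add: max_disjoint_appearances_eq_0)
  moreover have "\<bar>weighted_code_qm B z (test_word z [^]\<^bsub>P\<^esub> (49::nat)) - real 49 * code_qm z (test_word z)\<bar> \<le> 2 * 24"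
    using z by (intro P.homogenisation_bound weighted_code_qm_bound test_word_closed) auto
  ultimately show False using n by simp
qed

lemma code_qm_test_word_disjoint:
  assumes "y \<noteq> []" "0 \<notin> set z" "set y \<inter> set z = {}"
  shows "code_qm y (test_word z) = 0"
proof (rule homogenisation_eqI[where C = 0])
  fix k :: nat
  have "\<not> sublist y xs" if "set xs \<subseteq> set z" for xs
    using assms(1,3) that set_mono_sublist[of y xs] by (cases y) auto
  then have zero: "max_disjoint_appearances y xs = 0" if "set xs \<subseteq> set z" for xs
    using that by (intro max_disjoint_appearances_eq_0)
  have "set (concat (replicate (2 * k) z)) \<subseteq> set z" "set (rev (concat (replicate (2 * k) z))) \<subseteq> set z"
    by auto
  then show "\<bar>weighted_code_qm B y (test_word z [^]\<^bsub>P\<^esub> k) - real k * 0\<bar> \<le> 0"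
    unfolding weighted_code_qm_test_word[OF assms(2)] by (simp only: zero)
qed

lemma code_qm_unbounded:
  assumes "generic z"
  shows "unbounded_on (carrier P) (code_qm z)"
  unfolding unbounded_on_def
proof
  fix M :: real
  have z: "z \<noteq> []" "0 \<notin> set z" using assms by (auto simp: generic_def)
  note pos = code_qm_test_word_pos[OF assms]
  obtain n :: nat where "M < real n * code_qm z (test_word z)"
    using reals_Archimedean3[OF pos] by blast
  also have "\<dots> = code_qm z (test_word z [^]\<^bsub>P\<^esub> n)"
    using P.homogenisation_nat_pow[OF weighted_code_qm_bound[OF z(1)] test_word_closed[OF z(2)]] by simp
  finally have "M < \<bar>code_qm z (test_word z [^]\<^bsub>P\<^esub> n)\<bar>" by linarith
  then show "\<exists>g\<in>carrier P. M < \<bar>code_qm z g\<bar>"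
    using test_word_closed[OF z(2)] P.nat_pow_closed by blast
qed

end

definition code_qm0 :: "nat list \<Rightarrow> (int + 'b) list \<Rightarrow> real" where
  "code_qm0 z g = (if g \<in> carrier P then code_qm z g else 0)"

lemma code_qm0_mem:
  assumes ind: "freely_indecomposable B" and nZ: "\<not> B \<cong> integer_group" and z: "z \<noteq> []"
  shows "code_qm0 z \<in> Aut_qm_vanishing_on_letters B"
  unfolding Aut_qm_vanishing_on_letters_def
proof (intro CollectI conjI allI impI ballI)
  show "code_qm0 z g = 0" if "g \<notin> carrier P" for g using that by (simp add: code_qm0_def)
  show "quasimorphism P (code_qm0 z)"
    using P.quasimorphism_homogenisation[OF weighted_code_qm_bound[OF z]]
    by (simp add: quasimorphism_def code_qm0_def)
  show "homogeneous P (code_qm0 z)"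
    using P.homogeneous_homogenisation[OF weighted_code_qm_bound[OF z]]
    by (simp add: homogeneous_def code_qm0_def)
  show "Aut_invariant P (code_qm0 z)"
    using code_qm_Aut_invariant[OF assms]
    by (auto simp: Aut_invariant_def code_qm0_def auto_def hom_def)
  show "code_qm0 z g = 0" if "g \<in> letters integer_group B" for g
    using code_qm_letter[OF z that] by (simp add: code_qm0_def)
qed

end

text \<open>Three is the smallest possible length: a tuple with one or two entries reappears
  reversed in its square. Different \<open>m\<close> give triples without common entries.\<close>

lemma generic_triple: "generic [3 * m + 1, 3 * m + 2, 3 * m + 3]"
  by (auto simp: generic_def sublist_Cons_right)

section \<open>Infinite dimension\<close>

lemma sum_fun_apply: "(\<Sum>v\<in>A. f v) x = (\<Sum>v\<in>A. f v x)" for f :: "'c \<Rightarrow> 'a \<Rightarrow> real"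
  by (induction A rule: infinite_finite_induct) auto

text \<open>The points \<open>x\<close> are dual to the functions \<open>F\<close>: evaluating a
  linear relation at \<open>x m\<close> isolates one coefficient.\<close>

lemma infinite_dimensionalI:
  fixes F :: "nat \<Rightarrow> 'a \<Rightarrow> real" and x :: "nat \<Rightarrow> 'a"
  assumes V: "\<And>m. F m \<in> V" and diag: "\<And>m. F m (x m) \<noteq> 0"
    and off: "\<And>m n. m \<noteq> n \<Longrightarrow> F m (x n) = 0"
  shows "infinite_dimensional V"
  unfolding infinite_dimensional_def
proof
  assume "\<exists>S. finite S \<and> S \<subseteq> V \<and> V \<subseteq> fun_space.span S"
  then obtain S where S: "finite S" "V \<subseteq> fun_space.span S" by blast
  have inj: "inj F" using diag off by (metis injI)
  have "fun_space.independent (range F)"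
    unfolding fun_space.dependent_explicit
  proof
    assume "\<exists>R u. finite R \<and> R \<subseteq> range F \<and> (\<Sum>v\<in>R. fun_scale (u v) v) = 0 \<and> (\<exists>v\<in>R. u v \<noteq> 0)"
    then obtain R u m where R: "finite R" "R \<subseteq> range F" "(\<Sum>v\<in>R. fun_scale (u v) v) = 0"
      and m: "F m \<in> R" "u (F m) \<noteq> 0" by blast
    have "0 = (\<Sum>v\<in>R. fun_scale (u v) v) (x m)" using R(3) by simp
    also have "\<dots> = (\<Sum>v\<in>R. u v * v (x m))" by (simp add: sum_fun_apply fun_scale_def)
    also have "\<dots> = (\<Sum>v\<in>{F m}. u v * v (x m))"
    proof (rule sum.mono_neutral_right)
      show "\<forall>v\<in>R - {F m}. u v * v (x m) = 0"
      proof
        fix v assume v: "v \<in> R - {F m}"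
        then obtain n where "v = F n" using R(2) by blast
        then show "u v * v (x m) = 0" using v off[of n m] by auto
      qed
    qed (use R(1) m(1) in auto)
    finally show False using m(2) diag[of m] by simp
  qed
  moreover have "range F \<subseteq> fun_space.span S" using V S(2) by blast
  ultimately have "finite (range F)" using fun_space.independent_span_bound[OF S(1)] by blast
  then show False using inj by (simp add: finite_image_iff)
qed

theorem proposition5p7:
  fixes B :: "('b, 'm) monoid_scheme"
  assumes "group B"
    and "freely_indecomposable B"
    and "\<not> B \<cong> integer_group"
  shows "(\<forall>z. generic z \<longrightarrow>
            (let \<psi> = homogenisation (free_product integer_group B) (weighted_code_qm B z) in
               quasimorphism (free_product integer_group B) \<psi> \<and>
               Aut_invariant (free_product integer_group B) \<psi> \<and>
               unbounded_on (carrier (free_product integer_group B)) \<psi>)) \<and>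
         infinite_dimensional (Aut_qm_vanishing_on_letters B)"
proof -
  interpret free_product_Z B using assms(1) by (rule free_product_Z.intro)
  have "\<one>\<^bsub>B\<^esub> \<in> carrier B" "carrier B \<noteq> {\<one>\<^bsub>B\<^esub>}"
    using assms(2) by (auto simp: freely_indecomposable_def)
  then obtain b where b: "b \<in> carrier B" "b \<noteq> \<one>\<^bsub>B\<^esub>" by blast
  have "quasimorphism P (code_qm z) \<and> Aut_invariant P (code_qm z) \<and> unbounded_on (carrier P) (code_qm z)"
    if z: "generic z" for z
  proof -
    have "z \<noteq> []" using z by (simp add: generic_def)
    then show ?thesis
      using P.quasimorphism_homogenisation[OF weighted_code_qm_bound[OF \<open>z \<noteq> []\<close>]]
        code_qm_Aut_invariant[OF assms(2,3)] code_qm_unbounded[OF b z] by blast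
  qed
  moreover have "infinite_dimensional (Aut_qm_vanishing_on_letters B)"
  proof (rule infinite_dimensionalI)
    let ?z = "\<lambda>m::nat. [3 * m + 1, 3 * m + 2, 3 * m + 3]"
    have nz: "?z m \<noteq> []" "0 \<notin> set (?z m)" for m by auto
    show "code_qm0 (?z m) \<in> Aut_qm_vanishing_on_letters B" for m
      by (rule code_qm0_mem[OF assms(2,3) nz(1)])
    show "code_qm0 (?z m) (test_word b (?z m)) \<noteq> 0" for m
      using code_qm_test_word_pos[OF b generic_triple[of m]] test_word_closed[OF b nz(2)[of m]]
      by (simp add: code_qm0_def)
    show "code_qm0 (?z m) (test_word b (?z n)) = 0" if "m \<noteq> n" for m n
    proof -
      have "set (?z m) \<inter> set (?z n) = {}" using that by auto
      then show ?thesis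
        using code_qm_test_word_disjoint[OF b nz(1)[of m] nz(2)[of n]] by (simp add: code_qm0_def)
    qed
  qed
  ultimately show ?thesis by (simp add: Let_def)
qed

end
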